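(* Let $T$ be a computably enumerable extension of $\mathrm{I}\Delta_0+\mathsf{Exp}$ in the language of arithmetic, and let $A$ be a collection of arithmetical sentences such that $A\subseteq\Sigma_n$ for some $n\in\omega$ and $T\cup A$ is consistent. Then $T\cup A$ is incomplete.
   Context: The language of arithmetic is $\{0,1,+,\cdot,<\}$. $\Sigma_0=\Pi_0=\Delta_0$ formulae are those in which all quantifiers are bounded; $\Sigma_{n}$ is the usual arithmetical hierarchy built over $\Delta_0$ by alternating blocks of unbounded quantifiers starting with an existential block. $\mathrm{I}\Delta_0$ is the fragment of Peano Arithmetic in which the induction scheme is restricted to $\Delta_0$-formulae, and $\mathsf{Exp}$ is the arithmetical sentence asserting that the exponential function $x\mapsto 2^x$ is total. A theory is incomplete if there is a sentence $\psi$ such that it proves neither $\psi$ nor $\neg\psi$. *)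

theory Defs
  imports "HOL-Library.Nat_Bijection"
begin

section \<open>Syntax of first-order arithmetic\<close>

text \<open>
  Variables are de Bruijn indices; the primitive connectives are falsum, implication and the
  universal quantifier, the others being the usual classical abbreviations.
\<close>

datatype tm = Var nat | Zero | One | Add tm tm | Mul tm tm

datatype fm = Equal tm tm | Less tm tm | Falsum | Imp fm fm | Forall fm

abbreviation Neg :: "fm \<Rightarrow> fm" where
  "Neg \<phi> \<equiv> Imp \<phi> Falsum"

abbreviation Conj :: "fm \<Rightarrow> fm \<Rightarrow> fm" where
  "Conj \<phi> \<psi> \<equiv> Neg (Imp \<phi> (Neg \<psi>))"

abbreviation Disj :: "fm \<Rightarrow> fm \<Rightarrow> fm" where
  "Disj \<phi> \<psi> \<equiv> Imp (Neg \<phi>) \<psi>"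

abbreviation Exists :: "fm \<Rightarrow> fm" where
  "Exists \<phi> \<equiv> Neg (Forall (Neg \<phi>))"

primrec subst_tm :: "(nat \<Rightarrow> tm) \<Rightarrow> tm \<Rightarrow> tm" where
  "subst_tm \<sigma> (Var n) = \<sigma> n"
| "subst_tm \<sigma> Zero = Zero"
| "subst_tm \<sigma> One = One"
| "subst_tm \<sigma> (Add s t) = Add (subst_tm \<sigma> s) (subst_tm \<sigma> t)"
| "subst_tm \<sigma> (Mul s t) = Mul (subst_tm \<sigma> s) (subst_tm \<sigma> t)"

abbreviation lift_tm :: "tm \<Rightarrow> tm" where
  "lift_tm \<equiv> subst_tm (\<lambda>n. Var (Suc n))"

definition up :: "(nat \<Rightarrow> tm) \<Rightarrow> nat \<Rightarrow> tm" where
  "up \<sigma> n = (case n of 0 \<Rightarrow> Var 0 | Suc m \<Rightarrow> lift_tm (\<sigma> m))"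

primrec subst_fm :: "(nat \<Rightarrow> tm) \<Rightarrow> fm \<Rightarrow> fm" where
  "subst_fm \<sigma> (Equal s t) = Equal (subst_tm \<sigma> s) (subst_tm \<sigma> t)"
| "subst_fm \<sigma> (Less s t) = Less (subst_tm \<sigma> s) (subst_tm \<sigma> t)"
| "subst_fm \<sigma> Falsum = Falsum"
| "subst_fm \<sigma> (Imp \<phi> \<psi>) = Imp (subst_fm \<sigma> \<phi>) (subst_fm \<sigma> \<psi>)"
| "subst_fm \<sigma> (Forall \<phi>) = Forall (subst_fm (up \<sigma>) \<phi>)"

abbreviation lift_fm :: "fm \<Rightarrow> fm" where
  "lift_fm \<equiv> subst_fm (\<lambda>n. Var (Suc n))"

text \<open>Instantiation of the outermost variable, the remaining ones moving down by one.\<close>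

definition inst :: "fm \<Rightarrow> tm \<Rightarrow> fm" where
  "inst \<phi> t = subst_fm (\<lambda>n. case n of 0 \<Rightarrow> t | Suc m \<Rightarrow> Var m) \<phi>"

text \<open>All free variables have an index below \<open>k\<close>.\<close>

primrec closed_tm :: "nat \<Rightarrow> tm \<Rightarrow> bool" where
  "closed_tm k (Var n) \<longleftrightarrow> n < k"
| "closed_tm k Zero \<longleftrightarrow> True"
| "closed_tm k One \<longleftrightarrow> True"
| "closed_tm k (Add s t) \<longleftrightarrow> closed_tm k s \<and> closed_tm k t"
| "closed_tm k (Mul s t) \<longleftrightarrow> closed_tm k s \<and> closed_tm k t"

primrec closed_fm :: "nat \<Rightarrow> fm \<Rightarrow> bool" where
  "closed_fm k (Equal s t) \<longleftrightarrow> closed_tm k s \<and> closed_tm k t"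
| "closed_fm k (Less s t) \<longleftrightarrow> closed_tm k s \<and> closed_tm k t"
| "closed_fm k Falsum \<longleftrightarrow> True"
| "closed_fm k (Imp \<phi> \<psi>) \<longleftrightarrow> closed_fm k \<phi> \<and> closed_fm k \<psi>"
| "closed_fm k (Forall \<phi>) \<longleftrightarrow> closed_fm (Suc k) \<phi>"

definition sentence :: "fm \<Rightarrow> bool" where
  "sentence \<phi> \<longleftrightarrow> closed_fm 0 \<phi>"

section \<open>The arithmetical hierarchy\<close>

text \<open>Lifting the bound ensures that it does not contain the quantified variable.\<close>

definition BForall :: "tm \<Rightarrow> fm \<Rightarrow> fm" where
  "BForall t \<phi> = Forall (Imp (Less (Var 0) (lift_tm t)) \<phi>)"

definition BExists :: "tm \<Rightarrow> fm \<Rightarrow> fm" where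
  "BExists t \<phi> = Exists (Conj (Less (Var 0) (lift_tm t)) \<phi>)"

inductive_set Delta0 :: "fm set" where
  "Equal s t \<in> Delta0"
| "Less s t \<in> Delta0"
| "Falsum \<in> Delta0"
| "\<phi> \<in> Delta0 \<Longrightarrow> \<psi> \<in> Delta0 \<Longrightarrow> Imp \<phi> \<psi> \<in> Delta0"
| "\<phi> \<in> Delta0 \<Longrightarrow> BForall t \<phi> \<in> Delta0"
| "\<phi> \<in> Delta0 \<Longrightarrow> BExists t \<phi> \<in> Delta0"

text \<open>Quantifier blocks may have any length, including zero, so that the hierarchy is cumulative.\<close>

fun Sigma_fm :: "nat \<Rightarrow> fm set" and Pi_fm :: "nat \<Rightarrow> fm set" where
  "Sigma_fm 0 = Delta0"
| "Pi_fm 0 = Delta0"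
| "Sigma_fm (Suc n) = {(Exists ^^ k) \<phi> | k \<phi>. \<phi> \<in> Pi_fm n}"
| "Pi_fm (Suc n) = {(Forall ^^ k) \<phi> | k \<phi>. \<phi> \<in> Sigma_fm n}"

section \<open>Provability\<close>

text \<open>Natural deduction for classical first-order logic with equality.\<close>

inductive proves :: "fm set \<Rightarrow> fm \<Rightarrow> bool" (infix "\<turnstile>" 50) where
  Assm: "\<phi> \<in> \<Gamma> \<Longrightarrow> \<Gamma> \<turnstile> \<phi>"
| ImpI: "insert \<phi> \<Gamma> \<turnstile> \<psi> \<Longrightarrow> \<Gamma> \<turnstile> Imp \<phi> \<psi>"
| ImpE: "\<Gamma> \<turnstile> Imp \<phi> \<psi> \<Longrightarrow> \<Gamma> \<turnstile> \<phi> \<Longrightarrow> \<Gamma> \<turnstile> \<psi>"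
| Contr: "insert (Neg \<phi>) \<Gamma> \<turnstile> Falsum \<Longrightarrow> \<Gamma> \<turnstile> \<phi>"
| ForallI: "lift_fm ` \<Gamma> \<turnstile> \<phi> \<Longrightarrow> \<Gamma> \<turnstile> Forall \<phi>"
| ForallE: "\<Gamma> \<turnstile> Forall \<phi> \<Longrightarrow> \<Gamma> \<turnstile> inst \<phi> t"
| EqRefl: "\<Gamma> \<turnstile> Equal t t"
| EqSubst: "\<Gamma> \<turnstile> Equal s t \<Longrightarrow> \<Gamma> \<turnstile> inst \<phi> s \<Longrightarrow> \<Gamma> \<turnstile> inst \<phi> t"

definition consistent :: "fm set \<Rightarrow> bool" where
  "consistent U \<longleftrightarrow> \<not> U \<turnstile> Falsum"

definition incomplete :: "fm set \<Rightarrow> bool" where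
  "incomplete U \<longleftrightarrow> (\<exists>\<psi>. sentence \<psi> \<and> \<not> U \<turnstile> \<psi> \<and> \<not> U \<turnstile> Neg \<psi>)"

section \<open>The theory \<open>I\<Delta>\<^sub>0 + Exp\<close>\<close>

text \<open>
  The axioms of discretely ordered commutative semirings (usually written PA with a superscript
  minus), to which Peano Arithmetic in this language adds full induction.
\<close>

definition PA_minus :: "fm set" where
  "PA_minus =
    (let x = Var 0; y = Var 1; z = Var 2 in
    {Forall (Forall (Forall (Equal (Add (Add x y) z) (Add x (Add y z))))),
     Forall (Forall (Equal (Add x y) (Add y x))),
     Forall (Forall (Forall (Equal (Mul (Mul x y) z) (Mul x (Mul y z))))),
     Forall (Forall (Equal (Mul x y) (Mul y x))),
     Forall (Forall (Forall (Equal (Mul x (Add y z)) (Add (Mul x y) (Mul x z))))),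
     Forall (Equal (Add x Zero) x),
     Forall (Equal (Mul x Zero) Zero),
     Forall (Equal (Mul x One) x),
     Forall (Forall (Forall (Imp (Conj (Less x y) (Less y z)) (Less x z)))),
     Forall (Neg (Less x x)),
     Forall (Forall (Disj (Less x y) (Disj (Equal x y) (Less y x)))),
     Forall (Forall (Forall (Imp (Less x y) (Less (Add x z) (Add y z))))),
     Forall (Forall (Forall (Imp (Conj (Less Zero z) (Less x y)) (Less (Mul x z) (Mul y z))))),
     Forall (Forall (Imp (Less x y) (Exists (Equal (Add (Var 1) (Var 0)) (Var 2))))),
     Less Zero One,
     Forall (Imp (Less Zero x) (Disj (Less One x) (Equal One x))),
     Forall (Disj (Less Zero x) (Equal Zero x))})"

text \<open>Induction on the variable \<open>0\<close> of \<open>\<phi>\<close>, the other free variables being parameters.\<close>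

definition induction_fm :: "fm \<Rightarrow> fm" where
  "induction_fm \<phi> =
    Imp (Conj (inst \<phi> Zero)
              (Forall (Imp \<phi> (subst_fm (\<lambda>n. case n of 0 \<Rightarrow> Add (Var 0) One
                                                   | Suc m \<Rightarrow> Var (Suc m)) \<phi>))))
        (Forall \<phi>)"

definition IDelta0 :: "fm set" where
  "IDelta0 = PA_minus \<union>
    {(Forall ^^ k) (induction_fm \<phi>) | k \<phi>. \<phi> \<in> Delta0 \<and> closed_fm k (induction_fm \<phi>)}"

text \<open>
  Goedel's beta function: \<open>r\<close> is the remainder of \<open>a\<close> modulo \<open>1 + (i + 1) * b\<close>; the quotient is
  at most \<open>a\<close>.
\<close>

definition beta_fm :: "tm \<Rightarrow> tm \<Rightarrow> tm \<Rightarrow> tm \<Rightarrow> fm" where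
  "beta_fm a b i r =
    (let m = Add One (Mul (Add i One) b) in
      Conj (Less r m)
           (BExists (Add a One)
              (Equal (lift_tm a) (Add (Mul (Var 0) (lift_tm m)) (lift_tm r)))))"

text \<open>
  The formula \<open>2\<^sup>x = y\<close>: some \<open>a, b\<close> beta-code a sequence of length \<open>x + 1\<close> which starts
  with \<open>1\<close>, doubles at each step, and ends with \<open>y\<close>. In the matrix, \<open>a\<close> and \<open>b\<close> are
  \<open>Var 1\<close> and \<open>Var 0\<close>; under the two bounded quantifiers, over \<open>i < x\<close> and over the entry
  \<open>r \<le> a\<close> at position \<open>i\<close>, the variables \<open>r, i, b, a\<close> are \<open>Var 0, \<dots>, Var 3\<close>.
\<close>

definition pow2_fm :: "tm \<Rightarrow> tm \<Rightarrow> fm" where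
  "pow2_fm x y =
    Exists (Exists
     (Conj (beta_fm (Var 1) (Var 0) Zero One)
     (Conj (BForall (lift_tm (lift_tm x))
              (BExists (Add (Var 2) One)
                 (Conj (beta_fm (Var 3) (Var 2) (Var 1) (Var 0))
                       (beta_fm (Var 3) (Var 2) (Add (Var 1) One) (Add (Var 0) (Var 0))))))
           (beta_fm (Var 1) (Var 0) (lift_tm (lift_tm x)) (lift_tm (lift_tm y))))))"

definition Exp :: fm where
  "Exp = Forall (Exists (pow2_fm (Var 1) (Var 0)))"

definition extends :: "fm set \<Rightarrow> fm set \<Rightarrow> bool" where
  "extends T S \<longleftrightarrow> (\<forall>\<phi>\<in>S. T \<turnstile> \<phi>)"

section \<open>Computable enumerability\<close>

text \<open>Partial recursive functions; \<open>computes f xs y\<close> means that \<open>f\<close> halts on \<open>xs\<close> with value \<open>y\<close>.\<close>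

datatype recf =
  ZeroF | SuccF | Proj nat | Comp recf "recf list" | PrimRec recf recf | Mu recf

inductive computes :: "recf \<Rightarrow> nat list \<Rightarrow> nat \<Rightarrow> bool" where
  "computes ZeroF xs 0"
| "computes SuccF [x] (Suc x)"
| "i < length xs \<Longrightarrow> computes (Proj i) xs (xs ! i)"
| "list_all2 (\<lambda>g y. computes g xs y) gs ys \<Longrightarrow> computes f ys z \<Longrightarrow> computes (Comp f gs) xs z"
| "computes f xs z \<Longrightarrow> computes (PrimRec f g) (0 # xs) z"
| "computes (PrimRec f g) (n # xs) y \<Longrightarrow> computes g (n # y # xs) z \<Longrightarrow>
   computes (PrimRec f g) (Suc n # xs) z"
| "computes f (n # xs) 0 \<Longrightarrow> (\<And>m. m < n \<Longrightarrow> \<exists>k. computes f (m # xs) (Suc k)) \<Longrightarrow>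
   computes (Mu f) xs n"

definition ce_nat :: "nat set \<Rightarrow> bool" where
  "ce_nat W \<longleftrightarrow> (\<exists>f. W = {x. \<exists>y. computes f [x] y})"

primrec tm_code :: "tm \<Rightarrow> nat" where
  "tm_code (Var n) = prod_encode (0, n)"
| "tm_code Zero = prod_encode (1, 0)"
| "tm_code One = prod_encode (2, 0)"
| "tm_code (Add s t) = prod_encode (3, prod_encode (tm_code s, tm_code t))"
| "tm_code (Mul s t) = prod_encode (4, prod_encode (tm_code s, tm_code t))"

primrec fm_code :: "fm \<Rightarrow> nat" where
  "fm_code (Equal s t) = prod_encode (0, prod_encode (tm_code s, tm_code t))"
| "fm_code (Less s t) = prod_encode (1, prod_encode (tm_code s, tm_code t))"
| "fm_code Falsum = prod_encode (2, 0)"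
| "fm_code (Imp \<phi> \<psi>) = prod_encode (3, prod_encode (fm_code \<phi>, fm_code \<psi>))"
| "fm_code (Forall \<phi>) = prod_encode (4, fm_code \<phi>)"

definition computably_enumerable :: "fm set \<Rightarrow> bool" where
  "computably_enumerable T \<longleftrightarrow> ce_nat (fm_code ` T)"

end

(*
  Suppose that the consistent theory U = T + A is complete, and let M be a model of U.

  Over IDelta0 + Exp every Delta0-definable bounded set has a code, read off the binary digits of a
  number with the help of the powers of 2 provided by Exp. Hence there are coded certificates for
  the evaluation of Delta0 formulas, and a single formula S such that S(c) is equivalent to sigma,
  where c is a code of the Sigma_n sentence sigma. The assignment of codes need not be computable,
  because only the set of codes of A matters and this set is arbitrary anyway.

  As T is computably enumerable, "the sentences with codes in the finite set l prove phi over T" is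
  a Sigma_1 relation of l and phi, with a Delta0 matrix that is absolute between the standard model
  and M. Together with S for the truth of the members of l and a Rosser comparison of witnesses,
  which makes nonstandard witnesses harmless, it yields a definition of truth in M for standard
  sentences, contradicting Tarski's theorem.
*)
theory Submission
  imports Defs "HOL-Number_Theory.Cong" "HOL-Library.Countable_Set"
begin

section \<open>Structures and soundness\<close>

text \<open>The bound n takes the place of enumerability: the formula \<open>S\<close> of the main
  proof says of a number l that all sentences coded in l are true, and a sentence provable from T +
  A follows from T and some \<open>at_num S l\<close> that holds in M. But \<open>all_true\<close>
  is merely arithmetical, and its meaning is under control only for standard l. The Rosser
  comparison therefore bounds l along with the proof witness z, for below a standard bound both are
  standard. Completeness of T + A provides a standard witness for the diagonal sentence or for its
  negation, whichever holds in M, and this settles the comparison at a standard bound. Agreement of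
  \<open>S\<close> with the sentences is verified in models only; the completeness theorem turns it
  into derivability. Since HOL cannot quantify over carrier types, these models live on
  \<open>nat\<close>, which is possible because models of \<open>PA_minus\<close> are
  infinite.\<close>

datatype 'a str =
  Str (zr: 'a) (un: 'a) (ad: "'a \<Rightarrow> 'a \<Rightarrow> 'a") (mu: "'a \<Rightarrow> 'a \<Rightarrow> 'a") (ls: "'a \<Rightarrow> 'a \<Rightarrow> bool")

abbreviation scons :: "'a \<Rightarrow> (nat \<Rightarrow> 'a) \<Rightarrow> nat \<Rightarrow> 'a" (infixr "##" 65) where
  "x ## e \<equiv> case_nat x e"

primrec val :: "'a str \<Rightarrow> (nat \<Rightarrow> 'a) \<Rightarrow> tm \<Rightarrow> 'a" where
  "val M e (Var n) = e n"
| "val M e Zero = zr M"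
| "val M e One = un M"
| "val M e (Add s t) = ad M (val M e s) (val M e t)"
| "val M e (Mul s t) = mu M (val M e s) (val M e t)"

primrec sat :: "'a str \<Rightarrow> (nat \<Rightarrow> 'a) \<Rightarrow> fm \<Rightarrow> bool" where
  "sat M e (Equal s t) \<longleftrightarrow> val M e s = val M e t"
| "sat M e (Less s t) \<longleftrightarrow> ls M (val M e s) (val M e t)"
| "sat M e Falsum \<longleftrightarrow> False"
| "sat M e (Imp \<phi> \<psi>) \<longleftrightarrow> (sat M e \<phi> \<longrightarrow> sat M e \<psi>)"
| "sat M e (Forall \<phi>) \<longleftrightarrow> (\<forall>x. sat M (x ## e) \<phi>)"

lemma val_subst [simp]: "val M e (subst_tm \<sigma> t) = val M (\<lambda>n. val M e (\<sigma> n)) t"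
  by (induction t) auto

lemma val_up: "(\<lambda>n. val M (x ## e) (up \<sigma> n)) = x ## (\<lambda>n. val M e (\<sigma> n))"
  by (auto simp: up_def fun_eq_iff split: nat.splits)

lemma sat_subst [simp]: "sat M e (subst_fm \<sigma> \<phi>) = sat M (\<lambda>n. val M e (\<sigma> n)) \<phi>"
  by (induction \<phi> arbitrary: e \<sigma>) (auto simp: val_up)

lemma sat_inst [simp]: "sat M e (inst \<phi> t) = sat M (val M e t ## e) \<phi>"
proof -
  have "(\<lambda>n. val M e (case n of 0 \<Rightarrow> t | Suc m \<Rightarrow> Var m)) = val M e t ## e"
    by (auto simp: fun_eq_iff split: nat.splits)
  then show ?thesis by (simp add: inst_def)
qed

lemma sat_BForall [simp]:
  "sat M e (BForall t \<phi>) \<longleftrightarrow> (\<forall>x. ls M x (val M e t) \<longrightarrow> sat M (x ## e) \<phi>)"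
  by (simp add: BForall_def)

lemma sat_BExists [simp]:
  "sat M e (BExists t \<phi>) \<longleftrightarrow> (\<exists>x. ls M x (val M e t) \<and> sat M (x ## e) \<phi>)"
  by (auto simp: BExists_def)

lemma soundness: "\<Gamma> \<turnstile> \<phi> \<Longrightarrow> \<forall>\<gamma>\<in>\<Gamma>. sat M e \<gamma> \<Longrightarrow> sat M e \<phi>"
proof (induction arbitrary: e rule: proves.induct)
  case (Contr \<phi> \<Gamma>)
  then show ?case by (metis insert_iff sat.simps(3,4))
next
  case (ForallI \<Gamma> \<phi>)
  then show ?case by simp
qed auto

lemma val_agree: "closed_tm k t \<Longrightarrow> \<forall>n<k. e n = e' n \<Longrightarrow> val M e t = val M e' t"
  by (induction t) auto

lemma sat_agree: "closed_fm k \<phi> \<Longrightarrow> \<forall>n<k. e n = e' n \<Longrightarrow> sat M e \<phi> = sat M e' \<phi>"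
proof (induction \<phi> arbitrary: e e' k)
  case (Forall \<phi>)
  have "sat M (x ## e) \<phi> = sat M (x ## e') \<phi>" for x
    by (rule Forall.IH[of "Suc k"]) (use Forall.prems in \<open>auto split: nat.splits\<close>)
  then show ?case by simp
next
  case (Imp \<phi> \<psi>)
  then show ?case by (metis closed_fm.simps(4) sat.simps(4))
qed (use val_agree in \<open>auto; metis\<close>)+

lemma sat_sentence: "sentence \<phi> \<Longrightarrow> sat M e \<phi> = sat M e' \<phi>"
  using sat_agree[of 0] by (simp add: sentence_def)

section \<open>Free variables and simultaneous substitution\<close>

lemma closed_tm_mono: "closed_tm k t \<Longrightarrow> k \<le> m \<Longrightarrow> closed_tm m t"
  by (induction t) auto

lemma closed_fm_mono: "closed_fm k \<phi> \<Longrightarrow> k \<le> m \<Longrightarrow> closed_fm m \<phi>"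
proof (induction \<phi> arbitrary: k m)
  case (Forall \<phi>)
  then show ?case using Forall.IH[of "Suc k" "Suc m"] by simp
qed (auto intro: closed_tm_mono)

lemma closed_tm_ex: "\<exists>k. closed_tm k t"
proof (induction t)
  case (Add s t) then show ?case by (metis closed_tm.simps(4) closed_tm_mono max.cobounded1 max.cobounded2)
next
  case (Mul s t) then show ?case by (metis closed_tm.simps(5) closed_tm_mono max.cobounded1 max.cobounded2)
qed auto

lemma closed_fm_ex: "\<exists>k. closed_fm k \<phi>"
proof (induction \<phi>)
  case (Equal s t) then show ?case
    by (metis closed_fm.simps(1) closed_tm_ex closed_tm_mono max.cobounded1 max.cobounded2)
next
  case (Less s t) then show ?case
    by (metis closed_fm.simps(2) closed_tm_ex closed_tm_mono max.cobounded1 max.cobounded2)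
next
  case (Imp \<phi> \<psi>) then show ?case
    by (metis closed_fm.simps(4) closed_fm_mono max.cobounded1 max.cobounded2)
next
  case (Forall \<phi>) then show ?case by (metis closed_fm.simps(5) closed_fm_mono le_Suc_eq order_refl)
qed auto

lemma closed_tm_subst: "closed_tm k t \<Longrightarrow> \<forall>n<k. closed_tm m (\<sigma> n) \<Longrightarrow> closed_tm m (subst_tm \<sigma> t)"
  by (induction t) auto

lemma closed_fm_subst: "closed_fm k \<phi> \<Longrightarrow> \<forall>n<k. closed_tm m (\<sigma> n) \<Longrightarrow> closed_fm m (subst_fm \<sigma> \<phi>)"
proof (induction \<phi> arbitrary: k m \<sigma>)
  case (Forall \<phi>)
  have "closed_fm (Suc m) (subst_fm (up \<sigma>) \<phi>)"
    by (rule Forall.IH[of "Suc k"])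
      (use Forall.prems in \<open>auto simp: up_def split: nat.splits intro!: closed_tm_subst\<close>)
  then show ?case by simp
qed (auto intro: closed_tm_subst)

lemma subst_tm_Var [simp]: "subst_tm Var t = t"
  by (induction t) auto

lemma up_Var [simp]: "up Var = Var"
  by (auto simp: up_def fun_eq_iff split: nat.splits)

lemma subst_fm_Var [simp]: "subst_fm Var \<phi> = \<phi>"
  by (induction \<phi>) auto

lemma subst_tm_comp: "subst_tm \<sigma> (subst_tm \<tau> t) = subst_tm (\<lambda>n. subst_tm \<sigma> (\<tau> n)) t"
  by (induction t) auto

lemma subst_tm_up_lift: "subst_tm (up \<sigma>) (lift_tm t) = lift_tm (subst_tm \<sigma> t)"
  by (simp add: subst_tm_comp up_def)

lemma up_comp: "(\<lambda>n. subst_tm (up \<sigma>) (up \<tau> n)) = up (\<lambda>n. subst_tm \<sigma> (\<tau> n))"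
proof
  fix n show "subst_tm (up \<sigma>) (up \<tau> n) = up (\<lambda>n. subst_tm \<sigma> (\<tau> n)) n"
    using subst_tm_up_lift by (cases n) (auto simp: up_def)
qed

lemma subst_fm_comp: "subst_fm \<sigma> (subst_fm \<tau> \<phi>) = subst_fm (\<lambda>n. subst_tm \<sigma> (\<tau> n)) \<phi>"
  by (induction \<phi> arbitrary: \<sigma> \<tau>) (auto simp: subst_tm_comp up_comp)

lemma subst_tm_cong: "closed_tm k t \<Longrightarrow> \<forall>n<k. \<sigma> n = \<tau> n \<Longrightarrow> subst_tm \<sigma> t = subst_tm \<tau> t"
  by (induction t) auto

lemma subst_fm_cong: "closed_fm k \<phi> \<Longrightarrow> \<forall>n<k. \<sigma> n = \<tau> n \<Longrightarrow> subst_fm \<sigma> \<phi> = subst_fm \<tau> \<phi>"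
proof (induction \<phi> arbitrary: k \<sigma> \<tau>)
  case (Forall \<phi>)
  have "subst_fm (up \<sigma>) \<phi> = subst_fm (up \<tau>) \<phi>"
    by (rule Forall.IH[of "Suc k"]) (use Forall.prems in \<open>auto simp: up_def split: nat.splits\<close>)
  then show ?case by simp
qed (auto intro: subst_tm_cong)

lemma subst_sentence: "sentence \<phi> \<Longrightarrow> subst_fm \<sigma> \<phi> = \<phi>"
  using subst_fm_cong[of 0 \<phi> \<sigma> Var] by (simp add: sentence_def)

lemma subst_lift_fm: "subst_fm (up \<sigma>) (lift_fm \<phi>) = lift_fm (subst_fm \<sigma> \<phi>)"
  by (simp add: subst_fm_comp up_def)

lemma subst_inst: "subst_fm \<sigma> (inst \<phi> t) = inst (subst_fm (up \<sigma>) \<phi>) (subst_tm \<sigma> t)"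
proof -
  have "(\<lambda>n. subst_tm \<sigma> (case n of 0 \<Rightarrow> t | Suc m \<Rightarrow> Var m)) =
    (\<lambda>n. subst_tm (\<lambda>n. case n of 0 \<Rightarrow> subst_tm \<sigma> t | Suc m \<Rightarrow> Var m) (up \<sigma> n))"
    by (auto simp: fun_eq_iff up_def subst_tm_comp split: nat.splits)
  then show ?thesis by (simp add: inst_def subst_fm_comp)
qed

text \<open>\<open>ForallI\<close> shifts the whole context instead of naming an eigenvariable.
  Closure under arbitrary substitutions later allows a fresh variable to be renamed into this
  form.\<close>

lemma proves_subst: "\<Gamma> \<turnstile> \<phi> \<Longrightarrow> subst_fm \<sigma> ` \<Gamma> \<turnstile> subst_fm \<sigma> \<phi>"
proof (induction arbitrary: \<sigma> rule: proves.induct)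
  case (ImpI \<phi> \<Gamma> \<psi>)
  then show ?case by (auto intro: proves.ImpI)
next
  case (ImpE \<Gamma> \<phi> \<psi>)
  then show ?case by (metis proves.ImpE subst_fm.simps(4))
next
  case (Contr \<phi> \<Gamma>)
  from Contr.IH[of \<sigma>] show ?case by (auto intro: proves.Contr)
next
  case (ForallI \<Gamma> \<phi>)
  from ForallI.IH[of "up \<sigma>"] show ?case
    by (auto simp: image_image subst_lift_fm intro: proves.ForallI)
next
  case (ForallE \<Gamma> \<phi> t)
  then show ?case by (auto simp: subst_inst intro: proves.ForallE)
next
  case (EqSubst \<Gamma> s t \<phi>)
  then show ?case unfolding subst_inst
    by (metis proves.EqSubst subst_fm.simps(1))
qed (auto intro: proves.intros)

lemma weakening: "\<Gamma> \<turnstile> \<phi> \<Longrightarrow> \<Gamma> \<subseteq> \<Delta> \<Longrightarrow> \<Delta> \<turnstile> \<phi>"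
proof (induction arbitrary: \<Delta> rule: proves.induct)
  case (ImpI \<phi> \<Gamma> \<psi>) then show ?case by (meson insert_mono proves.ImpI)
next
  case (Contr \<phi> \<Gamma>) then show ?case by (meson insert_mono proves.Contr)
next
  case (ForallI \<Gamma> \<phi>) then show ?case using image_mono[of \<Gamma> \<Delta> lift_fm] by (blast intro: proves.ForallI)
qed (blast intro: proves.intros)+

lemma compactness: "\<Gamma> \<turnstile> \<phi> \<Longrightarrow> \<exists>F. finite F \<and> F \<subseteq> \<Gamma> \<and> F \<turnstile> \<phi>"
proof (induction rule: proves.induct)
  case (Assm \<phi> \<Gamma>)
  then have "finite {\<phi>}" "{\<phi>} \<subseteq> \<Gamma>" "{\<phi>} \<turnstile> \<phi>" by (auto intro: proves.Assm)
  then show ?case by blast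
next
  case (ImpI \<phi> \<Gamma> \<psi>)
  then obtain F where F: "finite F" "F \<subseteq> insert \<phi> \<Gamma>" "F \<turnstile> \<psi>" by blast
  have "finite (F - {\<phi>})" "F - {\<phi>} \<subseteq> \<Gamma>" using F by auto
  moreover have "F - {\<phi>} \<turnstile> Imp \<phi> \<psi>"
    by (rule proves.ImpI) (rule weakening[OF F(3)], auto)
  ultimately show ?case by blast
next
  case (ImpE \<Gamma> \<phi> \<psi>)
  then obtain F G where F: "finite F" "F \<subseteq> \<Gamma>" "F \<turnstile> Imp \<phi> \<psi>" "finite G" "G \<subseteq> \<Gamma>" "G \<turnstile> \<phi>" by blast
  have "F \<union> G \<turnstile> \<psi>" by (rule proves.ImpE[of _ \<phi>]) (use F weakening in blast)+
  then show ?case using F by (meson finite_UnI le_sup_iff)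
next
  case (Contr \<phi> \<Gamma>)
  then obtain F where F: "finite F" "F \<subseteq> insert (Neg \<phi>) \<Gamma>" "F \<turnstile> Falsum" by blast
  have "finite (F - {Neg \<phi>})" "F - {Neg \<phi>} \<subseteq> \<Gamma>" using F by auto
  moreover have "F - {Neg \<phi>} \<turnstile> \<phi>"
    by (rule proves.Contr) (rule weakening[OF F(3)], auto)
  ultimately show ?case by blast
next
  case (ForallI \<Gamma> \<phi>)
  then obtain F where F: "finite F" "F \<subseteq> lift_fm ` \<Gamma>" "F \<turnstile> \<phi>" by blast
  then obtain G where "G \<subseteq> \<Gamma>" "finite G" "F = lift_fm ` G" by (meson finite_subset_image)
  then show ?case using F by (blast intro: proves.ForallI)
next
  case (ForallE \<Gamma> \<phi> t) then show ?case by (meson proves.ForallE)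
next
  case (EqRefl \<Gamma> t) then show ?case by (meson finite.emptyI empty_subsetI proves.EqRefl)
next
  case (EqSubst \<Gamma> s t \<phi>)
  then obtain F G where F: "finite F" "F \<subseteq> \<Gamma>" "F \<turnstile> Equal s t" "finite G" "G \<subseteq> \<Gamma>" "G \<turnstile> inst \<phi> s" by blast
  have "F \<union> G \<turnstile> inst \<phi> t" by (rule proves.EqSubst[of _ s]) (use F weakening in blast)+
  then show ?case using F by (meson finite_UnI le_sup_iff)
qed

section \<open>The completeness theorem\<close>

instance tm :: countable by countable_datatype
instance fm :: countable by countable_datatype

lemma inst_Var_fresh:
  assumes "closed_fm (Suc k) \<psi>"
  shows "subst_fm (\<lambda>n. if n = k then Var 0 else Var (Suc n)) (inst \<psi> (Var k)) = \<psi>"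
proof -
  have "subst_fm (\<lambda>n. if n = k then Var 0 else Var (Suc n)) (inst \<psi> (Var k)) = subst_fm Var \<psi>"
    unfolding inst_def subst_fm_comp
    by (rule subst_fm_cong[OF assms]) (auto split: nat.splits)
  then show ?thesis by simp
qed

text \<open>For a variable \<open>k\<close> foreign to the context, the substitution taking k to 0
  and every other n to n + 1 shifts \<open>\<Gamma>\<close> and undoes the instantiation, so the
  assumption becomes a premise of \<open>ForallI\<close>.\<close>

lemma generalization:
  assumes "\<Gamma> \<turnstile> inst \<psi> (Var k)" "closed_fm (Suc k) \<psi>" "\<forall>\<gamma>\<in>\<Gamma>. closed_fm k \<gamma>"
  shows "\<Gamma> \<turnstile> Forall \<psi>"
proof -
  let ?\<sigma> = "\<lambda>n. if n = k then Var 0 else Var (Suc n)"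
  have "subst_fm ?\<sigma> ` \<Gamma> = lift_fm ` \<Gamma>"
    by (rule image_cong[OF refl]) (rule subst_fm_cong, use assms(3) in auto)
  with proves_subst[OF assms(1), of ?\<sigma>] show ?thesis
    by (simp add: inst_Var_fresh[OF assms(2)] proves.ForallI)
qed

lemma inconsistent_insertD: "\<not> consistent (insert \<phi> \<Gamma>) \<Longrightarrow> \<Gamma> \<turnstile> Neg \<phi>"
  by (simp add: consistent_def proves.ImpI)

lemma inconsistent_insert_NegD: "\<not> consistent (insert (Neg \<phi>) \<Gamma>) \<Longrightarrow> \<Gamma> \<turnstile> \<phi>"
  by (simp add: consistent_def proves.Contr)

text \<open>The common bound on free variables leaves a fresh variable to act as Henkin witness at
  every stage, so that variables can do the work of new constants.\<close>

definition extendable :: "fm set \<Rightarrow> bool" where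
  "extendable \<Gamma> \<longleftrightarrow> consistent \<Gamma> \<and> (\<exists>k. \<forall>\<gamma>\<in>\<Gamma>. closed_fm k \<gamma>)"

definition decides :: "fm set \<Rightarrow> fm \<Rightarrow> bool" where
  "decides \<Gamma> \<phi> \<longleftrightarrow> \<phi> \<in> \<Gamma> \<or> Neg \<phi> \<in> \<Gamma> \<and> (\<forall>\<psi>. \<phi> = Forall \<psi> \<longrightarrow> (\<exists>t. Neg (inst \<psi> t) \<in> \<Gamma>))"

lemma extendable_insert: "extendable \<Gamma> \<Longrightarrow> consistent (insert \<phi> \<Gamma>) \<Longrightarrow> extendable (insert \<phi> \<Gamma>)"
  unfolding extendable_def
  by (metis closed_fm_ex closed_fm_mono insert_iff max.cobounded1 max.cobounded2)

lemma extension_step: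
  assumes "extendable \<Gamma>"
  shows "\<exists>\<Delta>. extendable \<Delta> \<and> \<Gamma> \<subseteq> \<Delta> \<and> decides \<Delta> \<phi>"
proof (cases "consistent (insert \<phi> \<Gamma>)")
  case True
  then show ?thesis using extendable_insert[OF assms] by (meson decides_def insertI1 subset_insertI)
next
  case False
  let ?D = "insert (Neg \<phi>) \<Gamma>"
  have con: "consistent ?D"
  proof (rule ccontr)
    assume "\<not> consistent ?D"
    then have "\<Gamma> \<turnstile> \<phi>" by (rule inconsistent_insert_NegD)
    then have "\<Gamma> \<turnstile> Falsum" using inconsistent_insertD[OF False] by (metis proves.ImpE)
    then show False using assms by (simp add: extendable_def consistent_def)
  qed
  then have ext: "extendable ?D" using extendable_insert assms by blast
  show ?thesis
  proof (cases "\<exists>\<psi>. \<phi> = Forall \<psi>")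
    case False
    then show ?thesis using ext by (intro exI[of _ ?D]) (auto simp: decides_def)
  next
    case True
    then obtain \<psi> where \<psi>: "\<phi> = Forall \<psi>" by blast
    obtain k where k: "\<forall>\<gamma>\<in>?D. closed_fm k \<gamma>" using ext unfolding extendable_def by blast
    then have ck: "closed_fm (Suc k) \<psi>" using \<psi> by simp
    \<comment> \<open>\<open>Var k\<close> is fresh for \<open>?D\<close>; if its instance were
      provable, generalization would give the universal formula that \<open>?D\<close>
      refutes.\<close>
    have "consistent (insert (Neg (inst \<psi> (Var k))) ?D)"
    proof (rule ccontr)
      assume "\<not> ?thesis"
      then have "?D \<turnstile> inst \<psi> (Var k)" by (rule inconsistent_insert_NegD)
      then have "?D \<turnstile> \<phi>" using generalization[OF _ ck k] \<psi> by simp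
      moreover have "?D \<turnstile> Neg \<phi>" by (simp add: proves.Assm)
      ultimately have "?D \<turnstile> Falsum" by (metis proves.ImpE)
      then show False using con by (simp add: consistent_def)
    qed
    from extendable_insert[OF ext this] show ?thesis
      by (intro exI[of _ "insert (Neg (inst \<psi> (Var k))) ?D"]) (auto simp: decides_def \<psi>)
  qed
qed

text \<open>\<open>W\<close> is a maximal consistent set with a witness for each negated universal formula.\<close>

locale henkin =
  fixes W :: "fm set"
  assumes con: "consistent W"
    and dec: "decides W \<phi>"
begin

lemma mem_iff: "\<phi> \<in> W \<longleftrightarrow> W \<turnstile> \<phi>"
proof
  assume "W \<turnstile> \<phi>"
  show "\<phi> \<in> W"
  proof (rule ccontr)
    assume "\<phi> \<notin> W"
    then have "Neg \<phi> \<in> W" using dec[of \<phi>] by (auto simp: decides_def)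
    then have "W \<turnstile> Falsum" using \<open>W \<turnstile> \<phi>\<close> by (metis proves.Assm proves.ImpE)
    then show False using con by (simp add: consistent_def)
  qed
qed (rule proves.Assm)

lemma Falsum_mem [simp]: "Falsum \<notin> W"
  using con by (simp add: mem_iff consistent_def)

lemma Imp_mem [simp]: "Imp \<phi> \<psi> \<in> W \<longleftrightarrow> (\<phi> \<in> W \<longrightarrow> \<psi> \<in> W)"
proof
  assume "Imp \<phi> \<psi> \<in> W" then show "\<phi> \<in> W \<longrightarrow> \<psi> \<in> W" by (metis mem_iff proves.ImpE)
next
  assume a: "\<phi> \<in> W \<longrightarrow> \<psi> \<in> W"
  show "Imp \<phi> \<psi> \<in> W"
  proof (cases "\<phi> \<in> W")
    case True
    then have "W \<turnstile> \<psi>" using a mem_iff by blast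
    then have "insert \<phi> W \<turnstile> \<psi>" by (rule weakening) auto
    then show ?thesis unfolding mem_iff by (rule proves.ImpI)
  next
    case False
    then have "Neg \<phi> \<in> W" using dec[of \<phi>] by (auto simp: decides_def)
    then have "insert \<phi> W \<turnstile> Falsum" by (metis insertCI proves.Assm proves.ImpE)
    then have "insert \<phi> W \<turnstile> \<psi>" by (meson proves.Contr subset_insertI weakening)
    then show ?thesis unfolding mem_iff by (rule proves.ImpI)
  qed
qed

lemma Forall_mem: "Forall \<phi> \<in> W \<longleftrightarrow> (\<forall>t. inst \<phi> t \<in> W)"
proof
  assume "Forall \<phi> \<in> W" then show "\<forall>t. inst \<phi> t \<in> W" by (metis mem_iff proves.ForallE)
next
  assume a: "\<forall>t. inst \<phi> t \<in> W"
  show "Forall \<phi> \<in> W"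
  proof (rule ccontr)
    assume "Forall \<phi> \<notin> W"
    then obtain t where "Neg (inst \<phi> t) \<in> W" using dec[of "Forall \<phi>"] by (auto simp: decides_def)
    with a show False by simp
  qed
qed

lemma inst_subst: "inst (subst_fm (up \<sigma>) \<phi>) t = subst_fm (t ## \<sigma>) \<phi>"
  unfolding inst_def subst_fm_comp
  by (rule arg_cong[of _ _ "\<lambda>s. subst_fm s \<phi>"])
    (auto simp: up_def subst_tm_comp fun_eq_iff split: nat.splits)

lemma Forall_inst: "subst_fm \<sigma> (Forall \<phi>) \<in> W \<Longrightarrow> subst_fm (t ## \<sigma>) \<phi> \<in> W"
  by (simp add: Forall_mem inst_subst)

lemma inst_simps [simp]:
  "inst (Equal s t) u = Equal (subst_tm (case_nat u Var) s) (subst_tm (case_nat u Var) t)"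
  "inst (Less s t) u = Less (subst_tm (case_nat u Var) s) (subst_tm (case_nat u Var) t)"
  "inst (Imp \<phi> \<psi>) u = Imp (inst \<phi> u) (inst \<psi> u)"
  "inst Falsum u = Falsum"
  by (auto simp: inst_def)

lemma lift_inst [simp]: "subst_tm (case_nat u Var) (lift_tm t) = t"
  by (simp add: subst_tm_comp)

lemma Equal_refl [simp]: "Equal t t \<in> W"
  by (simp add: mem_iff proves.EqRefl)

lemma Equal_subst: "Equal s t \<in> W \<Longrightarrow> inst \<phi> s \<in> W \<Longrightarrow> inst \<phi> t \<in> W"
  by (metis mem_iff proves.EqSubst)

text \<open>This and the following congruence laws instantiate \<open>Equal_subst\<close> with a
  formula whose \<open>Var 0\<close> marks the place of replacement; lifting protects the other
  terms.\<close>

lemma Equal_sym: "Equal s t \<in> W \<Longrightarrow> Equal t s \<in> W"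
  using Equal_subst[of s t "Equal (Var 0) (lift_tm s)"] by simp

lemma Equal_trans: "Equal s t \<in> W \<Longrightarrow> Equal t u \<in> W \<Longrightarrow> Equal s u \<in> W"
  using Equal_subst[of t u "Equal (lift_tm s) (Var 0)"] by simp

lemma Equal_Add: "Equal s s' \<in> W \<Longrightarrow> Equal t t' \<in> W \<Longrightarrow> Equal (Add s t) (Add s' t') \<in> W"
  using Equal_subst[of s s' "Equal (Add (lift_tm s) (lift_tm t)) (Add (Var 0) (lift_tm t))"]
    Equal_subst[of t t' "Equal (Add (lift_tm s) (lift_tm t)) (Add (lift_tm s') (Var 0))"] by simp

lemma Equal_Mul: "Equal s s' \<in> W \<Longrightarrow> Equal t t' \<in> W \<Longrightarrow> Equal (Mul s t) (Mul s' t') \<in> W"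
  using Equal_subst[of s s' "Equal (Mul (lift_tm s) (lift_tm t)) (Mul (Var 0) (lift_tm t))"]
    Equal_subst[of t t' "Equal (Mul (lift_tm s) (lift_tm t)) (Mul (lift_tm s') (Var 0))"] by simp

lemma Less_Equal: "Less s t \<in> W \<Longrightarrow> Equal s s' \<in> W \<Longrightarrow> Equal t t' \<in> W \<Longrightarrow> Less s' t' \<in> W"
  using Equal_subst[of s s' "Less (Var 0) (lift_tm t)"]
    Equal_subst[of t t' "Less (lift_tm s') (Var 0)"] by simp

definition cls :: "tm \<Rightarrow> tm set" where
  "cls t = {s. Equal t s \<in> W}"

lemma cls_eq_iff: "cls s = cls t \<longleftrightarrow> Equal s t \<in> W"
  using Equal_sym Equal_trans Equal_refl unfolding cls_def by blast

end

primrec num :: "nat \<Rightarrow> tm" where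
  "num 0 = Zero"
| "num (Suc n) = Add (num n) One"

text \<open>
  The axioms of \<open>PA_minus\<close> keep the classes of the numerals apart, so the term model is
  infinite and can be moved to the type \<^typ>\<open>nat\<close>.
\<close>

locale henkin_PA = henkin +
  assumes PA: "PA_minus \<subseteq> W"
begin

lemma Less_axioms:
  shows "Less s s \<notin> W" and "Less s t \<in> W \<Longrightarrow> Less t u \<in> W \<Longrightarrow> Less s u \<in> W"
    and "Less s t \<in> W \<Longrightarrow> Less (Add s u) (Add t u) \<in> W" and "Less Zero One \<in> W"
    and "Equal (Add s Zero) s \<in> W" and "Equal (Add s t) (Add t s) \<in> W"
proof -
  note ax = PA[unfolded PA_minus_def Let_def]
  have 1: "Forall \<phi> \<in> W \<Longrightarrow> subst_fm (a ## Var) \<phi> \<in> W" for a \<phi>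
    using Forall_inst[of Var] by simp
  have 2: "Forall (Forall \<phi>) \<in> W \<Longrightarrow> subst_fm (a ## b ## Var) \<phi> \<in> W" for a b \<phi>
    using 1[of "Forall \<phi>"] by (rule Forall_inst)
  have 3: "Forall (Forall (Forall \<phi>)) \<in> W \<Longrightarrow> subst_fm (a ## b ## c ## Var) \<phi> \<in> W" for a b c \<phi>
    using 2[of "Forall \<phi>"] by (rule Forall_inst)
  show "Less s s \<notin> W"
    using 1[of "Neg (Less (Var 0) (Var 0))" s] ax by simp
  show "Less s t \<in> W \<Longrightarrow> Less t u \<in> W \<Longrightarrow> Less s u \<in> W"
    using 3[of "Imp (Conj (Less (Var 0) (Var 1)) (Less (Var 1) (Var 2))) (Less (Var 0) (Var 2))" s t u] ax
    by (simp add: numeral_2_eq_2)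
  show "Less s t \<in> W \<Longrightarrow> Less (Add s u) (Add t u) \<in> W"
    using 3[of "Imp (Less (Var 0) (Var 1)) (Less (Add (Var 0) (Var 2)) (Add (Var 1) (Var 2)))" s t u] ax
    by (simp add: numeral_2_eq_2)
  show "Less Zero One \<in> W" using ax by simp
  show "Equal (Add s Zero) s \<in> W"
    using 1[of "Equal (Add (Var 0) Zero) (Var 0)" s] ax by simp
  show "Equal (Add s t) (Add t s) \<in> W"
    using 2[of "Equal (Add (Var 0) (Var 1)) (Add (Var 1) (Var 0))" s t] ax by simp
qed

lemma num_less: "m < n \<Longrightarrow> Less (num m) (num n) \<in> W"
proof (induction n)
  case (Suc n)
  have step: "Less (num n) (num (Suc n)) \<in> W"
    using Less_Equal[OF Less_axioms(3)[OF Less_axioms(4), of "num n"]]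
      Equal_trans[OF Less_axioms(6) Less_axioms(5)] Less_axioms(6) by simp
  show ?case using Suc step Less_axioms(2) less_Suc_eq by blast
qed simp

lemma infinite_classes: "infinite (range cls)"
proof -
  have "cls (num m) \<noteq> cls (num n)" if "m < n" for m n
    using num_less[OF that] Less_Equal[of "num m" "num n" "num n" "num n"] Less_axioms(1)
    by (auto simp: cls_eq_iff)
  then have "inj (\<lambda>n. cls (num n))" by (metis injI linorder_neqE_nat)
  then have "infinite (range (\<lambda>n. cls (num n)))" by (metis finite_imageD infinite_UNIV_nat)
  then show ?thesis by (rule infinite_super[rotated]) auto
qed

lemma model: "\<exists>(M :: nat str) e. \<forall>\<phi>\<in>W. sat M e \<phi>"
proof -
  have "countable (range cls)" by auto
  then obtain g :: "tm set \<Rightarrow> nat" where g: "bij_betw g (range cls) UNIV"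
    using infinite_classes by (rule countableE_infinite)
  define h where "h t = g (cls t)" for t
  have h_eq: "h s = h t \<longleftrightarrow> Equal s t \<in> W" for s t
    unfolding h_def cls_eq_iff[symmetric]
    by (rule inj_on_eq_iff[OF bij_betw_imp_inj_on[OF g]]) auto
  have h_surj: "\<exists>t. h t = x" for x
    using bij_betw_imp_surj_on[OF g] unfolding h_def by (metis UNIV_I imageE)
  define r where "r = inv h"
  have hr: "h (r x) = x" for x 
    unfolding r_def by (rule surj_f_inv_f) (metis h_surj surj_def)
  have r_eq: "Equal (r (h t)) t \<in> W" for t using hr h_eq by blast
  define M where "M = Str (h Zero) (h One) (\<lambda>x y. h (Add (r x) (r y))) (\<lambda>x y. h (Mul (r x) (r y)))
    (\<lambda>x y. Less (r x) (r y) \<in> W)"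
  have val: "val M (\<lambda>n. h (\<sigma> n)) t = h (subst_tm \<sigma> t)" for \<sigma> t
    by (induction t) (auto simp: M_def h_eq intro: Equal_Add Equal_Mul r_eq)
  \<comment> \<open>Truth lemma, stated for all \<open>\<sigma>\<close> because the case
    \<open>Forall\<close> prepends the representative \<open>r x\<close> of the new element.\<close>
  have "sat M (\<lambda>n. h (\<sigma> n)) \<phi> \<longleftrightarrow> subst_fm \<sigma> \<phi> \<in> W" for \<sigma> \<phi>
  proof (induction \<phi> arbitrary: \<sigma>)
    case (Less s t)
    have "Less (r (h (subst_tm \<sigma> s))) (r (h (subst_tm \<sigma> t))) \<in> W \<longleftrightarrow> Less (subst_tm \<sigma> s) (subst_tm \<sigma> t) \<in> W"
      using Less_Equal r_eq Equal_sym by meson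
    then show ?case by (simp add: val) (simp add: M_def)
  next
    case (Forall \<phi>)
    have "sat M (x ## (\<lambda>n. h (\<sigma> n))) \<phi> \<longleftrightarrow> inst (subst_fm (up \<sigma>) \<phi>) (r x) \<in> W" for x
    proof -
      have 1: "x ## (\<lambda>n. h (\<sigma> n)) = (\<lambda>n. h ((r x ## \<sigma>) n))"
        by (auto simp: hr fun_eq_iff split: nat.splits)
      show ?thesis unfolding 1 inst_subst by (rule Forall.IH)
    qed
    then have 1: "sat M (\<lambda>n. h (\<sigma> n)) (Forall \<phi>) \<longleftrightarrow> (\<forall>x. inst (subst_fm (up \<sigma>) \<phi>) (r x) \<in> W)" by simp
    \<comment> \<open>Instances at representatives suffice, since every term is equal in W to one of
      them.\<close>
    have "(\<forall>t. inst (subst_fm (up \<sigma>) \<phi>) t \<in> W)" if "\<forall>x. inst (subst_fm (up \<sigma>) \<phi>) (r x) \<in> W"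
      using that r_eq Equal_subst by blast
    with 1 show ?case by (auto simp: Forall_mem)
  qed (auto simp: val h_eq)
  from this[of Var] show ?thesis by auto
qed

end

theorem model_existence:
  assumes "\<forall>\<phi>\<in>U. sentence \<phi>" "consistent U" "extends U PA_minus"
  shows "\<exists>(M :: nat str) e. \<forall>\<phi>\<in>U. sat M e \<phi>"
proof -
  have ext: "extendable U" using assms unfolding extendable_def sentence_def by blast
  define step where "step n \<Gamma> = (SOME \<Delta>. extendable \<Delta> \<and> \<Gamma> \<subseteq> \<Delta> \<and> decides \<Delta> (from_nat n))" for n \<Gamma>
  define G where "G = rec_nat U step"
  have G0: "G 0 = U" and GS: "G (Suc n) = step n (G n)" for n by (auto simp: G_def)
  have stp: "extendable (step n \<Gamma>) \<and> \<Gamma> \<subseteq> step n \<Gamma> \<and> decides (step n \<Gamma>) (from_nat n)" if "extendable \<Gamma>" for n \<Gamma>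
    unfolding step_def using extension_step[OF that] by (rule someI_ex)
  have Gext: "extendable (G n)" for n by (induction n) (use G0 GS ext stp in auto)
  have "G n \<subseteq> G (Suc n)" for n using GS stp Gext by auto
  then have mono: "m \<le> n \<Longrightarrow> G m \<subseteq> G n" for m n by (rule lift_Suc_mono_le)
  define W where "W = (\<Union>n. G n)"
  have con: "consistent W"
  proof (rule ccontr)
    assume "\<not> consistent W"
    then obtain F where F: "finite F" "F \<subseteq> W" "F \<turnstile> Falsum" using compactness unfolding consistent_def by blast
    have "\<exists>n. F \<subseteq> G n" using F(1,2)
    proof (induction F)
      case (insert \<phi> F)
      then obtain n m where "F \<subseteq> G n" "\<phi> \<in> G m" unfolding W_def by blast
      then have "insert \<phi> F \<subseteq> G (max n m)" using mono[of n "max n m"] mono[of m "max n m"] by auto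
      then show ?case by blast
    qed simp
    then show False using Gext F(3) weakening unfolding extendable_def consistent_def by blast
  qed
  have dec: "decides W \<phi>" for \<phi>
  proof -
    have "decides (G (Suc (to_nat \<phi>))) \<phi>" using stp[OF Gext, of "to_nat \<phi>" "to_nat \<phi>"] GS by simp
    then show ?thesis unfolding decides_def W_def by blast
  qed
  interpret henkin W using con dec by unfold_locales
  have "U \<subseteq> W" using G0 unfolding W_def by blast
  then have "PA_minus \<subseteq> W" using assms(3) weakening mem_iff unfolding extends_def by blast
  then interpret henkin_PA W by unfold_locales
  from model \<open>U \<subseteq> W\<close> show ?thesis by blast
qed

text \<open>Validity over the single carrier \<open>nat\<close> suffices, because a consistent set
  of sentences extending \<open>PA_minus\<close> always has a model there.\<close>

corollary completeness:
  assumes "\<forall>\<phi>\<in>U. sentence \<phi>" "extends U PA_minus" "sentence \<psi>"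
    and valid: "\<And>(M :: nat str) e. \<forall>\<phi>\<in>U. sat M e \<phi> \<Longrightarrow> sat M e \<psi>"
  shows "U \<turnstile> \<psi>"
proof (rule ccontr)
  assume "\<not> U \<turnstile> \<psi>"
  then have "consistent (insert (Neg \<psi>) U)" using inconsistent_insert_NegD by blast
  moreover have "\<forall>\<phi>\<in>insert (Neg \<psi>) U. sentence \<phi>" using assms by (simp add: sentence_def)
  moreover have "extends (insert (Neg \<psi>) U) PA_minus"
    using assms(2) weakening unfolding extends_def by blast
  ultimately obtain M :: "nat str" and e where "\<forall>\<phi>\<in>insert (Neg \<psi>) U. sat M e \<phi>"
    using model_existence by blast
  then show False using valid[of M e] by simp
qed

section \<open>Definable relations\<close>

lemma Delta0_subst: "\<phi> \<in> Delta0 \<Longrightarrow> subst_fm \<sigma> \<phi> \<in> Delta0"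
proof (induction arbitrary: \<sigma> rule: Delta0.induct)
  case (5 \<phi> t)
  have "subst_fm \<sigma> (BForall t \<phi>) = BForall (subst_tm \<sigma> t) (subst_fm (up \<sigma>) \<phi>)"
    unfolding BForall_def subst_tm_up_lift[symmetric] by (simp add: up_def)
  then show ?case using 5 by (simp add: Delta0.intros)
next
  case (6 \<phi> t)
  have "subst_fm \<sigma> (BExists t \<phi>) = BExists (subst_tm \<sigma> t) (subst_fm (up \<sigma>) \<phi>)"
    unfolding BExists_def subst_tm_up_lift[symmetric] by (simp add: up_def)
  then show ?case using 6 by (simp add: Delta0.intros)
qed (auto intro: Delta0.intros)

text \<open>
  In the next three notions one term or formula must work for all structures on the type.
\<close>

definition term_fn :: "('a str \<Rightarrow> (nat \<Rightarrow> 'a) \<Rightarrow> 'a) \<Rightarrow> bool" where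
  "term_fn f \<longleftrightarrow> (\<exists>t. \<forall>M e. val M e t = f M e)"

definition delta0 :: "('a str \<Rightarrow> (nat \<Rightarrow> 'a) \<Rightarrow> bool) \<Rightarrow> bool" where
  "delta0 P \<longleftrightarrow> (\<exists>\<phi>\<in>Delta0. \<forall>M e. sat M e \<phi> \<longleftrightarrow> P M e)"

definition arith :: "('a str \<Rightarrow> (nat \<Rightarrow> 'a) \<Rightarrow> bool) \<Rightarrow> bool" where
  "arith P \<longleftrightarrow> (\<exists>\<phi>. \<forall>M e. sat M e \<phi> \<longleftrightarrow> P M e)"

lemma term_fn_var: "term_fn (\<lambda>M e. e n)"
  unfolding term_fn_def by (rule exI[of _ "Var n"]) simp
lemma term_fn_zr: "term_fn (\<lambda>M e. zr M)"
  unfolding term_fn_def by (rule exI[of _ Zero]) simp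
lemma term_fn_un: "term_fn (\<lambda>M e. un M)"
  unfolding term_fn_def by (rule exI[of _ One]) simp
lemma term_fn_ad: "term_fn f \<Longrightarrow> term_fn g \<Longrightarrow> term_fn (\<lambda>M e. ad M (f M e) (g M e))"
  unfolding term_fn_def by (metis val.simps(4))
lemma term_fn_mu: "term_fn f \<Longrightarrow> term_fn g \<Longrightarrow> term_fn (\<lambda>M e. mu M (f M e) (g M e))"
  unfolding term_fn_def by (metis val.simps(5))
lemma term_fn_scons: "term_fn f \<Longrightarrow> (\<And>m. term_fn (\<lambda>M e. g M e m)) \<Longrightarrow> term_fn (\<lambda>M e. (f M e ## g M e) n)"
  by (cases n) auto

lemmas term_fn_intros = term_fn_var term_fn_zr term_fn_un term_fn_ad term_fn_mu term_fn_scons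

lemma delta0_subst: "delta0 P \<Longrightarrow> (\<And>n. term_fn (\<lambda>M e. g M e n)) \<Longrightarrow> delta0 (\<lambda>M e. P M (g M e))"
proof -
  assume "delta0 P" "\<And>n. term_fn (\<lambda>M e. g M e n)"
  then obtain \<phi> \<sigma> where t: "\<phi> \<in> Delta0" "\<forall>M e. sat M e \<phi> = P M e" and s: "\<forall>n M e. val M e (\<sigma> n) = g M e n"
    unfolding delta0_def term_fn_def by metis
  then have "\<forall>M e. sat M e (subst_fm \<sigma> \<phi>) = P M (g M e)" by simp
  then show ?thesis unfolding delta0_def using Delta0_subst t by blast
qed

lemma arith_subst: "arith P \<Longrightarrow> (\<And>n. term_fn (\<lambda>M e. g M e n)) \<Longrightarrow> arith (\<lambda>M e. P M (g M e))"
proof -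
  assume "arith P" "\<And>n. term_fn (\<lambda>M e. g M e n)"
  then obtain \<phi> \<sigma> where t: "\<forall>M e. sat M e \<phi> = P M e" and s: "\<forall>n M e. val M e (\<sigma> n) = g M e n"
    unfolding arith_def term_fn_def by metis
  then have "\<forall>M e. sat M e (subst_fm \<sigma> \<phi>) = P M (g M e)" by simp
  then show ?thesis unfolding arith_def by blast
qed

lemma delta0_eq: "term_fn f \<Longrightarrow> term_fn g \<Longrightarrow> delta0 (\<lambda>M e. f M e = g M e)"
  unfolding term_fn_def delta0_def by (metis sat.simps(1) Delta0.intros(1))
lemma delta0_ls: "term_fn f \<Longrightarrow> term_fn g \<Longrightarrow> delta0 (\<lambda>M e. ls M (f M e) (g M e))"
  unfolding term_fn_def delta0_def by (metis sat.simps(2) Delta0.intros(2))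
lemma delta0_False: "delta0 (\<lambda>M e. False)"
  unfolding delta0_def by (metis sat.simps(3) Delta0.intros(3))
lemma delta0_imp: "delta0 P \<Longrightarrow> delta0 Q \<Longrightarrow> delta0 (\<lambda>M e. P M e \<longrightarrow> Q M e)"
  unfolding delta0_def by (metis sat.simps(4) Delta0.intros(4))
lemma delta0_not: "delta0 P \<Longrightarrow> delta0 (\<lambda>M e. \<not> P M e)"
  using delta0_imp[OF _ delta0_False] by simp
lemma delta0_True: "delta0 (\<lambda>M e. True)"
  using delta0_not[OF delta0_False] by simp
lemma delta0_disj: "delta0 P \<Longrightarrow> delta0 Q \<Longrightarrow> delta0 (\<lambda>M e. P M e \<or> Q M e)"
  using delta0_imp[OF delta0_not[of P], of Q] by (simp add: disj_imp)
lemma delta0_conj: "delta0 P \<Longrightarrow> delta0 Q \<Longrightarrow> delta0 (\<lambda>M e. P M e \<and> Q M e)"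
  using delta0_not[OF delta0_imp[OF _ delta0_not[of Q], of P]] by simp
lemma delta0_iff: "delta0 P \<Longrightarrow> delta0 Q \<Longrightarrow> delta0 (\<lambda>M e. P M e \<longleftrightarrow> Q M e)"
  using delta0_conj[OF delta0_imp[of P Q] delta0_imp[of Q P]] by (simp add: iff_conv_conj_imp)

lemma delta0_ball:
  assumes "delta0 (\<lambda>M e. P M (e 0) (\<lambda>n. e (Suc n)))" "term_fn t"
  shows "delta0 (\<lambda>M e. \<forall>x. ls M x (t M e) \<longrightarrow> P M x e)"
proof -
  obtain \<phi> u where "\<phi> \<in> Delta0" "\<forall>M e. sat M e \<phi> = P M (e 0) (\<lambda>n. e (Suc n))" "\<forall>M e. val M e u = t M e"
    using assms unfolding delta0_def term_fn_def by blast
  then have "BForall u \<phi> \<in> Delta0" "\<forall>M e. sat M e (BForall u \<phi>) = (\<forall>x. ls M x (t M e) \<longrightarrow> P M x e)"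
    by (auto intro: Delta0.intros)
  then show ?thesis unfolding delta0_def by blast
qed

lemma delta0_bex:
  assumes "delta0 (\<lambda>M e. P M (e 0) (\<lambda>n. e (Suc n)))" "term_fn t"
  shows "delta0 (\<lambda>M e. \<exists>x. ls M x (t M e) \<and> P M x e)"
  using delta0_not[OF delta0_ball[OF delta0_not[OF assms(1)] assms(2)]] by simp

text \<open>A finite disjunction formed outside the language; it serves to quantify over the
  subexpressions of a fixed expression.\<close>

lemma delta0_list_ex: "(\<And>x. x \<in> set xs \<Longrightarrow> delta0 (P x)) \<Longrightarrow> delta0 (\<lambda>M e. \<exists>x\<in>set xs. P x M e)"
  by (induction xs) (auto intro: delta0_False delta0_disj)

lemmas delta0_intros = delta0_False delta0_True delta0_imp delta0_not delta0_disj delta0_conj delta0_iff delta0_ball delta0_bex delta0_eq delta0_ls term_fn_intros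

lemma delta0_arith: "delta0 P \<Longrightarrow> arith P"
  unfolding delta0_def arith_def by blast
lemma arith_imp: "arith P \<Longrightarrow> arith Q \<Longrightarrow> arith (\<lambda>M e. P M e \<longrightarrow> Q M e)"
  unfolding arith_def by (metis sat.simps(4))
lemmas arith_eq = delta0_arith[OF delta0_eq]
lemmas arith_ls = delta0_arith[OF delta0_ls]
lemmas arith_False = delta0_arith[OF delta0_False]
lemma arith_not: "arith P \<Longrightarrow> arith (\<lambda>M e. \<not> P M e)"
  using arith_imp[OF _ arith_False] by simp
lemma arith_disj: "arith P \<Longrightarrow> arith Q \<Longrightarrow> arith (\<lambda>M e. P M e \<or> Q M e)"
  using arith_imp[OF arith_not[of P], of Q] by (simp add: disj_imp)
lemma arith_conj: "arith P \<Longrightarrow> arith Q \<Longrightarrow> arith (\<lambda>M e. P M e \<and> Q M e)"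
  using arith_not[OF arith_imp[OF _ arith_not[of Q], of P]] by simp
lemma arith_all:
  assumes "arith (\<lambda>M e. P M (e 0) (\<lambda>n. e (Suc n)))"
  shows "arith (\<lambda>M e. \<forall>x. P M x e)"
proof -
  obtain \<phi> where "\<forall>M e. sat M e \<phi> = P M (e 0) (\<lambda>n. e (Suc n))" using assms unfolding arith_def by blast
  then have "\<forall>M e. sat M e (Forall \<phi>) = (\<forall>x. P M x e)" by simp
  then show ?thesis unfolding arith_def by blast
qed
lemma arith_ex: "arith (\<lambda>M e. P M (e 0) (\<lambda>n. e (Suc n))) \<Longrightarrow> arith (\<lambda>M e. \<exists>x. P M x e)"
  using arith_not[OF arith_all[OF arith_not]] by simp

lemmas arith_intros = arith_False arith_imp arith_not arith_disj arith_conj arith_all arith_ex arith_eq arith_ls term_fn_intros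

section \<open>Existential definability in the standard model\<close>

definition std :: "nat str" where
  "std = Str 0 1 (+) (*) (<)"

lemma std_simps [simp]: "zr std = 0" "un std = 1" "ad std = (+)" "mu std = (*)" "ls std = (<)"
  by (auto simp: std_def)

text \<open>The equivalence is required in \<open>std\<close> only, but the matrix \<open>Q\<close>
  is uniform in the structure, so it can afterwards be read in M and compared by
  absoluteness.\<close>

definition sigma1 :: "((nat \<Rightarrow> nat) \<Rightarrow> bool) \<Rightarrow> bool" where
  "sigma1 P \<longleftrightarrow> (\<exists>Q. delta0 Q \<and> (\<forall>e. P e \<longleftrightarrow> (\<exists>z. Q std (z ## e))))"

lemma sigma1_delta0: "delta0 Q \<Longrightarrow> (\<And>e. Q std e = P e) \<Longrightarrow> sigma1 P"
  unfolding sigma1_def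
  by (rule exI[of _ "\<lambda>M e. Q M (\<lambda>n. e (Suc n))"]) (auto intro: delta0_subst term_fn_intros)

lemma sigma1_ren: "sigma1 P \<Longrightarrow> sigma1 (\<lambda>e. P (\<lambda>n. e (\<rho> n)))"
proof -
  assume "sigma1 P"
  then obtain Q where Q: "delta0 Q" "\<forall>e. P e \<longleftrightarrow> (\<exists>z. Q std (z ## e))" unfolding sigma1_def by blast
  have 1: "delta0 (\<lambda>M e. Q M (e 0 ## (\<lambda>n. e (Suc (\<rho> n)))))"
    by (rule delta0_subst[OF Q(1)]) (intro term_fn_intros)
  show ?thesis unfolding sigma1_def by (rule exI, rule conjI[OF 1]) (use Q(2) in auto)
qed

lemma sigma1_conj: "sigma1 P1 \<Longrightarrow> sigma1 P2 \<Longrightarrow> sigma1 (\<lambda>e. P1 e \<and> P2 e)"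
proof -
  assume "sigma1 P1" "sigma1 P2"
  then obtain Q1 Q2 where Q: "delta0 Q1" "\<forall>e. P1 e \<longleftrightarrow> (\<exists>z. Q1 std (z ## e))"
    "delta0 Q2" "\<forall>e. P2 e \<longleftrightarrow> (\<exists>z. Q2 std (z ## e))" unfolding sigma1_def by blast
  define Q where "Q M e = ((\<exists>z. ls M z (e 0) \<and> Q1 M (z ## (\<lambda>n. e (Suc n)))) \<and>
    (\<exists>z. ls M z (e 0) \<and> Q2 M (z ## (\<lambda>n. e (Suc n)))))" for M and e :: "nat \<Rightarrow> nat"
  have 1: "delta0 Q" unfolding Q_def
    by (intro delta0_conj delta0_bex delta0_subst[OF Q(1)] delta0_subst[OF Q(3)] term_fn_intros)
  have "(P1 e \<and> P2 e) \<longleftrightarrow> (\<exists>z. Q std (z ## e))" for e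
  proof
    assume "P1 e \<and> P2 e"
    then obtain z1 z2 where "Q1 std (z1 ## e)" "Q2 std (z2 ## e)" using Q by blast
    then have "\<exists>z<Suc (z1 + z2). Q1 std (z ## e)" "\<exists>z<Suc (z1 + z2). Q2 std (z ## e)"
      by (metis less_add_Suc1, metis less_add_Suc2)
    then have "Q std (Suc (z1 + z2) ## e)" by (simp add: Q_def)
    then show "\<exists>z. Q std (z ## e)" by blast
  qed (use Q in \<open>auto simp: Q_def\<close>)
  then show ?thesis unfolding sigma1_def using 1 by blast
qed

lemma sigma1_disj: "sigma1 P1 \<Longrightarrow> sigma1 P2 \<Longrightarrow> sigma1 (\<lambda>e. P1 e \<or> P2 e)"
proof -
  assume "sigma1 P1" "sigma1 P2"
  then obtain Q1 Q2 where Q: "delta0 Q1" "\<forall>e. P1 e \<longleftrightarrow> (\<exists>z. Q1 std (z ## e))"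
    "delta0 Q2" "\<forall>e. P2 e \<longleftrightarrow> (\<exists>z. Q2 std (z ## e))" unfolding sigma1_def by blast
  have 1: "delta0 (\<lambda>M e. Q1 M e \<or> Q2 M e)" by (intro delta0_disj Q)
  show ?thesis unfolding sigma1_def by (rule exI, rule conjI[OF 1]) (use Q in auto)
qed

text \<open>Both existential quantifiers are bounded by one new number, which restores the form with
  a single unbounded quantifier; \<open>Suc (x + z)\<close> exceeds both witnesses.\<close>

lemma sigma1_ex:
  assumes "sigma1 (\<lambda>e. P (e 0) (\<lambda>n. e (Suc n)))"
  shows "sigma1 (\<lambda>e. \<exists>x. P x e)"
proof -
  obtain R where R: "delta0 R" "\<forall>e. P (e 0) (\<lambda>n. e (Suc n)) \<longleftrightarrow> (\<exists>z. R std (z ## e))"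
    using assms unfolding sigma1_def by blast
  define Q where "Q M e = (\<exists>x. ls M x (e 0) \<and> (\<exists>z. ls M z (e 0) \<and> R M (z ## x ## (\<lambda>n. e (Suc n)))))"
    for M and e :: "nat \<Rightarrow> nat"
  have 1: "delta0 Q" unfolding Q_def by (intro delta0_bex delta0_subst[OF R(1)] term_fn_intros)
  have R2: "P x e \<longleftrightarrow> (\<exists>z. R std (z ## x ## e))" for x e
    using R(2)[rule_format, of "x ## e"] by simp
  have "(\<exists>x. P x e) \<longleftrightarrow> (\<exists>z. Q std (z ## e))" for e
  proof
    assume "\<exists>x. P x e"
    then obtain x z where "R std (z ## x ## e)" using R2 by blast
    then have "\<exists>x'<Suc (x + z). \<exists>z'<Suc (x + z). R std (z' ## x' ## e)"
      by (intro exI[of _ x] exI[of _ z] conjI) auto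
    then have "Q std (Suc (x + z) ## e)" by (simp add: Q_def)
    then show "\<exists>z. Q std (z ## e)" by blast
  qed (use R2 in \<open>auto simp: Q_def\<close>)
  then show ?thesis unfolding sigma1_def using 1 by blast
qed

text \<open>Collection in the standard model: finitely many witnesses lie below a common bound, here
  one more than their sum.\<close>

lemma sigma1_ball_var:
  assumes "sigma1 (\<lambda>e. P (e 0) (\<lambda>n. e (Suc n)))"
  shows "sigma1 (\<lambda>e. \<forall>x<e k. P x e)"
proof -
  obtain R where R: "delta0 R" "\<forall>e. P (e 0) (\<lambda>n. e (Suc n)) \<longleftrightarrow> (\<exists>z. R std (z ## e))"
    using assms unfolding sigma1_def by blast
  define Q where "Q M e = (\<forall>x. ls M x (e (Suc k)) \<longrightarrow> (\<exists>z. ls M z (e 0) \<and> R M (z ## x ## (\<lambda>n. e (Suc n)))))"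
    for M and e :: "nat \<Rightarrow> nat"
  have 1: "delta0 Q" unfolding Q_def by (intro delta0_ball delta0_bex delta0_subst[OF R(1)] term_fn_intros)
  have R2: "P x e \<longleftrightarrow> (\<exists>z. R std (z ## x ## e))" for x e
    using R(2)[rule_format, of "x ## e"] by simp
  have "(\<forall>x<e k. P x e) \<longleftrightarrow> (\<exists>z. Q std (z ## e))" for e
  proof
    assume "\<forall>x<e k. P x e"
    then have "\<forall>x. \<exists>z. x < e k \<longrightarrow> R std (z ## x ## e)" using R2 by blast
    then obtain f where f: "\<forall>x. x < e k \<longrightarrow> R std (f x ## x ## e)" by metis
    define b where "b = Suc (\<Sum>x<e k. f x)"
    have "f x < b" if "x < e k" for x
      using member_le_sum[of x "{..<e k}" f] that by (simp add: b_def less_Suc_eq_le)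
    then have "Q std (b ## e)" using f by (auto simp: Q_def)
    then show "\<exists>z. Q std (z ## e)" by blast
  qed (use R2 in \<open>auto simp: Q_def\<close>)
  then show ?thesis unfolding sigma1_def using 1 by blast
qed

section \<open>Functions with an existentially definable graph\<close>

definition sig_fun :: "((nat \<Rightarrow> nat) \<Rightarrow> nat) \<Rightarrow> bool" where
  "sig_fun f \<longleftrightarrow> sigma1 (\<lambda>e. e 0 = f (\<lambda>n. e (Suc n)))"

lemma sig_fun_ren: "sig_fun f \<Longrightarrow> sig_fun (\<lambda>e. f (\<lambda>n. e (\<rho> n)))"
  unfolding sig_fun_def using sigma1_ren[of "\<lambda>e. e 0 = f (\<lambda>n. e (Suc n))" "\<lambda>n. case n of 0 \<Rightarrow> 0 | Suc m \<Rightarrow> Suc (\<rho> m)"]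
  by simp

lemma sigma1_1:
  assumes "sigma1 (\<lambda>e. P (e 0))" "sig_fun f" shows "sigma1 (\<lambda>e. P (f e))"
proof -
  have "sigma1 (\<lambda>e. \<exists>x. x = f e \<and> P x)"
    by (rule sigma1_ex, rule sigma1_conj[OF assms(2)[unfolded sig_fun_def] assms(1)])
  then show ?thesis by simp
qed

lemma sigma1_2:
  assumes "sigma1 (\<lambda>e. P (e 0) (e 1))" "sig_fun f" "sig_fun g" shows "sigma1 (\<lambda>e. P (f e) (g e))"
proof -
  have "sigma1 (\<lambda>e. P (e 1) (e 0))"
    using sigma1_ren[OF assms(1), of "\<lambda>n. if n = 0 then 1 else 0"] by simp
  from sigma1_conj[OF sig_fun_ren[OF assms(3), of Suc, unfolded sig_fun_def] this]
  have "sigma1 (\<lambda>e. \<exists>y. y = g (\<lambda>n. e (Suc n)) \<and> P (e 0) y)"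
    by (intro sigma1_ex) simp
  from sigma1_conj[OF assms(2)[unfolded sig_fun_def] this]
  have "sigma1 (\<lambda>e. \<exists>x. x = f e \<and> (\<exists>y. y = g e \<and> P x y))" by (intro sigma1_ex)
  then show ?thesis by simp
qed

lemma sigma1_3:
  assumes "sigma1 (\<lambda>e. P (e 0) (e 1) (e 2))" "sig_fun f" "sig_fun g" "sig_fun h" shows "sigma1 (\<lambda>e. P (f e) (g e) (h e))"
proof -
  have "sigma1 (\<lambda>e. P (e 2) (e 1) (e 0))"
    using sigma1_ren[OF assms(1), of "\<lambda>n. 2 - n"] by simp
  from sigma1_conj[OF sig_fun_ren[OF assms(4), of "\<lambda>n. Suc (Suc n)", unfolded sig_fun_def] this]
  have "sigma1 (\<lambda>e. \<exists>z. z = h (\<lambda>n. e (Suc (Suc n))) \<and> P (e 1) (e 0) z)"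
    by (intro sigma1_ex) (simp add: numeral_2_eq_2)
  from sigma1_conj[OF sig_fun_ren[OF assms(3), of Suc, unfolded sig_fun_def] this]
  have "sigma1 (\<lambda>e. \<exists>y. y = g (\<lambda>n. e (Suc n)) \<and> (\<exists>z. z = h (\<lambda>n. e (Suc n)) \<and> P (e 0) y z))"
    by (intro sigma1_ex) simp
  from sigma1_conj[OF assms(2)[unfolded sig_fun_def] this]
  have "sigma1 (\<lambda>e. \<exists>x. x = f e \<and> (\<exists>y. y = g e \<and> (\<exists>z. z = h e \<and> P x y z)))" by (intro sigma1_ex)
  then show ?thesis by simp
qed

lemma sig_fun_var: "sig_fun (\<lambda>e. e n)"
  unfolding sig_fun_def by (rule sigma1_delta0[of "\<lambda>M e. e 0 = e (Suc n)"]) (auto intro: delta0_intros)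

lemma sigma1_eq: "sig_fun f \<Longrightarrow> sig_fun g \<Longrightarrow> sigma1 (\<lambda>e. f e = g e)"
  by (rule sigma1_2[of "(=)"]) (rule sigma1_delta0[of "\<lambda>M e. e 0 = e 1"], auto intro: delta0_intros)
lemma sigma1_less: "sig_fun f \<Longrightarrow> sig_fun g \<Longrightarrow> sigma1 (\<lambda>e. f e < g e)"
  by (rule sigma1_2[of "(<)"]) (rule sigma1_delta0[of "\<lambda>M e. ls M (e 0) (e 1)"], auto intro: delta0_intros)

lemma sigma1_ball:
  assumes "sigma1 (\<lambda>e. P (e 0) (\<lambda>n. e (Suc n)))" "sig_fun f"
  shows "sigma1 (\<lambda>e. \<forall>x<f e. P x e)"
proof -
  have "sigma1 (\<lambda>e. P (e 0) (\<lambda>n. e (Suc (Suc n))))"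
    using sigma1_ren[OF assms(1), of "\<lambda>n. case n of 0 \<Rightarrow> 0 | Suc m \<Rightarrow> Suc (Suc m)"] by simp
  then have "sigma1 (\<lambda>e. \<forall>x<e 0. P x (\<lambda>n. e (Suc n)))" by (rule sigma1_ball_var)
  from sigma1_conj[OF assms(2)[unfolded sig_fun_def] this]
  have "sigma1 (\<lambda>e. \<exists>y. y = f e \<and> (\<forall>x<y. P x e))" by (intro sigma1_ex)
  then show ?thesis by simp
qed

lemma sigma1_bex:
  assumes "sigma1 (\<lambda>e. P (e 0) (\<lambda>n. e (Suc n)))" "sig_fun f"
  shows "sigma1 (\<lambda>e. \<exists>x<f e. P x e)"
  by (intro sigma1_ex sigma1_conj sigma1_less sig_fun_var sig_fun_ren[OF assms(2)] assms(1))

lemma sig_fun_1: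
  assumes "sigma1 (\<lambda>e. e 0 = h (e 1))" "sig_fun f" shows "sig_fun (\<lambda>e. h (f e))"
  unfolding sig_fun_def using sigma1_2[where P = "\<lambda>y x. y = h x", OF assms(1) sig_fun_var[of 0] sig_fun_ren[OF assms(2), of Suc]] .

lemma sig_fun_2:
  assumes "sigma1 (\<lambda>e. e 0 = h (e 1) (e 2))" "sig_fun f" "sig_fun g" shows "sig_fun (\<lambda>e. h (f e) (g e))"
  unfolding sig_fun_def
  using sigma1_3[where P = "\<lambda>z x y. z = h x y", OF assms(1) sig_fun_var[of 0] sig_fun_ren[OF assms(2), of Suc] sig_fun_ren[OF assms(3), of Suc]] .

lemma sig_fun_const: "sig_fun (\<lambda>e. c)"
proof -
  have "\<exists>t :: tm. \<forall>e. val std e t = c"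
  proof (induction c)
    case (Suc c)
    then obtain t where "\<forall>e. val std e t = c" by blast
    then have "\<forall>e. val std e (Add t One) = Suc c" by simp
    then show ?case by blast
  qed (rule exI[of _ Zero], simp)
  then obtain t where t: "\<forall>e. val std e t = c" by blast
  have "delta0 (\<lambda>M e. e 0 = val M e t)" by (intro delta0_eq term_fn_var) (auto simp: term_fn_def)
  then show ?thesis unfolding sig_fun_def by (rule sigma1_delta0) (simp add: t)
qed

lemma sig_fun_add: "sig_fun f \<Longrightarrow> sig_fun g \<Longrightarrow> sig_fun (\<lambda>e. f e + g e)"
  by (rule sig_fun_2[of "(+)"]) (rule sigma1_delta0[of "\<lambda>M e. e 0 = ad M (e 1) (e 2)"], intro delta0_intros, simp)
lemma sig_fun_mul: "sig_fun f \<Longrightarrow> sig_fun g \<Longrightarrow> sig_fun (\<lambda>e. f e * g e)"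
  by (rule sig_fun_2[of "(*)"]) (rule sigma1_delta0[of "\<lambda>M e. e 0 = mu M (e 1) (e 2)"], intro delta0_intros, simp)
lemma sig_fun_Suc: "sig_fun f \<Longrightarrow> sig_fun (\<lambda>e. Suc (f e))"
  using sig_fun_add[OF sig_fun_const[of 1], of f] by simp

text \<open>Doubling removes the division from the triangle number n (n + 1) / 2 in Cantor's
  pairing, so the graph becomes an equation between terms.\<close>

lemma prod_encode_graph: "z = prod_encode (x, y) \<longleftrightarrow> z + z = (x + y) * Suc (x + y) + (x + x)"
proof -
  have "2 * triangle n = n * Suc n" for n by (induction n) auto
  from this[of "x + y"] show ?thesis by (auto simp: prod_encode_def)
qed

lemma sig_fun_prod_encode:
  assumes "sig_fun f" "sig_fun g" shows "sig_fun (\<lambda>e. prod_encode (f e, g e))"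
proof -
  have "sigma1 (\<lambda>e. e 0 = prod_encode (e 1, e 2))"
    unfolding prod_encode_graph by (intro sigma1_eq sig_fun_add sig_fun_mul sig_fun_Suc sig_fun_var)
  from sig_fun_2[where h = "\<lambda>x y. prod_encode (x, y)", OF this assms] show ?thesis .
qed

section \<open>Goedel's beta function\<close>

definition beta :: "nat \<Rightarrow> nat \<Rightarrow> nat \<Rightarrow> nat" where
  "beta a b i = a mod Suc (Suc i * b)"

lemma beta_graph: "r = beta a b i \<longleftrightarrow> r < Suc (Suc i * b) \<and> (\<exists>q. a = q * Suc (Suc i * b) + r)"
proof
  assume "r = beta a b i"
  then have "r < Suc (Suc i * b)" "a = (a div Suc (Suc i * b)) * Suc (Suc i * b) + r"
    unfolding beta_def by (simp_all only: div_mult_mod_eq mod_less_divisor zero_less_Suc)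
  then show "r < Suc (Suc i * b) \<and> (\<exists>q. a = q * Suc (Suc i * b) + r)" by blast
next
  assume "r < Suc (Suc i * b) \<and> (\<exists>q. a = q * Suc (Suc i * b) + r)"
  then obtain q where "r < Suc (Suc i * b)" "a = q * Suc (Suc i * b) + r" by blast
  then show "r = beta a b i" unfolding beta_def by (simp only: mod_mult_self3 mod_less)
qed

lemma sig_fun_beta:
  assumes "sig_fun f" "sig_fun g" "sig_fun h" shows "sig_fun (\<lambda>e. beta (f e) (g e) (h e))"
proof -
  have "sigma1 (\<lambda>e. e 0 = beta (f (\<lambda>n. e (Suc n))) (g (\<lambda>n. e (Suc n))) (h (\<lambda>n. e (Suc n))))"
    unfolding beta_graph
    by (intro sigma1_ex sigma1_conj sigma1_less sigma1_eq sig_fun_add sig_fun_mul sig_fun_Suc sig_fun_var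
        sig_fun_ren[OF assms(1)] sig_fun_ren[OF assms(2)] sig_fun_ren[OF assms(3)])
  then show ?thesis by (simp add: sig_fun_def)
qed

text \<open>Goedel's lemma, by the Chinese remainder theorem for the moduli 1 + (i + 1) b.\<close>

lemma beta_exists: "\<exists>a b. \<forall>i<n. beta a b i = f i"
proof -
  \<comment> \<open>m dominates the length and all values. Hence (m + 1)! is divisible by every
    positive difference of positions and exceeds every value.\<close>
  define m where "m = n + (\<Sum>i<n. f i)"
  define b where "b = fact (Suc m) * (1::nat)"
  let ?u = "\<lambda>i. Suc (Suc i * b)"
  have cop: "coprime (?u i) (?u j)" if "i < j" "j < n" for i j
  proof (rule ccontr)
    assume "\<not> coprime (?u i) (?u j)"
    then obtain p where "prime p" "p dvd gcd (?u i) (?u j)"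
      using prime_factor_nat coprime_iff_gcd_eq_1 by blast
    then have p: "prime p" "p dvd ?u i" "p dvd ?u j" by auto
    \<comment> \<open>A common prime divides the difference of the two moduli, hence j - i or b,
      hence b in either case; then it divides 1.\<close>
    have "p dvd (j - i) * b"
    proof -
      have "?u j - ?u i = (j - i) * b" by (simp add: diff_mult_distrib)
      then show ?thesis using dvd_diff_nat[OF p(3,2)] by simp
    qed
    then have "p dvd (j - i) \<or> p dvd b" using p(1) prime_dvd_mult_iff by blast
    moreover have "p dvd b" if "p dvd (j - i)"
    proof -
      have "p \<le> j - i" using that \<open>i < j\<close> by (simp add: dvd_imp_le)
      then have "p \<le> Suc m" using \<open>j < n\<close> by (simp add: m_def)
      then show ?thesis using dvd_fact[OF prime_ge_1_nat[OF p(1)]] by (simp add: b_def del: fact_Suc)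
    qed
    ultimately have "p dvd Suc i * b" by auto
    then have "p dvd 1" using p(2) by (metis Suc_eq_plus1 dvd_add_right_iff)
    then show False using p(1) not_prime_unit by blast
  qed
  have "\<exists>x. \<forall>i\<in>{..<n}. [x = f i] (mod ?u i)"
  proof (rule chinese_remainder_nat)
    show "\<forall>i\<in>{..<n}. \<forall>j\<in>{..<n}. i \<noteq> j \<longrightarrow> coprime (?u i) (?u j)"
      using cop by (metis coprime_commute lessThan_iff linorder_neqE_nat)
  qed simp
  then obtain x where x: "\<forall>i<n. [x = f i] (mod ?u i)" by blast
  have "beta x b i = f i" if "i < n" for i
  proof -
    have "f i \<le> m" using member_le_sum[of i "{..<n}" f] that by (simp add: m_def)
    also have "m < b" using fact_ge_self[of "Suc m"] by (simp add: b_def del: fact_Suc)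
    also have "b \<le> Suc i * b" by simp
    finally have "f i < ?u i" by simp
    then show ?thesis using x that by (simp add: cong_def beta_def)
  qed
  then show ?thesis by blast
qed

text \<open>
  All syntactic relations are obtained as closures under rules with at most two premises; a rule
  with one premise ignores its third argument.
\<close>

inductive clos :: "(nat \<Rightarrow> bool) \<Rightarrow> (nat \<Rightarrow> nat \<Rightarrow> nat \<Rightarrow> bool) \<Rightarrow> nat \<Rightarrow> bool" for B R where
  base: "B x \<Longrightarrow> clos B R x"
| step: "R x y z \<Longrightarrow> clos B R y \<Longrightarrow> clos B R z \<Longrightarrow> clos B R x"

definition derivation :: "(nat \<Rightarrow> bool) \<Rightarrow> (nat \<Rightarrow> nat \<Rightarrow> nat \<Rightarrow> bool) \<Rightarrow> (nat \<Rightarrow> nat) \<Rightarrow> nat \<Rightarrow> bool" where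
  "derivation B R f n \<longleftrightarrow> (\<forall>i<n. B (f i) \<or> (\<exists>j<i. \<exists>k<i. R (f i) (f j) (f k)))"

text \<open>Derivations in the closure are trees; \<open>derivation\<close> lists them linearly so
  that the beta function can code them. The lists of two premises are concatenated and the new
  conclusion is appended.\<close>

lemma clos_derivation: "clos B R x \<longleftrightarrow> (\<exists>f n. derivation B R f (Suc n) \<and> f n = x)"
proof
  assume "clos B R x"
  then show "\<exists>f n. derivation B R f (Suc n) \<and> f n = x"
  proof induction
    case (base x)
    then have "derivation B R (\<lambda>_. x) (Suc 0)" by (simp add: derivation_def)
    then show ?case by blast
  next
    case (step x y z)
    then obtain f n g m where f: "derivation B R f (Suc n)" "f n = y" "derivation B R g (Suc m)" "g m = z"
      by blast
    define h where "h i = (if i \<le> n then f i else if i \<le> n + Suc m then g (i - Suc n) else x)" for i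
    have "derivation B R h (Suc (n + Suc (Suc m)))"
      unfolding derivation_def
    proof (intro allI impI)
      fix i assume i: "i < Suc (n + Suc (Suc m))"
      consider "i \<le> n" | "n < i" "i \<le> n + Suc m" | "i = n + Suc (Suc m)" using i by linarith
      then show "B (h i) \<or> (\<exists>j<i. \<exists>k<i. R (h i) (h j) (h k))"
      proof cases
        case 1
        then show ?thesis using f(1)[unfolded derivation_def, rule_format, of i]
          by (auto simp: h_def less_Suc_eq_le) (meson le_trans less_imp_le_nat)
      next
        case 2
        then have "i - Suc n < Suc m" by linarith
        with f(3) have "B (g (i - Suc n)) \<or> (\<exists>j<i - Suc n. \<exists>k<i - Suc n. R (g (i - Suc n)) (g j) (g k))"
          unfolding derivation_def by blast
        then show ?thesis
        proof
          assume "B (g (i - Suc n))" then show ?thesis using 2 by (simp add: h_def)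
        next
          assume "\<exists>j<i - Suc n. \<exists>k<i - Suc n. R (g (i - Suc n)) (g j) (g k)"
          then obtain j k where "j < i - Suc n" "k < i - Suc n" "R (g (i - Suc n)) (g j) (g k)" by blast
          then have "j + Suc n < i" "k + Suc n < i" "R (h i) (h (j + Suc n)) (h (k + Suc n))"
            using 2 by (auto simp: h_def)
          then show ?thesis by blast
        qed
      next
        case 3
        then have "h i = x" "h n = y" "h (n + Suc m) = z" "n < i" "n + Suc m < i"
          using f by (auto simp: h_def)
        then show ?thesis using step.hyps(1) by metis
      qed
    qed
    moreover have "h (n + Suc (Suc m)) = x" by (simp add: h_def)
    ultimately show ?case by blast
  qed
next
  assume "\<exists>f n. derivation B R f (Suc n) \<and> f n = x"
  then obtain f n where f: "derivation B R f (Suc n)" "f n = x" by blast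
  have "i < Suc n \<Longrightarrow> clos B R (f i)" for i
  proof (induction i rule: less_induct)
    case (less i)
    then consider "B (f i)" | j k where "j < i" "k < i" "R (f i) (f j) (f k)"
      using f(1)[unfolded derivation_def, rule_format, of i] by blast
    then show ?case
    proof cases
      case 2
      then show ?thesis using less clos.step[of R "f i" "f j" "f k" B] by simp
    qed (rule clos.base)
  qed
  then show "clos B R x" using f(2) by blast
qed

lemma sigma1_clos:
  assumes B: "sigma1 (\<lambda>e. B (e 0))" and R: "sigma1 (\<lambda>e. R (e 0) (e 1) (e 2))"
  shows "sigma1 (\<lambda>e. clos B R (e 0))"
proof -
  have eq: "clos B R x \<longleftrightarrow> (\<exists>a b n. (\<forall>i<Suc n. B (beta a b i) \<or> (\<exists>j<i. \<exists>k<i. R (beta a b i) (beta a b j) (beta a b k)))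
    \<and> beta a b n = x)"
    (is "_ = ?r") for x
  proof
    assume "clos B R x"
    then obtain f n where f: "derivation B R f (Suc n)" "f n = x" using clos_derivation by blast
    obtain a b where ab: "\<forall>i<Suc n. beta a b i = f i" using beta_exists by blast
    have "derivation B R (beta a b) (Suc n)"
      using f(1) ab unfolding derivation_def by (metis less_trans)
    then show ?r unfolding derivation_def using ab f(2) by (intro exI) auto
  next
    assume ?r then show "clos B R x"
      unfolding clos_derivation derivation_def by blast
  qed
  show ?thesis unfolding eq
    by (intro sigma1_ex sigma1_conj sigma1_ball sigma1_bex sigma1_disj sigma1_eq sigma1_1[OF B] sigma1_3[OF R] sig_fun_beta sig_fun_Suc sig_fun_var)
qed

lemmas sigma1_intros = sigma1_ex sigma1_ball sigma1_bex sigma1_conj sigma1_disj sigma1_eq sigma1_less sig_fun_prod_encode sig_fun_add sig_fun_mul sig_fun_Suc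
  sig_fun_const sig_fun_var

abbreviation pe :: "nat \<Rightarrow> nat \<Rightarrow> nat" where
  "pe x y \<equiv> prod_encode (x, y)"

lemma list_decode_eq_iff: "list_decode l = xs \<longleftrightarrow> l = list_encode xs"
  by (metis list_decode_inverse list_encode_inverse)

lemma ex_list_code: "(\<exists>xs. P xs) \<longleftrightarrow> (\<exists>l. P (list_decode l))"
  by (metis list_encode_inverse)

section \<open>Computable relations are existentially definable\<close>

definition runs :: "recf \<Rightarrow> nat \<Rightarrow> nat \<Rightarrow> bool" where
  "runs f l y \<longleftrightarrow> computes f (list_decode l) y"

lemma computes_Zero: "computes ZeroF xs y \<longleftrightarrow> y = 0"
  by (subst computes.simps) auto
lemma computes_Succ: "computes SuccF xs y \<longleftrightarrow> (\<exists>x. xs = [x] \<and> y = Suc x)"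
  by (subst computes.simps) auto
lemma computes_Proj: "computes (Proj i) xs y \<longleftrightarrow> i < length xs \<and> y = xs ! i"
  by (subst computes.simps) auto
lemma computes_Comp: "computes (Comp f gs) xs z \<longleftrightarrow> (\<exists>ys. list_all2 (\<lambda>g y. computes g xs y) gs ys \<and> computes f ys z)"
  by (subst computes.simps) auto
lemma computes_Mu: "computes (Mu f) xs n \<longleftrightarrow> computes f (n # xs) 0 \<and> (\<forall>m<n. \<exists>k. computes f (m # xs) (Suc k))"
  by (subst computes.simps) auto

text \<open>\<open>list_encode\<close> maps the empty list to 0 and x # xs to
  \<open>Suc (pe x l)\<close> with l the code of xs, so list patterns are equations between
  definable functions. The index is fixed, hence the induction on it takes place outside the
  language.\<close>

lemma sigma1_nth: "sigma1 (\<lambda>e. i < length (list_decode (e 0)) \<and> e 1 = list_decode (e 0) ! i)"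
proof (induction i)
  case 0
  have eq: "(0 < length (list_decode l) \<and> y = list_decode l ! 0) \<longleftrightarrow> (\<exists>l'. l = Suc (pe y l'))" for l y
  proof (cases "list_decode l")
    case (Cons a as) then show ?thesis by (auto simp: list_decode_eq_iff)
  qed (auto simp: list_decode_eq_iff)
  show ?case unfolding eq by (intro sigma1_intros)
next
  case (Suc i)
  have eq: "(Suc i < length (list_decode l) \<and> y = list_decode l ! Suc i) \<longleftrightarrow>
    (\<exists>x l'. l = Suc (pe x l') \<and> i < length (list_decode l') \<and> y = list_decode l' ! i)" for l y
  proof (cases "list_decode l")
    case (Cons a as) then show ?thesis by (auto simp: list_decode_eq_iff)
  qed (auto simp: list_decode_eq_iff)
  show ?case unfolding eq
    by (intro sigma1_intros sigma1_2[where P = "\<lambda>l y. i < length (list_decode l) \<and> y = list_decode l ! i", OF Suc])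
qed

lemma sigma1_list_all2:
  assumes "\<And>g. g \<in> set gs \<Longrightarrow> sigma1 (\<lambda>e. runs g (e 0) (e 1))"
  shows "sigma1 (\<lambda>e. list_all2 (\<lambda>g y. runs g (e 0) y) gs (list_decode (e 1)))"
  using assms
proof (induction gs)
  case Nil
  have eq: "list_all2 (\<lambda>g y. runs g l y) [] (list_decode m) \<longleftrightarrow> m = 0" for l m
    by (simp add: list_decode_eq_iff)
  show ?case unfolding eq by (intro sigma1_intros)
next
  case (Cons g gs)
  have eq: "list_all2 (\<lambda>g y. runs g l y) (g # gs) (list_decode m) \<longleftrightarrow>
    (\<exists>y m'. m = Suc (pe y m') \<and> runs g l y \<and> list_all2 (\<lambda>g y. runs g l y) gs (list_decode m'))" for l m
  proof (cases "list_decode m")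
    case (Cons a as) then show ?thesis by (auto simp: list_decode_eq_iff)
  qed (auto simp: list_decode_eq_iff)
  have g: "sigma1 (\<lambda>e. runs g (e 0) (e 1))" using Cons by simp
  have gs: "sigma1 (\<lambda>e. list_all2 (\<lambda>g y. runs g (e 0) y) gs (list_decode (e 1)))" using Cons by simp
  show ?case unfolding eq
    by (intro sigma1_intros sigma1_2[OF g] sigma1_2[where P = "\<lambda>l m. list_all2 (\<lambda>g y. runs g l y) gs (list_decode m)", OF gs])
qed

text \<open>The closure consists of pairs of an argument list and a value. Only the recursive call
  is a premise; calls of the functions f and g are side conditions, definable by the induction
  hypothesis of \<open>sigma1_runs\<close>.\<close>

definition primrec_base :: "recf \<Rightarrow> nat \<Rightarrow> bool" where
  "primrec_base f x \<longleftrightarrow> (\<exists>l z. x = pe (Suc (pe 0 l)) z \<and> runs f l z)"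
definition primrec_step :: "recf \<Rightarrow> nat \<Rightarrow> nat \<Rightarrow> nat \<Rightarrow> bool" where
  "primrec_step g x y y' \<longleftrightarrow> (\<exists>n l u z. x = pe (Suc (pe (Suc n) l)) z \<and> y = pe (Suc (pe n l)) u \<and>
    runs g (Suc (pe n (Suc (pe u l)))) z)"

lemma runs_PrimRec: "runs (PrimRec f g) l z \<longleftrightarrow> clos (primrec_base f) (primrec_step g) (pe l z)"
proof
  have "computes h xs z \<Longrightarrow> h = PrimRec f g \<Longrightarrow> clos (primrec_base f) (primrec_step g) (pe (list_encode xs) z)" for h xs
  proof (induction rule: computes.induct)
    case (5 f' xs z g')
    then show ?case by (intro clos.base) (auto simp: primrec_base_def runs_def)
  next
    case (6 f' g' n xs y z)
    then have IH: "clos (primrec_base f) (primrec_step g) (pe (list_encode (n # xs)) y)" by simp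
    show ?case
      by (rule clos.step[OF _ IH IH]) (use 6 in \<open>auto simp: primrec_step_def runs_def\<close>)
  qed auto
  then show "runs (PrimRec f g) l z \<Longrightarrow> clos (primrec_base f) (primrec_step g) (pe l z)"
    unfolding runs_def by (metis list_decode_inverse)
next
  have "clos (primrec_base f) (primrec_step g) x \<Longrightarrow> \<exists>l z. x = pe l z \<and> runs (PrimRec f g) l z" for x
  proof (induction rule: clos.induct)
    case (base x)
    then show ?case by (auto simp: primrec_base_def runs_def intro: computes.intros)
  next
    case (step x y z)
    then show ?case by (auto simp: primrec_step_def runs_def intro: computes.intros)
  qed
  then show "clos (primrec_base f) (primrec_step g) (pe l z) \<Longrightarrow> runs (PrimRec f g) l z" by fastforce
qed

lemma sigma1_runs: "sigma1 (\<lambda>e. runs f (e 0) (e 1))"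
proof (induction f)
  case ZeroF
  show ?case unfolding runs_def computes_Zero by (intro sigma1_intros)
next
  case SuccF
  have eq: "runs SuccF l y \<longleftrightarrow> (\<exists>x. l = Suc (pe x 0) \<and> y = Suc x)" for l y
    by (auto simp: runs_def computes_Succ list_decode_eq_iff)
  show ?case unfolding eq by (intro sigma1_intros)
next
  case (Proj i)
  show ?case unfolding runs_def computes_Proj by (rule sigma1_nth)
next
  case (Comp f gs)
  have eq: "runs (Comp f gs) l z \<longleftrightarrow> (\<exists>m. list_all2 (\<lambda>g y. runs g l y) gs (list_decode m) \<and> runs f m z)" for l z
    unfolding runs_def computes_Comp ex_list_code ..
  have gs: "sigma1 (\<lambda>e. list_all2 (\<lambda>g y. runs g (e 0) y) gs (list_decode (e 1)))"
    by (rule sigma1_list_all2) (rule Comp)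
  show ?case unfolding eq
    by (intro sigma1_intros sigma1_2[OF Comp(1)] sigma1_2[where P = "\<lambda>l m. list_all2 (\<lambda>g y. runs g l y) gs (list_decode m)", OF gs])
next
  case (PrimRec f g)
  have "sigma1 (\<lambda>e. clos (primrec_base f) (primrec_step g) (e 0))"
    by (rule sigma1_clos; unfold primrec_base_def primrec_step_def)
      (intro sigma1_intros sigma1_2[OF PrimRec(1)] sigma1_2[OF PrimRec(2)])+
  then show ?case unfolding runs_PrimRec by (rule sigma1_1) (intro sigma1_intros)
next
  case (Mu f)
  have eq: "runs (Mu f) l n \<longleftrightarrow> runs f (Suc (pe n l)) 0 \<and> (\<forall>m<n. \<exists>k. runs f (Suc (pe m l)) (Suc k))" for l n
    by (simp add: runs_def computes_Mu)
  show ?case unfolding eq by (intro sigma1_intros sigma1_2[OF Mu])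
qed

lemma sigma1_ce:
  assumes "ce_nat W" shows "sigma1 (\<lambda>e. e 0 \<in> W)"
proof -
  obtain f where W: "W = {x. \<exists>y. computes f [x] y}" using assms unfolding ce_nat_def by blast
  have eq: "x \<in> W \<longleftrightarrow> (\<exists>y. runs f (Suc (pe x 0)) y)" for x by (simp add: W runs_def)
  show ?thesis unfolding eq by (intro sigma1_intros sigma1_2[OF sigma1_runs])
qed

section \<open>Provability from a computably enumerable theory is existentially definable\<close>

lemma tm_code_eq_iff [simp]: "tm_code s = tm_code t \<longleftrightarrow> s = t"
  by (induction s arbitrary: t; case_tac t; simp)

lemma fm_code_eq_iff [simp]: "fm_code \<phi> = fm_code \<psi> \<longleftrightarrow> \<phi> = \<psi>"
  by (induction \<phi> arbitrary: \<psi>; case_tac \<psi>; simp)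

lemma fm_code_cases:
  "fm_code \<phi> = pe 0 (pe a b) \<longleftrightarrow> (\<exists>s t. \<phi> = Equal s t \<and> a = tm_code s \<and> b = tm_code t)"
  "fm_code \<phi> = pe 2 0 \<longleftrightarrow> \<phi> = Falsum"
  "fm_code \<phi> = pe 3 (pe a b) \<longleftrightarrow> (\<exists>\<psi> \<chi>. \<phi> = Imp \<psi> \<chi> \<and> fm_code \<psi> = a \<and> fm_code \<chi> = b)"
  "fm_code \<phi> = pe 4 a \<longleftrightarrow> (\<exists>\<psi>. \<phi> = Forall \<psi> \<and> fm_code \<psi> = a)"
  by (cases \<phi>; auto)+

text \<open>The rules of the calculus use shifting and instantiation only, and passing a quantifier
  applies \<open>up\<close>; these substitutions have finite descriptions and hence codes.\<close>

datatype sb = Shift | Inst tm | Under sb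

primrec den :: "sb \<Rightarrow> nat \<Rightarrow> tm" where
  "den Shift = (\<lambda>n. Var (Suc n))"
| "den (Inst t) = (\<lambda>n. case n of 0 \<Rightarrow> t | Suc m \<Rightarrow> Var m)"
| "den (Under s) = up (den s)"

primrec sb_code :: "sb \<Rightarrow> nat" where
  "sb_code Shift = pe 0 0"
| "sb_code (Inst t) = pe 1 (tm_code t)"
| "sb_code (Under s) = pe 2 (sb_code s)"

lemma sb_code_cases:
  "sb_code s = pe 0 a \<longleftrightarrow> s = Shift \<and> a = 0"
  "sb_code s = pe (Suc 0) a \<longleftrightarrow> (\<exists>t. s = Inst t \<and> a = tm_code t)"
  "sb_code s = pe 2 a \<longleftrightarrow> (\<exists>s'. s = Under s' \<and> a = sb_code s')"
  by (cases s; auto)+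

definition subst_tm_base :: "nat \<Rightarrow> bool" where
  "subst_tm_base x \<longleftrightarrow> (\<exists>s c d. x = pe s (pe c d) \<and>
    ((\<exists>n. s = pe 0 0 \<and> c = pe 0 n \<and> d = pe 0 (Suc n)) \<or>
     (\<exists>u. s = pe 1 u \<and> c = pe 0 0 \<and> d = u) \<or>
     (\<exists>u n. s = pe 1 u \<and> c = pe 0 (Suc n) \<and> d = pe 0 n) \<or>
     (\<exists>s'. s = pe 2 s' \<and> c = pe 0 0 \<and> d = pe 0 0) \<or>
     (c = pe 1 0 \<and> d = pe 1 0) \<or> (c = pe 2 0 \<and> d = pe 2 0)))"

text \<open>The first disjunct computes \<open>up\<close> at a successor: y gives the value d at n,
  and z the shifted term d'. That s codes a substitution is left to \<open>tm_graph_iff\<close>,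
  which speaks of \<open>sb_code s\<close> only.\<close>

definition subst_tm_step :: "nat \<Rightarrow> nat \<Rightarrow> nat \<Rightarrow> bool" where
  "subst_tm_step x y z \<longleftrightarrow>
    (\<exists>s n d d'. x = pe (pe 2 s) (pe (pe 0 (Suc n)) d') \<and> y = pe s (pe (pe 0 n) d) \<and> z = pe (pe 0 0) (pe d d')) \<or>
    (\<exists>s k c1 c2 d1 d2. (k = 3 \<or> k = 4) \<and> x = pe s (pe (pe k (pe c1 c2)) (pe k (pe d1 d2))) \<and>
      y = pe s (pe c1 d1) \<and> z = pe s (pe c2 d2))"

definition tm_graph :: "nat \<Rightarrow> nat \<Rightarrow> nat \<Rightarrow> bool" where
  "tm_graph s c d \<longleftrightarrow> clos subst_tm_base subst_tm_step (pe s (pe c d))"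

text \<open>Separated from the treatment of variables because the case \<open>Under\<close> in
  \<open>tm_graph_Var\<close> already needs the graph of \<open>Shift\<close> on arbitrary
  terms.\<close>

lemma tm_graph_if_Var:
  assumes "\<And>n. tm_graph (sb_code s) (pe 0 n) (tm_code (den s n))"
  shows "tm_graph (sb_code s) (tm_code t) (tm_code (subst_tm (den s) t))"
proof (induction t)
  case (Var n) then show ?case using assms by simp
next
  case (Add t u)
  show ?case unfolding tm_graph_def by (rule clos.step[OF _ Add[unfolded tm_graph_def]]) (auto simp: subst_tm_step_def)
next
  case (Mul t u)
  show ?case unfolding tm_graph_def by (rule clos.step[OF _ Mul[unfolded tm_graph_def]]) (auto simp: subst_tm_step_def)
qed (auto simp: tm_graph_def subst_tm_base_def intro: clos.base)

lemma tm_graph_Var: "tm_graph (sb_code s) (pe 0 n) (tm_code (den s n))"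
proof -
  have Var_Sh: "tm_graph (sb_code Shift) (pe 0 n) (tm_code (den Shift n))" for n
    unfolding tm_graph_def by (rule clos.base) (auto simp: subst_tm_base_def)
  show ?thesis
  proof (induction s arbitrary: n)
    case Shift show ?case by (rule Var_Sh)
  next
    case (Inst t)
    show ?case unfolding tm_graph_def by (rule clos.base, cases n) (auto simp: subst_tm_base_def)
  next
    case (Under s)
    show ?case
    proof (cases n)
      case 0
      then show ?thesis unfolding tm_graph_def by (intro clos.base) (auto simp: subst_tm_base_def up_def)
    next
      case (Suc m)
      have "tm_graph (pe 0 0) (tm_code (den s m)) (tm_code (lift_tm (den s m)))"
        using tm_graph_if_Var[of Shift, OF Var_Sh] by simp
      with Under[of m] show ?thesis unfolding tm_graph_def
        by (rule clos.step[rotated]) (auto simp: subst_tm_step_def Suc up_def)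
    qed
  qed
qed

lemma tm_graph_iff: "tm_graph (sb_code s) c d \<longleftrightarrow> (\<exists>t. c = tm_code t \<and> d = tm_code (subst_tm (den s) t))"
proof
  have "clos subst_tm_base subst_tm_step x \<Longrightarrow> x = pe (sb_code s) (pe c d) \<Longrightarrow>
    \<exists>t. c = tm_code t \<and> d = tm_code (subst_tm (den s) t)" for x
  proof (induction arbitrary: s c d rule: clos.induct)
    case (base x)
    then consider n where "s = Shift" "c = pe 0 n" "d = pe 0 (Suc n)"
      | u where "s = Inst u" "c = pe 0 0" "d = tm_code u"
      | u n where "s = Inst u" "c = pe 0 (Suc n)" "d = pe 0 n"
      | s' where "s = Under s'" "c = pe 0 0" "d = pe 0 0"
      | "c = pe 1 0" "d = pe 1 0" | "c = pe 2 0" "d = pe 2 0"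
      by (auto simp: subst_tm_base_def sb_code_cases)
    then show ?case
    proof cases
      case (1 n) then show ?thesis by (intro exI[of _ "Var n"]) simp
    next
      case (2 u) then show ?thesis by (intro exI[of _ "Var 0"]) simp
    next
      case (3 u n) then show ?thesis by (intro exI[of _ "Var (Suc n)"]) simp
    next
      case (4 s') then show ?thesis by (intro exI[of _ "Var 0"]) (simp add: up_def)
    next
      case 5 then show ?thesis by (intro exI[of _ Zero]) simp
    next
      case 6 then show ?thesis by (intro exI[of _ One]) simp
    qed
  next
    case (step x y z)
    from step.hyps(1) step.prems show ?case unfolding subst_tm_step_def
    proof (elim disjE exE conjE, goal_cases)
      case (1 u n e e')
      then have "sb_code s = pe 2 u" by simp
      then obtain s' where s: "s = Under s'" "u = sb_code s'" by (auto simp: sb_code_cases)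
      have "\<exists>t. pe 0 n = tm_code t \<and> e = tm_code (subst_tm (den s') t)"
        by (rule step.IH(1)) (use 1 s in simp)
      then obtain t where t: "tm_code (Var n) = tm_code t" "e = tm_code (subst_tm (den s') t)" by auto
      then have e: "e = tm_code (den s' n)" by (metis subst_tm.simps(1) tm_code_eq_iff)
      have "\<exists>t. e = tm_code t \<and> e' = tm_code (subst_tm (den Shift) t)"
        by (rule step.IH(2)) (use 1 in simp)
      then have "e' = tm_code (lift_tm (den s' n))" using e by auto
      then show ?case using 1 s by (intro exI[of _ "Var (Suc n)"]) (simp add: up_def)
    next
      case (2 u k c1 c2 d1 d2)
      then have "y = pe (sb_code s) (pe c1 d1)" "z = pe (sb_code s) (pe c2 d2)" by simp_all
      from step.IH(1)[OF this(1)] step.IH(2)[OF this(2)] obtain t1 t2 where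
        "c1 = tm_code t1 \<and> d1 = tm_code (subst_tm (den s) t1)"
        "c2 = tm_code t2 \<and> d2 = tm_code (subst_tm (den s) t2)" by blast
      then show ?case using 2 by (intro exI[of _ "Add t1 t2"]) simp
    next
      case (3 u k c1 c2 d1 d2)
      then have "y = pe (sb_code s) (pe c1 d1)" "z = pe (sb_code s) (pe c2 d2)" by simp_all
      from step.IH(1)[OF this(1)] step.IH(2)[OF this(2)] obtain t1 t2 where
        "c1 = tm_code t1 \<and> d1 = tm_code (subst_tm (den s) t1)"
        "c2 = tm_code t2 \<and> d2 = tm_code (subst_tm (den s) t2)" by blast
      then show ?case using 3 by (intro exI[of _ "Mul t1 t2"]) simp
    qed
  qed
  then show "tm_graph (sb_code s) c d \<Longrightarrow> \<exists>t. c = tm_code t \<and> d = tm_code (subst_tm (den s) t)"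
    unfolding tm_graph_def by blast
qed (auto intro: tm_graph_if_Var tm_graph_Var)

lemma sigma1_tm_graph: "sigma1 (\<lambda>e. tm_graph (e 0) (e 1) (e 2))"
proof -
  have "sigma1 (\<lambda>e. clos subst_tm_base subst_tm_step (e 0))"
    by (rule sigma1_clos; unfold subst_tm_base_def subst_tm_step_def) (intro sigma1_intros)+
  then show ?thesis unfolding tm_graph_def by (rule sigma1_1) (intro sigma1_intros)
qed

definition subst_fm_base :: "nat \<Rightarrow> bool" where
  "subst_fm_base x \<longleftrightarrow> (\<exists>s. x = pe s (pe (pe 2 0) (pe 2 0))) \<or>
    (\<exists>s k c1 c2 d1 d2. (k = 0 \<or> k = 1) \<and> x = pe s (pe (pe k (pe c1 c2)) (pe k (pe d1 d2))) \<and>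
      tm_graph s c1 d1 \<and> tm_graph s c2 d2)"

definition subst_fm_step :: "nat \<Rightarrow> nat \<Rightarrow> nat \<Rightarrow> bool" where
  "subst_fm_step x y z \<longleftrightarrow>
    (\<exists>s c1 c2 d1 d2. x = pe s (pe (pe 3 (pe c1 c2)) (pe 3 (pe d1 d2))) \<and>
      y = pe s (pe c1 d1) \<and> z = pe s (pe c2 d2)) \<or>
    (\<exists>s c d. x = pe s (pe (pe 4 c) (pe 4 d)) \<and> y = pe (pe 2 s) (pe c d))"

definition fm_graph :: "nat \<Rightarrow> nat \<Rightarrow> nat \<Rightarrow> bool" where
  "fm_graph s c d \<longleftrightarrow> clos subst_fm_base subst_fm_step (pe s (pe c d))"

lemma fm_graph_iff: "fm_graph (sb_code s) c d \<longleftrightarrow> (\<exists>\<phi>. c = fm_code \<phi> \<and> d = fm_code (subst_fm (den s) \<phi>))"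
proof
  have "clos subst_fm_base subst_fm_step x \<Longrightarrow> x = pe (sb_code s) (pe c d) \<Longrightarrow>
    \<exists>\<phi>. c = fm_code \<phi> \<and> d = fm_code (subst_fm (den s) \<phi>)" for x
  proof (induction arbitrary: s c d rule: clos.induct)
    case (base x)
    from base show ?case unfolding subst_fm_base_def
    proof (elim disjE exE conjE, goal_cases)
      case 1 then show ?case by (intro exI[of _ Falsum]) simp
    next
      case (2 u k c1 c2 d1 d2)
      then obtain t1 t2 where "c1 = tm_code t1 \<and> d1 = tm_code (subst_tm (den s) t1)"
        "c2 = tm_code t2 \<and> d2 = tm_code (subst_tm (den s) t2)" using tm_graph_iff by (metis Pair_inject prod_encode_eq)
      then show ?case using 2 by (intro exI[of _ "Equal t1 t2"]) simp
    next
      case (3 u k c1 c2 d1 d2)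
      then obtain t1 t2 where "c1 = tm_code t1 \<and> d1 = tm_code (subst_tm (den s) t1)"
        "c2 = tm_code t2 \<and> d2 = tm_code (subst_tm (den s) t2)" using tm_graph_iff by (metis Pair_inject prod_encode_eq)
      then show ?case using 3 by (intro exI[of _ "Less t1 t2"]) simp
    qed
  next
    case (step x y z)
    from step.hyps(1) step.prems show ?case unfolding subst_fm_step_def
    proof (elim disjE exE conjE, goal_cases)
      case (1 u c1 c2 d1 d2)
      have "\<exists>\<phi>. c1 = fm_code \<phi> \<and> d1 = fm_code (subst_fm (den s) \<phi>)"
        by (rule step.IH(1)) (use 1 in simp)
      moreover have "\<exists>\<phi>. c2 = fm_code \<phi> \<and> d2 = fm_code (subst_fm (den s) \<phi>)"
        by (rule step.IH(2)) (use 1 in simp)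
      ultimately obtain t1 t2 where "c1 = fm_code t1 \<and> d1 = fm_code (subst_fm (den s) t1)"
        "c2 = fm_code t2 \<and> d2 = fm_code (subst_fm (den s) t2)" by blast
      then show ?case using 1 by (intro exI[of _ "Imp t1 t2"]) simp
    next
      case (2 u c' d')
      have "\<exists>\<phi>. c' = fm_code \<phi> \<and> d' = fm_code (subst_fm (den (Under s)) \<phi>)"
        by (rule step.IH(1)) (use 2 in simp)
      then obtain \<phi> where "c' = fm_code \<phi> \<and> d' = fm_code (subst_fm (den (Under s)) \<phi>)" by blast
      then show ?case using 2 by (intro exI[of _ "Forall \<phi>"]) simp
    qed
  qed
  then show "fm_graph (sb_code s) c d \<Longrightarrow> \<exists>\<phi>. c = fm_code \<phi> \<and> d = fm_code (subst_fm (den s) \<phi>)"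
    unfolding fm_graph_def by blast
next
  have tm_graph: "tm_graph (sb_code s) (tm_code t) (tm_code (subst_tm (den s) t))" for s t
    using tm_graph_iff by blast
  have "fm_graph (sb_code s) (fm_code \<phi>) (fm_code (subst_fm (den s) \<phi>))" for \<phi>
  proof (induction \<phi> arbitrary: s)
    case (Equal t u)
    show ?case unfolding fm_graph_def by (intro clos.base) (auto simp: subst_fm_base_def tm_graph)
  next
    case (Less t u)
    show ?case unfolding fm_graph_def by (intro clos.base) (auto simp: subst_fm_base_def tm_graph)
  next
    case Falsum
    show ?case unfolding fm_graph_def by (intro clos.base) (auto simp: subst_fm_base_def)
  next
    case (Imp \<phi> \<psi>)
    show ?case unfolding fm_graph_def
      by (rule clos.step[OF _ Imp[of s, unfolded fm_graph_def]]) (auto simp: subst_fm_step_def)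
  next
    case (Forall \<phi>)
    show ?case unfolding fm_graph_def
      by (rule clos.step[OF _ Forall[of "Under s", unfolded fm_graph_def] Forall[of "Under s", unfolded fm_graph_def]])
        (auto simp: subst_fm_step_def)
  qed
  then show "\<exists>\<phi>. c = fm_code \<phi> \<and> d = fm_code (subst_fm (den s) \<phi>) \<Longrightarrow> fm_graph (sb_code s) c d" by blast
qed

lemma sigma1_fm_graph: "sigma1 (\<lambda>e. fm_graph (e 0) (e 1) (e 2))"
proof -
  have "sigma1 (\<lambda>e. clos subst_fm_base subst_fm_step (e 0))"
    by (rule sigma1_clos; unfold subst_fm_base_def subst_fm_step_def) (intro sigma1_intros sigma1_3[OF sigma1_tm_graph])+
  then show ?thesis unfolding fm_graph_def by (rule sigma1_1) (intro sigma1_intros)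
qed

section \<open>Coded contexts and derivations\<close>

abbreviation lcode :: "fm list \<Rightarrow> nat" where
  "lcode \<Gamma> \<equiv> list_encode (map fm_code \<Gamma>)"

lemma lcode_cases:
  "lcode \<Gamma> = 0 \<longleftrightarrow> \<Gamma> = []"
  "lcode \<Gamma> = Suc (pe a l) \<longleftrightarrow> (\<exists>\<phi> \<Delta>. \<Gamma> = \<phi> # \<Delta> \<and> fm_code \<phi> = a \<and> l = lcode \<Delta>)"
  by (cases \<Gamma>; auto)+

lemma lcode_eq_iff [simp]: "lcode \<Gamma> = lcode \<Delta> \<longleftrightarrow> \<Gamma> = \<Delta>"
  by (simp add: inj_map_eq_map inj_def list_encode_eq)

definition lift_list_step :: "nat \<Rightarrow> nat \<Rightarrow> nat \<Rightarrow> bool" where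
  "lift_list_step x y z \<longleftrightarrow> (\<exists>c d l l'. x = pe (Suc (pe c l)) (Suc (pe d l')) \<and> y = pe l l' \<and> fm_graph (pe 0 0) c d)"

definition lift_graph :: "nat \<Rightarrow> nat \<Rightarrow> bool" where
  "lift_graph l l' \<longleftrightarrow> clos (\<lambda>x. x = pe 0 0) lift_list_step (pe l l')"

lemma fm_graph_lift: "fm_graph (pe 0 0) c d \<longleftrightarrow> (\<exists>\<phi>. c = fm_code \<phi> \<and> d = fm_code (lift_fm \<phi>))"
  using fm_graph_iff[of Shift] by simp

lemma lift_graph_iff: "lift_graph l l' \<longleftrightarrow> (\<exists>\<Gamma>. l = lcode \<Gamma> \<and> l' = lcode (map lift_fm \<Gamma>))"
proof
  have "clos (\<lambda>x. x = pe 0 0) lift_list_step x \<Longrightarrow> \<exists>\<Gamma>. x = pe (lcode \<Gamma>) (lcode (map lift_fm \<Gamma>))" for x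
  proof (induction rule: clos.induct)
    case (base x) then show ?case by (intro exI[of _ "[]"]) simp
  next
    case (step x y z)
    then obtain c d l l' where x: "x = pe (Suc (pe c l)) (Suc (pe d l'))" "y = pe l l'" "fm_graph (pe 0 0) c d"
      unfolding lift_list_step_def by blast
    then obtain \<phi> where "c = fm_code \<phi>" "d = fm_code (lift_fm \<phi>)" using fm_graph_lift by blast
    moreover obtain \<Gamma> where "y = pe (lcode \<Gamma>) (lcode (map lift_fm \<Gamma>))" using step by blast
    ultimately show ?case using x by (intro exI[of _ "\<phi> # \<Gamma>"]) simp
  qed
  then show "lift_graph l l' \<Longrightarrow> \<exists>\<Gamma>. l = lcode \<Gamma> \<and> l' = lcode (map lift_fm \<Gamma>)"
    unfolding lift_graph_def by fastforce
next
  have "lift_graph (lcode \<Gamma>) (lcode (map lift_fm \<Gamma>))" for \<Gamma>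
  proof (induction \<Gamma>)
    case Nil then show ?case by (auto simp: lift_graph_def intro: clos.base)
  next
    case (Cons \<phi> \<Gamma>)
    show ?case unfolding lift_graph_def
      by (rule clos.step[OF _ Cons[unfolded lift_graph_def] Cons[unfolded lift_graph_def]]) (auto simp: lift_list_step_def fm_graph_lift)
  qed
  then show "\<exists>\<Gamma>. l = lcode \<Gamma> \<and> l' = lcode (map lift_fm \<Gamma>) \<Longrightarrow> lift_graph l l'" by blast
qed

lemma sigma1_lift_graph: "sigma1 (\<lambda>e. lift_graph (e 0) (e 1))"
proof -
  have "sigma1 (\<lambda>e. clos (\<lambda>x. x = pe 0 0) lift_list_step (e 0))"
    by (rule sigma1_clos; (unfold lift_list_step_def)?) (intro sigma1_intros sigma1_3[OF sigma1_fm_graph])+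
  then show ?thesis unfolding lift_graph_def by (rule sigma1_1) (intro sigma1_intros)
qed

definition member_base :: "nat \<Rightarrow> bool" where
  "member_base x \<longleftrightarrow> (\<exists>c l. x = pe c (Suc (pe c l)))"
definition member_step :: "nat \<Rightarrow> nat \<Rightarrow> nat \<Rightarrow> bool" where
  "member_step x y z \<longleftrightarrow> (\<exists>c d l. x = pe c (Suc (pe d l)) \<and> y = pe c l)"
definition member_code :: "nat \<Rightarrow> nat \<Rightarrow> bool" where
  "member_code c l \<longleftrightarrow> clos member_base member_step (pe c l)"

lemma member_code_iff: "member_code c l \<longleftrightarrow> c \<in> set (list_decode l)"
proof
  have "clos member_base member_step x \<Longrightarrow> \<exists>c l. x = pe c l \<and> c \<in> set (list_decode l)" for x
    by (induction rule: clos.induct) (auto simp: member_base_def member_step_def)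
  then show "member_code c l \<Longrightarrow> c \<in> set (list_decode l)" unfolding member_code_def by fastforce
next
  have "c \<in> set xs \<Longrightarrow> member_code c (list_encode xs)" for xs
  proof (induction xs)
    case (Cons x xs)
    show ?case
    proof (cases "c = x")
      case True then show ?thesis by (auto simp: member_code_def member_base_def intro!: clos.base)
    next
      case False
      then have "clos member_base member_step (pe c (list_encode xs))" using Cons by (simp add: member_code_def)
      from clos.step[OF _ this this] show ?thesis by (simp add: member_code_def member_step_def)
    qed
  qed simp
  then show "c \<in> set (list_decode l) \<Longrightarrow> member_code c l" by (metis list_decode_inverse)
qed

lemma sigma1_member_code: "sigma1 (\<lambda>e. member_code (e 0) (e 1))"
proof -
  have "sigma1 (\<lambda>e. clos member_base member_step (e 0))"
    by (rule sigma1_clos; unfold member_base_def member_step_def) (intro sigma1_intros)+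
  then show ?thesis unfolding member_code_def by (rule sigma1_1) (intro sigma1_intros)
qed

text \<open>\<open>lift_graph l l'\<close> and \<open>tm_graph (pe 0 0) t u\<close> act as tests:
  they hold for some l' and u exactly if l codes a list of formulas and t is the code of a
  term.\<close>

definition prov_base :: "nat set \<Rightarrow> nat \<Rightarrow> bool" where
  "prov_base W x \<longleftrightarrow> (\<exists>l l' c. x = pe l c \<and> lift_graph l l' \<and>
    (c \<in> W \<or> member_code c l \<or> (\<exists>t u. c = pe 0 (pe t t) \<and> tm_graph (pe 0 0) t u)))"

text \<open>The disjuncts correspond in order to \<open>ImpI\<close>, \<open>ImpE\<close>,
  \<open>Contr\<close>, \<open>ForallI\<close>, \<open>ForallE\<close> and \<open>EqSubst\<close>;
  \<open>Assm\<close> and \<open>EqRefl\<close> are in \<open>prov_base\<close>.\<close>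

definition prov_step :: "nat \<Rightarrow> nat \<Rightarrow> nat \<Rightarrow> bool" where
  "prov_step x y z \<longleftrightarrow>
    (\<exists>l a b. x = pe l (pe 3 (pe a b)) \<and> y = pe (Suc (pe a l)) b) \<or>
    (\<exists>l a b. x = pe l b \<and> y = pe l (pe 3 (pe a b)) \<and> z = pe l a) \<or>
    (\<exists>l a. x = pe l a \<and> y = pe (Suc (pe (pe 3 (pe a (pe 2 0))) l)) (pe 2 0)) \<or>
    (\<exists>l l' a. x = pe l (pe 4 a) \<and> lift_graph l l' \<and> y = pe l' a) \<or>
    (\<exists>l a t b u. x = pe l b \<and> y = pe l (pe 4 a) \<and> tm_graph (pe 0 0) t u \<and> fm_graph (pe 1 t) a b) \<or>
    (\<exists>l s t a b c. x = pe l c \<and> y = pe l (pe 0 (pe s t)) \<and> z = pe l b \<and> fm_graph (pe 1 s) a b \<and> fm_graph (pe 1 t) a c)"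

definition prov_code :: "nat set \<Rightarrow> nat \<Rightarrow> nat \<Rightarrow> bool" where
  "prov_code W l c \<longleftrightarrow> clos (prov_base W) prov_step (pe l c)"

lemma sigma1_prov_code:
  assumes "sigma1 (\<lambda>e. e 0 \<in> W)" shows "sigma1 (\<lambda>e. prov_code W (e 0) (e 1))"
proof -
  have 1: "sigma1 (\<lambda>e. prov_base W (e 0))" unfolding prov_base_def
    by (intro sigma1_intros sigma1_2[OF sigma1_lift_graph] sigma1_2[OF sigma1_member_code] sigma1_3[OF sigma1_tm_graph] sigma1_1[OF assms])
  have 2: "sigma1 (\<lambda>e. prov_step (e 0) (e 1) (e 2))" unfolding prov_step_def
    by (intro sigma1_intros sigma1_2[OF sigma1_lift_graph] sigma1_3[OF sigma1_tm_graph] sigma1_3[OF sigma1_fm_graph])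
  show ?thesis unfolding prov_code_def by (rule sigma1_1[OF sigma1_clos[OF 1 2]]) (intro sigma1_intros)
qed

lemma tm_graph_wf: "tm_graph (pe 0 0) c d \<longleftrightarrow> (\<exists>t. c = tm_code t \<and> d = tm_code (lift_tm t))"
  using tm_graph_iff[of Shift] by simp

lemma fm_graph_inst: "fm_graph (pe (Suc 0) (tm_code t)) c d \<longleftrightarrow> (\<exists>\<phi>. c = fm_code \<phi> \<and> d = fm_code (inst \<phi> t))"
  using fm_graph_iff[of "Inst t"] by (simp add: inst_def)

text \<open>Only the finite part of the context is coded. \<open>T\<close> enters through the set of
  its codes and is preserved by \<open>ForallI\<close>, because lifting fixes sentences.\<close>

lemma prov_code_iff:
  assumes T: "\<forall>\<phi>\<in>T. sentence \<phi>"
  shows "prov_code (fm_code ` T) (lcode \<Gamma>) (fm_code \<phi>) \<longleftrightarrow> T \<union> set \<Gamma> \<turnstile> \<phi>"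
proof
  have lift_T: "lift_fm ` (T \<union> set \<Gamma>) = T \<union> set (map lift_fm \<Gamma>)" for \<Gamma>
    using T subst_sentence by (force simp: image_Un)
  have "clos (prov_base (fm_code ` T)) prov_step x \<Longrightarrow> \<exists>\<Gamma> \<phi>. x = pe (lcode \<Gamma>) (fm_code \<phi>) \<and> T \<union> set \<Gamma> \<turnstile> \<phi>" for x
  proof (induction rule: clos.induct)
    case (base x)
    then obtain l l' c where x: "x = pe l c" "lift_graph l l'"
      "c \<in> fm_code ` T \<or> member_code c l \<or> (\<exists>t u. c = pe 0 (pe t t) \<and> tm_graph (pe 0 0) t u)"
      unfolding prov_base_def by blast
    obtain \<Gamma> where \<Gamma>: "l = lcode \<Gamma>" using x lift_graph_iff by blast
    from x(3) consider \<phi> where "c = fm_code \<phi>" "\<phi> \<in> T \<union> set \<Gamma>" | t where "c = fm_code (Equal t t)"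
      by (auto simp: member_code_iff \<Gamma> tm_graph_wf)
    then show ?case
    proof cases
      case 1 then show ?thesis using x \<Gamma> by (blast intro: proves.Assm)
    next
      case 2 then show ?thesis using x \<Gamma> by (blast intro: proves.EqRefl)
    qed
  next
    case (step x y z)
    obtain \<Gamma> \<phi> where y: "y = pe (lcode \<Gamma>) (fm_code \<phi>)" "T \<union> set \<Gamma> \<turnstile> \<phi>" using step by blast
    obtain \<Delta> \<psi> where z: "z = pe (lcode \<Delta>) (fm_code \<psi>)" "T \<union> set \<Delta> \<turnstile> \<psi>" using step by blast
    from step.hyps(1) show ?case unfolding prov_step_def
    proof (elim disjE exE conjE, goal_cases)
      case (1 l a b)
      then obtain \<alpha> \<Gamma>' where "\<Gamma> = \<alpha> # \<Gamma>'" "a = fm_code \<alpha>" "l = lcode \<Gamma>'" "b = fm_code \<phi>"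
        using y(1) by (auto simp: lcode_cases dest: sym)
      moreover from this have "T \<union> set \<Gamma>' \<turnstile> Imp \<alpha> \<phi>" using y(2) by (intro proves.ImpI) simp
      ultimately show ?case using 1 by (intro exI[of _ \<Gamma>'] exI[of _ "Imp \<alpha> \<phi>"]) simp
    next
      case (2 l a b)
      then have "\<Gamma> = \<Delta>" "l = lcode \<Gamma>" "a = fm_code \<psi>" "fm_code \<phi> = pe 3 (pe a b)" using y z by auto
      then obtain \<chi> where "\<phi> = Imp \<psi> \<chi>" "b = fm_code \<chi>" by (auto simp: fm_code_cases)
      then show ?case using 2 y z \<open>\<Gamma> = \<Delta>\<close> \<open>l = lcode \<Gamma>\<close> by (auto intro: proves.ImpE)
    next
      case (3 l a)
      then have lc: "lcode \<Gamma> = Suc (pe (pe 3 (pe a (pe 2 0))) l)" and "fm_code \<phi> = pe 2 0"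
        using y(1) by auto
      then have \<phi>: "\<phi> = Falsum" by (simp add: fm_code_cases(2))
      from lc obtain \<beta> \<Gamma>' where \<Gamma>: "\<Gamma> = \<beta> # \<Gamma>'" "fm_code \<beta> = pe 3 (pe a (pe 2 0))" "l = lcode \<Gamma>'"
        unfolding lcode_cases by (elim exE conjE)
      from \<Gamma>(2) obtain \<alpha> \<chi> where \<alpha>: "\<beta> = Imp \<alpha> \<chi>" "fm_code \<alpha> = a" "fm_code \<chi> = pe 2 0"
        unfolding fm_code_cases(3) by (elim exE conjE)
      then have "\<beta> = Neg \<alpha>" by (simp add: fm_code_cases(2))
      then have "insert (Neg \<alpha>) (T \<union> set \<Gamma>') \<turnstile> Falsum" using y(2) \<phi> \<Gamma>(1) by simp
      then have "T \<union> set \<Gamma>' \<turnstile> \<alpha>" by (rule proves.Contr)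
      then show ?case using 3(1) \<Gamma>(3) \<alpha>(2) by blast
    next
      case (4 l l' a)
      then obtain \<Gamma>' where "l = lcode \<Gamma>'" "\<Gamma> = map lift_fm \<Gamma>'" "a = fm_code \<phi>" using y by (auto simp: lift_graph_iff simp del: map_map list.map_comp)
      moreover from this have "T \<union> set \<Gamma>' \<turnstile> Forall \<phi>" using y(2) by (intro proves.ForallI) (simp only: lift_T)
      ultimately show ?case using 4 by (intro exI[of _ \<Gamma>'] exI[of _ "Forall \<phi>"]) simp
    next
      case (5 l a t b u)
      then obtain t' where t: "t = tm_code t'" using tm_graph_wf by blast
      have a: "fm_code \<phi> = pe 4 a" "l = lcode \<Gamma>" using 5 y by auto
      then obtain \<alpha> where \<alpha>: "\<phi> = Forall \<alpha>" "a = fm_code \<alpha>" by (auto simp: fm_code_cases)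
      have "b = fm_code (inst \<alpha> t')" using 5 t \<alpha> by (auto simp: fm_graph_inst)
      moreover have "T \<union> set \<Gamma> \<turnstile> inst \<alpha> t'" using y(2) \<alpha> by (auto intro: proves.ForallE)
      ultimately show ?case using 5 a by blast
    next
      case (6 l s t a b c)
      then have a: "fm_code \<phi> = pe 0 (pe s t)" "l = lcode \<Gamma>" "\<Gamma> = \<Delta>" "b = fm_code \<psi>" using y z by auto
      then obtain s' t' where st: "\<phi> = Equal s' t'" "s = tm_code s'" "t = tm_code t'" by (auto simp: fm_code_cases)
      then obtain \<alpha> where \<alpha>: "\<psi> = inst \<alpha> s'" "c = fm_code (inst \<alpha> t')" using 6 a by (auto simp: fm_graph_inst)
      have "T \<union> set \<Gamma> \<turnstile> inst \<alpha> t'"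
        by (rule proves.EqSubst[of _ s']) (use y z st \<alpha> a in auto)
      then show ?case using 6 a \<alpha> by blast
    qed
  qed
  then show "prov_code (fm_code ` T) (lcode \<Gamma>) (fm_code \<phi>) \<Longrightarrow> T \<union> set \<Gamma> \<turnstile> \<phi>"
    unfolding prov_code_def by fastforce
next
  have LLE: "\<exists>l'. lift_graph (lcode \<Gamma>) l'" for \<Gamma> using lift_graph_iff by blast
  have lift_T: "lift_fm ` (T \<union> set \<Gamma>) = T \<union> set (map lift_fm \<Gamma>)" for \<Gamma>
    using T subst_sentence by (force simp: image_Un)
  have "\<Theta> \<turnstile> \<phi> \<Longrightarrow> \<Theta> = T \<union> set \<Gamma> \<Longrightarrow> prov_code (fm_code ` T) (lcode \<Gamma>) (fm_code \<phi>)" for \<Theta>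
  proof (induction arbitrary: \<Gamma> rule: proves.induct)
    case (Assm \<phi> \<Theta>)
    then show ?case using LLE[of \<Gamma>] unfolding prov_code_def
      by (intro clos.base) (auto simp: prov_base_def member_code_iff)
  next
    case (ImpI \<phi> \<Theta> \<psi>)
    have "prov_code (fm_code ` T) (lcode (\<phi> # \<Gamma>)) (fm_code \<psi>)"
      by (rule ImpI.IH) (simp add: ImpI.prems)
    from clos.step[OF _ this[unfolded prov_code_def] this[unfolded prov_code_def]] show ?case
      by (simp add: prov_code_def prov_step_def)
  next
    case (ImpE \<Theta> \<phi> \<psi>)
    from clos.step[OF _ ImpE.IH(1)[OF ImpE.prems, unfolded prov_code_def] ImpE.IH(2)[OF ImpE.prems, unfolded prov_code_def]]
    show ?case by (simp add: prov_code_def prov_step_def)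
  next
    case (Contr \<phi> \<Theta>)
    have "prov_code (fm_code ` T) (lcode (Neg \<phi> # \<Gamma>)) (fm_code Falsum)"
      by (rule Contr.IH) (simp add: Contr.prems)
    from clos.step[OF _ this[unfolded prov_code_def] this[unfolded prov_code_def]] show ?case
      by (simp add: prov_code_def prov_step_def)
  next
    case (ForallI \<Theta> \<phi>)
    then have 1: "prov_code (fm_code ` T) (lcode (map lift_fm \<Gamma>)) (fm_code \<phi>)" using lift_T by metis
    have "lift_graph (lcode \<Gamma>) (lcode (map lift_fm \<Gamma>))" using lift_graph_iff by blast
    then have "prov_step (pe (lcode \<Gamma>) (fm_code (Forall \<phi>))) (pe (lcode (map lift_fm \<Gamma>)) (fm_code \<phi>)) z" for z
      unfolding prov_step_def by (auto simp del: map_map list.map_comp)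
    from clos.step[where R = prov_step, OF this 1[unfolded prov_code_def] 1[unfolded prov_code_def]] show ?case
      by (simp only: prov_code_def)
  next
    case (ForallE \<Theta> \<phi> t)
    have "prov_step (pe (lcode \<Gamma>) (fm_code (inst \<phi> t))) (pe (lcode \<Gamma>) (fm_code (Forall \<phi>))) z" for z
      unfolding prov_step_def by (auto simp: fm_graph_inst tm_graph_wf)
    from clos.step[where R = prov_step, OF this] ForallE.IH[OF ForallE.prems] show ?case
      unfolding prov_code_def by blast
  next
    case (EqRefl \<Theta> t)
    then show ?case using LLE[of \<Gamma>] unfolding prov_code_def
      by (intro clos.base) (auto simp: prov_base_def tm_graph_wf)
  next
    case (EqSubst \<Theta> s t \<phi>)
    have "prov_step (pe (lcode \<Gamma>) (fm_code (inst \<phi> t))) (pe (lcode \<Gamma>) (fm_code (Equal s t))) (pe (lcode \<Gamma>) (fm_code (inst \<phi> s)))"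
      unfolding prov_step_def by (auto simp: fm_graph_inst)
    from clos.step[where R = prov_step, OF this] EqSubst.IH[OF EqSubst.prems] show ?case
      unfolding prov_code_def by blast
  qed
  then show "T \<union> set \<Gamma> \<turnstile> \<phi> \<Longrightarrow> prov_code (fm_code ` T) (lcode \<Gamma>) (fm_code \<phi>)" by blast
qed

definition num_code_step :: "nat \<Rightarrow> nat \<Rightarrow> nat \<Rightarrow> bool" where
  "num_code_step x y z \<longleftrightarrow> (\<exists>n c. x = pe (Suc n) (pe 3 (pe c (pe 2 0))) \<and> y = pe n c)"

lemma num_code_graph: "c = tm_code (num n) \<longleftrightarrow> clos (\<lambda>x. x = pe 0 (pe 1 0)) num_code_step (pe n c)"
proof
  have "clos (\<lambda>x. x = pe 0 (pe 1 0)) num_code_step (pe n (tm_code (num n)))"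
  proof (induction n)
    case 0 then show ?case by (auto intro: clos.base)
  next
    case (Suc n)
    from clos.step[OF _ Suc Suc] show ?case by (simp add: num_code_step_def)
  qed
  then show "c = tm_code (num n) \<Longrightarrow> clos (\<lambda>x. x = pe 0 (pe 1 0)) num_code_step (pe n c)" by simp
next
  have "clos (\<lambda>x. x = pe 0 (pe 1 0)) num_code_step x \<Longrightarrow> \<exists>n. x = pe n (tm_code (num n))" for x
  proof (induction rule: clos.induct)
    case (base x) then show ?case by (intro exI[of _ 0]) simp
  next
    case (step x y z) then show ?case by (auto simp: num_code_step_def)
  qed
  then show "clos (\<lambda>x. x = pe 0 (pe 1 0)) num_code_step (pe n c) \<Longrightarrow> c = tm_code (num n)" by fastforce
qed

lemma sig_fun_num:
  assumes "sig_fun f" shows "sig_fun (\<lambda>e. tm_code (num (f e)))"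
proof -
  have "sigma1 (\<lambda>e. clos (\<lambda>x. x = pe 0 (pe 1 0)) num_code_step (e 0))"
    by (rule sigma1_clos; (unfold num_code_step_def)?) (intro sigma1_intros)+
  then have "sigma1 (\<lambda>e. e 0 = tm_code (num (e 1)))"
    unfolding num_code_graph by (rule sigma1_1) (intro sigma1_intros)
  from sig_fun_1[where h = "\<lambda>n. tm_code (num n)", OF this assms] show ?thesis .
qed

section \<open>Models of the theory of discretely ordered semirings\<close>

text \<open>
  Unlike the Cantor pairing, this one is a term of the language; it is injective but not surjective.
\<close>

definition pr :: "'a str \<Rightarrow> 'a \<Rightarrow> 'a \<Rightarrow> 'a" where
  "pr M x y = ad M (mu M (ad M x y) (ad M x y)) x"

text \<open>Phrased with y + 1 so that a quantifier bounded by \<open>le\<close> unfolds to a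
  bounded quantifier of the language whose bound is a term.\<close>

definition le :: "'a str \<Rightarrow> 'a \<Rightarrow> 'a \<Rightarrow> bool" where
  "le M x y \<longleftrightarrow> ls M x (ad M y (un M))"

primrec nm :: "'a str \<Rightarrow> nat \<Rightarrow> 'a" where
  "nm M 0 = zr M"
| "nm M (Suc n) = ad M (nm M n) (un M)"

lemma val_num [simp]: "val M e (num n) = nm M n"
  by (induction n) auto

locale PA_model =
  fixes M :: "'a str"
  assumes PA: "\<phi> \<in> PA_minus \<Longrightarrow> sat M e \<phi>"
begin

abbreviation plusM (infixl "\<oplus>" 65) where "x \<oplus> y \<equiv> ad M x y"
abbreviation timesM (infixl "\<otimes>" 70) where "x \<otimes> y \<equiv> mu M x y"
abbreviation lessM (infix "\<prec>" 50) where "x \<prec> y \<equiv> ls M x y"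
abbreviation leM (infix "\<preceq>" 50) where "x \<preceq> y \<equiv> le M x y"
abbreviation oneM ("\<one>") where "\<one> \<equiv> un M"
abbreviation zeroM ("\<zero>") where "\<zero> \<equiv> zr M"

lemma axioms:
  "x \<oplus> y \<oplus> z = x \<oplus> (y \<oplus> z)" "x \<oplus> y = y \<oplus> x"
  "x \<otimes> y \<otimes> z = x \<otimes> (y \<otimes> z)" "x \<otimes> y = y \<otimes> x"
  "x \<otimes> (y \<oplus> z) = x \<otimes> y \<oplus> x \<otimes> z"
  "x \<oplus> \<zero> = x" "x \<otimes> \<zero> = \<zero>" "x \<otimes> \<one> = x"
  "x \<prec> y \<Longrightarrow> y \<prec> z \<Longrightarrow> x \<prec> z" "\<not> x \<prec> x" "x \<prec> y \<or> x = y \<or> y \<prec> x"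
  "x \<prec> y \<Longrightarrow> x \<oplus> z \<prec> y \<oplus> z" "\<zero> \<prec> z \<Longrightarrow> x \<prec> y \<Longrightarrow> x \<otimes> z \<prec> y \<otimes> z"
  "x \<prec> y \<Longrightarrow> \<exists>z. x \<oplus> z = y" "\<zero> \<prec> \<one>" "\<zero> \<prec> x \<Longrightarrow> \<one> \<prec> x \<or> \<one> = x" "\<zero> \<prec> x \<or> \<zero> = x"
proof -
  have 1: "Forall \<phi> \<in> PA_minus \<Longrightarrow> sat M (a ## e) \<phi>" for a e \<phi>
    using PA[of "Forall \<phi>" e] by simp
  have 2: "Forall (Forall \<phi>) \<in> PA_minus \<Longrightarrow> sat M (a ## b ## e) \<phi>" for a b e \<phi>
    using 1[of "Forall \<phi>"] by simp
  have 3: "Forall (Forall (Forall \<phi>)) \<in> PA_minus \<Longrightarrow> sat M (a ## b ## c ## e) \<phi>" for a b c e \<phi>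
    using 2[of "Forall \<phi>"] by simp
  note mem = PA_minus_def Let_def
  show "x \<oplus> y \<oplus> z = x \<oplus> (y \<oplus> z)"
    using 3[of "Equal (Add (Add (Var 0) (Var 1)) (Var 2)) (Add (Var 0) (Add (Var 1) (Var 2)))" x y z] by (simp add: mem numeral_2_eq_2)
  show "x \<oplus> y = y \<oplus> x"
    using 2[of "Equal (Add (Var 0) (Var 1)) (Add (Var 1) (Var 0))" x y] by (simp add: mem numeral_2_eq_2)
  show "x \<otimes> y \<otimes> z = x \<otimes> (y \<otimes> z)"
    using 3[of "Equal (Mul (Mul (Var 0) (Var 1)) (Var 2)) (Mul (Var 0) (Mul (Var 1) (Var 2)))" x y z] by (simp add: mem numeral_2_eq_2)
  show "x \<otimes> y = y \<otimes> x"
    using 2[of "Equal (Mul (Var 0) (Var 1)) (Mul (Var 1) (Var 0))" x y] by (simp add: mem numeral_2_eq_2)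
  show "x \<otimes> (y \<oplus> z) = x \<otimes> y \<oplus> x \<otimes> z"
    using 3[of "Equal (Mul (Var 0) (Add (Var 1) (Var 2))) (Add (Mul (Var 0) (Var 1)) (Mul (Var 0) (Var 2)))" x y z] by (simp add: mem numeral_2_eq_2)
  show "x \<oplus> \<zero> = x"
    using 1[of "Equal (Add (Var 0) Zero) (Var 0)" x] by (simp add: mem numeral_2_eq_2)
  show "x \<otimes> \<zero> = \<zero>"
    using 1[of "Equal (Mul (Var 0) Zero) Zero" x] by (simp add: mem numeral_2_eq_2)
  show "x \<otimes> \<one> = x"
    using 1[of "Equal (Mul (Var 0) One) (Var 0)" x] by (simp add: mem numeral_2_eq_2)
  show "x \<prec> y \<Longrightarrow> y \<prec> z \<Longrightarrow> x \<prec> z"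
    using 3[of "Imp (Conj (Less (Var 0) (Var 1)) (Less (Var 1) (Var 2))) (Less (Var 0) (Var 2))" x y z] by (simp add: mem numeral_2_eq_2)
  show "\<not> x \<prec> x"
    using 1[of "Neg (Less (Var 0) (Var 0))" x] by (simp add: mem numeral_2_eq_2)
  show "x \<prec> y \<or> x = y \<or> y \<prec> x"
    using 2[of "Disj (Less (Var 0) (Var 1)) (Disj (Equal (Var 0) (Var 1)) (Less (Var 1) (Var 0)))" x y] by (simp add: mem numeral_2_eq_2) blast
  show "x \<prec> y \<Longrightarrow> x \<oplus> z \<prec> y \<oplus> z"
    using 3[of "Imp (Less (Var 0) (Var 1)) (Less (Add (Var 0) (Var 2)) (Add (Var 1) (Var 2)))" x y z] by (simp add: mem numeral_2_eq_2)
  show "\<zero> \<prec> z \<Longrightarrow> x \<prec> y \<Longrightarrow> x \<otimes> z \<prec> y \<otimes> z"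
    using 3[of "Imp (Conj (Less Zero (Var 2)) (Less (Var 0) (Var 1))) (Less (Mul (Var 0) (Var 2)) (Mul (Var 1) (Var 2)))" x y z] by (simp add: mem numeral_2_eq_2)
  show "x \<prec> y \<Longrightarrow> \<exists>z. x \<oplus> z = y"
    using 2[of "Imp (Less (Var 0) (Var 1)) (Exists (Equal (Add (Var 1) (Var 0)) (Var 2)))" x y] by (simp add: mem numeral_2_eq_2)
  show "\<zero> \<prec> \<one>"
    using PA[of "Less Zero One"] by (simp add: mem numeral_2_eq_2)
  show "\<zero> \<prec> x \<Longrightarrow> \<one> \<prec> x \<or> \<one> = x"
    using 1[of "Imp (Less Zero (Var 0)) (Disj (Less One (Var 0)) (Equal One (Var 0)))" x] by (simp add: mem numeral_2_eq_2) blast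
  show "\<zero> \<prec> x \<or> \<zero> = x"
    using 1[of "Disj (Less Zero (Var 0)) (Equal Zero (Var 0))" x] by (simp add: mem numeral_2_eq_2) blast
qed

text \<open>Discreteness at 0 carries over to y: a larger x is y + z with z nonzero, hence z is at
  least 1 and x at least y + 1.\<close>

lemma less_suc_aux: "x \<prec> y \<oplus> \<one> \<longleftrightarrow> x \<prec> y \<or> x = y"
proof
  have 1: "y \<prec> y \<oplus> \<one>" for y using axioms(12)[OF axioms(15), of y] axioms(2,6) by metis
  assume a: "x \<prec> y \<oplus> \<one>"
  show "x \<prec> y \<or> x = y"
  proof (rule ccontr)
    assume "\<not> ?thesis"
    then have "y \<prec> x" using axioms(11) by blast
    then obtain z where z: "y \<oplus> z = x" using axioms(14) by blast
    then have "z \<noteq> \<zero>" using \<open>y \<prec> x\<close> axioms(6,10) by metis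
    then have "\<one> \<prec> z \<or> \<one> = z" using axioms(16,17) by metis
    then have "y \<oplus> \<one> \<prec> x \<or> y \<oplus> \<one> = x" using axioms(2,12) z by metis
    then show False using a axioms(9,10) by metis
  qed
next
  have 1: "y \<prec> y \<oplus> \<one>" for y using axioms(12)[OF axioms(15), of y] axioms(2,6) by metis
  assume "x \<prec> y \<or> x = y" then show "x \<prec> y \<oplus> \<one>" using 1 axioms(9) by blast
qed

lemma le_iff: "x \<preceq> y \<longleftrightarrow> x \<prec> y \<or> x = y"
  by (simp add: le_def less_suc_aux)

sublocale R: comm_semiring_1 where plus = "ad M" and times = "mu M" and zero = "zr M" and one = "un M"
proof unfold_locales
  fix a b c
  show "a \<oplus> b \<oplus> c = a \<oplus> (b \<oplus> c)" "a \<oplus> b = b \<oplus> a" "a \<otimes> b \<otimes> c = a \<otimes> (b \<otimes> c)" "a \<otimes> b = b \<otimes> a"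
    by (fact axioms)+
  show "\<zero> \<oplus> a = a" "\<one> \<otimes> a = a" "\<zero> \<otimes> a = \<zero>" "a \<otimes> \<zero> = \<zero>"
    using axioms(2,4,6,7,8) by metis+
  show "(a \<oplus> b) \<otimes> c = a \<otimes> c \<oplus> b \<otimes> c" using axioms(4,5) by metis
  show "\<zero> \<noteq> \<one>" using axioms(10,15) by metis
qed

sublocale R: linorder where less_eq = "le M" and less = "ls M"
proof unfold_locales
  fix x y z
  show "x \<prec> y \<longleftrightarrow> x \<preceq> y \<and> \<not> y \<preceq> x" using axioms(9,10) le_iff by metis
  show "x \<preceq> x" by (simp add: le_iff)
  show "x \<preceq> y \<Longrightarrow> y \<preceq> z \<Longrightarrow> x \<preceq> z" using axioms(9) le_iff by metis
  show "x \<preceq> y \<Longrightarrow> y \<preceq> x \<Longrightarrow> x = y" using axioms(9,10) le_iff by metis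
  show "x \<preceq> y \<or> y \<preceq> x" using axioms(11) le_iff by metis
qed

lemma less_suc [simp]: "x \<prec> y \<oplus> \<one> \<longleftrightarrow> x \<preceq> y"
  by (simp add: le_def)

lemma suc_le: "x \<oplus> \<one> \<preceq> y \<longleftrightarrow> x \<prec> y"
  using less_suc R.not_less by metis

lemma zero_le [simp]: "\<zero> \<preceq> x" and not_less_zero [simp]: "\<not> x \<prec> \<zero>"
  using axioms(17) le_iff R.not_less by metis+

lemma add_less [simp]: "x \<oplus> z \<prec> y \<oplus> z \<longleftrightarrow> x \<prec> y" "z \<oplus> x \<prec> z \<oplus> y \<longleftrightarrow> x \<prec> y"
  using axioms(9-12) R.add.commute by metis+

lemma add_le [simp]: "x \<oplus> z \<preceq> y \<oplus> z \<longleftrightarrow> x \<preceq> y" "z \<oplus> x \<preceq> z \<oplus> y \<longleftrightarrow> x \<preceq> y"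
  using add_less R.not_less by metis+

lemma add_cancel [simp]: "x \<oplus> z = y \<oplus> z \<longleftrightarrow> x = y" "z \<oplus> x = z \<oplus> y \<longleftrightarrow> x = y"
  using add_le R.order.antisym R.order.refl by metis+

lemma le_add [simp]: "x \<preceq> x \<oplus> y" "y \<preceq> x \<oplus> y"
  using add_le(2)[of x \<zero> y] add_le(1)[of \<zero> y x] by simp_all

lemma le_ex: "x \<preceq> y \<longleftrightarrow> (\<exists>z. y = x \<oplus> z)"
  using axioms(6,14) le_iff le_add by metis

lemma add_mono: "x \<preceq> x' \<Longrightarrow> y \<preceq> y' \<Longrightarrow> x \<oplus> y \<preceq> x' \<oplus> y'"
  using add_le R.order.trans by metis

lemma mult_mono: "x \<preceq> x' \<Longrightarrow> y \<preceq> y' \<Longrightarrow> x \<otimes> y \<preceq> x' \<otimes> y'"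
proof -
  have 1: "x \<otimes> y \<preceq> x' \<otimes> y" if xx: "x \<preceq> x'" for x x' y
  proof -
    obtain z where "x' = x \<oplus> z" using xx le_ex by blast
    then show ?thesis by (simp add: R.distrib_right)
  qed
  assume "x \<preceq> x'" "y \<preceq> y'"
  then show ?thesis using 1[of x x' y] 1[of y y' x'] R.mult.commute R.order.trans by metis
qed

lemma pr_le [simp]: "x \<preceq> pr M x y" "y \<preceq> pr M x y"
proof -
  have sq: "u \<preceq> u \<otimes> u" for u
  proof (cases "u = \<zero>")
    case False
    then have "\<one> \<preceq> u" using axioms(16,17) le_iff by metis
    then show ?thesis using mult_mono[of \<one> u u u] by simp
  qed simp
  show "x \<preceq> pr M x y" by (simp add: pr_def)
  show "y \<preceq> pr M x y" unfolding pr_def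
    using sq[of "x \<oplus> y"] le_add R.order.trans by metis
qed

lemma pr_mono: "x \<preceq> x' \<Longrightarrow> y \<preceq> y' \<Longrightarrow> pr M x y \<preceq> pr M x' y'"
  unfolding pr_def by (intro add_mono mult_mono)

lemma square_suc: "(s \<oplus> \<one>) \<otimes> (s \<oplus> \<one>) = s \<otimes> s \<oplus> (s \<oplus> (s \<oplus> \<one>))"
  by (simp only: R.distrib_left R.distrib_right R.mult_1_left R.mult_1_right R.add.assoc)

text \<open>With s = x + y the pair is s^2 + x, which lies between s^2 and (s + 1)^2 because x is at
  most s. So the pair determines s, then x, then y.\<close>

lemma pr_eq_iff [simp]: "pr M x y = pr M u v \<longleftrightarrow> x = u \<and> y = v"
proof
  have less: "pr M x y \<prec> pr M u v" if st: "x \<oplus> y \<prec> u \<oplus> v" for x y u v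
  proof -
    let ?s = "x \<oplus> y" and ?t = "u \<oplus> v"
    have "?s \<oplus> \<one> \<preceq> ?t" using st suc_le by blast
    then have "(?s \<oplus> \<one>) \<otimes> (?s \<oplus> \<one>) \<preceq> ?t \<otimes> ?t" by (intro mult_mono)
    moreover have "(?s \<oplus> \<one>) \<otimes> (?s \<oplus> \<one>) = ?s \<otimes> ?s \<oplus> (?s \<oplus> (?s \<oplus> \<one>))"
      by (rule square_suc)
    moreover have "x \<prec> ?s \<oplus> (?s \<oplus> \<one>)"
    proof -
      have "x \<preceq> ?s \<oplus> ?s" using le_add R.order.trans by metis
      then show ?thesis by (simp only: R.add.assoc[symmetric] less_suc)
    qed
    ultimately have "?s \<otimes> ?s \<oplus> x \<prec> ?t \<otimes> ?t" using add_less(2) R.less_le_trans by metis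
    also have "\<dots> \<preceq> pr M u v" by (simp add: pr_def)
    finally show ?thesis by (simp add: pr_def)
  qed
  assume eq: "pr M x y = pr M u v"
  then have s: "x \<oplus> y = u \<oplus> v" using less R.less_irrefl R.linorder_cases by metis
  with eq have "x = u" by (simp add: pr_def)
  with s show "x = u \<and> y = v" by simp
qed simp

lemma division_unique:
  assumes "q \<otimes> m \<oplus> r = q' \<otimes> m \<oplus> r'" "r \<prec> m" "r' \<prec> m"
  shows "q = q' \<and> r = r'"
proof -
  have less: "q \<otimes> m \<oplus> r \<prec> q' \<otimes> m \<oplus> r'" if "q \<prec> q'" "r \<prec> m" for q q' r r'
  proof -
    have "q \<otimes> m \<oplus> r \<prec> q \<otimes> m \<oplus> m" using that by simp
    also have "\<dots> = (q \<oplus> \<one>) \<otimes> m" by (simp add: R.distrib_right)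
    also have "\<dots> \<preceq> q' \<otimes> m" using that by (intro mult_mono) (simp_all add: suc_le)
    also have "\<dots> \<preceq> q' \<otimes> m \<oplus> r'" by simp
    finally show ?thesis .
  qed
  have "q = q'" using less[of q q' r r'] less[of q' q r' r] assms R.less_irrefl R.linorder_cases by metis
  then show ?thesis using assms(1) by simp
qed

section \<open>Standard numerals and absoluteness\<close>

lemma nm_add [simp]: "nm M (m + n) = nm M m \<oplus> nm M n"
  by (induction n) (simp_all add: R.add.assoc)

lemma nm_mult [simp]: "nm M (m * n) = nm M m \<otimes> nm M n"
  by (induction n) (simp_all add: R.distrib_left R.add.commute)

lemma nm_less [simp]: "nm M m \<prec> nm M n \<longleftrightarrow> m < n"
proof -
  have lt: "m < n \<Longrightarrow> nm M m \<prec> nm M n" for m n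
    by (induction n) (auto simp: less_Suc_eq le_iff)
  show ?thesis using lt[of m n] lt[of n m] R.less_irrefl R.less_asym by (metis linorder_neqE_nat)
qed

lemma nm_eq [simp]: "nm M m = nm M n \<longleftrightarrow> m = n"
  using nm_less R.less_irrefl by (metis linorder_neqE_nat)

lemma nm_le [simp]: "nm M m \<preceq> nm M n \<longleftrightarrow> m \<le> n"
  by (simp add: le_iff le_less)

lemma less_nmD: "x \<prec> nm M n \<Longrightarrow> \<exists>k<n. x = nm M k"
proof (induction n)
  case (Suc n)
  then have "x \<prec> nm M n \<or> x = nm M n" using le_iff by simp
  then show ?case using Suc.IH less_Suc_eq by auto
qed simp

lemma le_nmD: "x \<preceq> nm M n \<Longrightarrow> \<exists>k\<le>n. x = nm M k"
  using less_nmD[of x "Suc n"] by (auto simp: less_Suc_eq_le)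

lemma nm_pr: "nm M (pr std x y) = pr M (nm M x) (nm M y)"
  by (simp add: pr_def)

lemma val_nm: "val M (\<lambda>n. nm M (e n)) t = nm M (val std e t)"
  by (induction t) auto

lemma scons_nm: "nm M x ## (\<lambda>n. nm M (e n)) = (\<lambda>n. nm M ((x ## e) n))"
  by (auto simp: fun_eq_iff split: nat.splits)

lemma all_less_nm: "(\<forall>x. x \<prec> nm M k \<longrightarrow> Q x) \<longleftrightarrow> (\<forall>j<k. Q (nm M j))"
  using less_nmD[of _ k] nm_less by blast

lemma ex_less_nm: "(\<exists>x. x \<prec> nm M k \<and> Q x) \<longleftrightarrow> (\<exists>j<k. Q (nm M j))"
  using less_nmD[of _ k] nm_less by blast

text \<open>The numerals form an initial segment of M, so a quantifier bounded by the value of a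
  term at numerals ranges over numerals only.\<close>

lemma Delta0_absolute: "\<phi> \<in> Delta0 \<Longrightarrow> sat M (\<lambda>n. nm M (e n)) \<phi> \<longleftrightarrow> sat std e \<phi>"
  by (induction arbitrary: e rule: Delta0.induct)
    (simp_all add: val_nm all_less_nm ex_less_nm scons_nm)

end

lemma delta0_absolute:
  assumes "delta0 P" "PA_model M" shows "P M (\<lambda>n. nm M (e n)) \<longleftrightarrow> P std e"
proof -
  interpret PA_model M by fact
  show ?thesis using assms(1) Delta0_absolute unfolding delta0_def by metis
qed

lemma PA_model_std: "PA_model std"
proof
  fix \<phi> and e :: "nat \<Rightarrow> nat"
  have "\<forall>\<phi>\<in>PA_minus. sat std e \<phi>"
    unfolding PA_minus_def Let_def by (auto simp: algebra_simps numeral_2_eq_2 intro: le_Suc_ex less_imp_le_nat dest: less_imp_add_positive)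
  then show "\<phi> \<in> PA_minus \<Longrightarrow> sat std e \<phi>" by blast
qed

lemma nm_std [simp]: "nm std n = n"
  by (induction n) auto

lemma le_std [simp]: "le std x y \<longleftrightarrow> x \<le> y"
  by (simp add: le_def less_Suc_eq_le)

lemma delta0_app:
  assumes "delta0 (\<lambda>M e. P M (e 0) (\<lambda>n. e (Suc n)))" "term_fn f" "\<And>n. term_fn (\<lambda>M e. g M e n)"
  shows "delta0 (\<lambda>M e. P M (f M e) (g M e))"
  using delta0_subst[OF assms(1), of "\<lambda>M e. f M e ## g M e"] term_fn_scons[OF assms(2,3)] by simp

lemma arith_2:
  assumes "arith (\<lambda>M e. P M (e 0) (e 1))" "term_fn f" "term_fn g"
  shows "arith (\<lambda>M e. P M (f M e) (g M e))"
  using arith_subst[OF assms(1), of "\<lambda>M e. f M e ## (\<lambda>_. g M e)"] term_fn_scons[OF assms(2), of "\<lambda>M e _. g M e"] assms(3)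
  by simp

lemma arith_3:
  assumes "arith (\<lambda>M e. P M (e 0) (e 1) (e 2))" "term_fn f" "term_fn g" "term_fn h"
  shows "arith (\<lambda>M e. P M (f M e) (g M e) (h M e))"
proof -
  have "term_fn (\<lambda>M e. (f M e ## g M e ## (\<lambda>_. h M e)) n)" for n
    by (intro term_fn_scons assms)
  then show ?thesis
    using arith_subst[OF assms(1), of "\<lambda>M e. f M e ## g M e ## (\<lambda>_. h M e)"] by (simp add: numeral_2_eq_2)
qed

lemma delta0_3:
  assumes "delta0 (\<lambda>M e. P M (e 0) (e 1) (e 2))" "term_fn f" "term_fn g" "term_fn h"
  shows "delta0 (\<lambda>M e. P M (f M e) (g M e) (h M e))"
proof -
  have "term_fn (\<lambda>M e. (f M e ## g M e ## (\<lambda>_. h M e)) n)" for n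
    by (intro term_fn_scons assms)
  then show ?thesis
    using delta0_subst[OF assms(1), of "\<lambda>M e. f M e ## g M e ## (\<lambda>_. h M e)"] by (simp add: numeral_2_eq_2)
qed

lemma term_fn_nm: "term_fn (\<lambda>M e. nm M k)"
  by (induction k) (auto intro: term_fn_intros)

lemma term_fn_pr: "term_fn f \<Longrightarrow> term_fn g \<Longrightarrow> term_fn (\<lambda>M e. pr M (f M e) (g M e))"
  unfolding pr_def by (intro term_fn_intros)

section \<open>Coding of bounded sets in models of \<open>I\<Delta>\<^sub>0 + Exp\<close>\<close>

definition beta_rel :: "'a str \<Rightarrow> 'a \<Rightarrow> 'a \<Rightarrow> 'a \<Rightarrow> 'a \<Rightarrow> bool" where
  "beta_rel M a b i r \<longleftrightarrow> ls M r (ad M (un M) (mu M (ad M i (un M)) b)) \<and>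
    (\<exists>k. ls M k (ad M a (un M)) \<and> a = ad M (mu M k (ad M (un M) (mu M (ad M i (un M)) b))) r)"

lemma sat_beta_fm: "sat M e (beta_fm a b i r) \<longleftrightarrow> beta_rel M (val M e a) (val M e b) (val M e i) (val M e r)"
  by (simp add: beta_fm_def Let_def beta_rel_def)

text \<open>
  If \<open>a, b\<close> code the powers of 2, then \<open>odd_at M a b s i\<close> says that the binary digit number \<open>i\<close> of
  \<open>s\<close> is 1, and \<open>even_at M a b s i\<close> that it is 0. No other properties of powers of 2 are needed, so
  that the uniqueness of exponentiation need not be developed in the model.
\<close>

definition odd_at :: "'a str \<Rightarrow> 'a \<Rightarrow> 'a \<Rightarrow> 'a \<Rightarrow> 'a \<Rightarrow> bool" where
  "odd_at M a b s i \<longleftrightarrow> (\<exists>r. le M r a \<and> beta_rel M a b i r \<and> (\<exists>k. le M k s \<and> (\<exists>t. ls M t r \<and>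
    s = ad M (mu M (ad M (ad M k k) (un M)) r) t)))"

definition even_at :: "'a str \<Rightarrow> 'a \<Rightarrow> 'a \<Rightarrow> 'a \<Rightarrow> 'a \<Rightarrow> bool" where
  "even_at M a b s i \<longleftrightarrow> (\<exists>r. le M r a \<and> beta_rel M a b i r \<and> (\<exists>k. le M k s \<and> (\<exists>t. ls M t r \<and>
    s = ad M (mu M (ad M k k) r) t)))"

text \<open>Each code carries its own table a, b of powers of 2, besides the digits s and the bound
  q; codes with different tables need never be compared.\<close>

definition mem :: "'a str \<Rightarrow> 'a \<Rightarrow> 'a \<Rightarrow> bool" where
  "mem M u i \<longleftrightarrow> (\<exists>a b s q. u = pr M a (pr M b (pr M s q)) \<and> ls M i q \<and> odd_at M a b s i)"

text \<open>The evenness of the quotient is what keeps a lower binary digit unchanged when a power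
  of 2 is added. \<open>e 0\<close> and \<open>e 1\<close> are the table and \<open>e 2\<close> its
  length; all values are bounded by \<open>e 0\<close>, so that bounded induction applies.\<close>

definition double_at :: "'a str \<Rightarrow> 'a \<Rightarrow> (nat \<Rightarrow> 'a) \<Rightarrow> bool" where
  "double_at M n e \<longleftrightarrow> (le M n (e 2) \<longrightarrow> (\<forall>i. ls M i n \<longrightarrow> (\<forall>r. le M r (e 0) \<longrightarrow> (\<forall>u. le M u (e 0) \<longrightarrow>
    beta_rel M (e 0) (e 1) i r \<longrightarrow> beta_rel M (e 0) (e 1) n u \<longrightarrow> (\<exists>k. le M k (e 0) \<and> u = mu M (ad M k k) r)))))"

text \<open>Induction statement for comprehension. Digits 1 and 0 are both recorded positively,
  since each has to survive the addition of a power. The offset 3 skips the table a, b and its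
  length.\<close>

definition prefix_at :: "('a str \<Rightarrow> 'a \<Rightarrow> (nat \<Rightarrow> 'a) \<Rightarrow> bool) \<Rightarrow> 'a str \<Rightarrow> 'a \<Rightarrow> (nat \<Rightarrow> 'a) \<Rightarrow> bool" where
  "prefix_at P M n e \<longleftrightarrow> (le M n (e 2) \<longrightarrow> (\<exists>r. le M r (e 0) \<and> beta_rel M (e 0) (e 1) n r \<and> (\<exists>s. ls M s r \<and>
    (\<forall>i. ls M i n \<longrightarrow> (P M i (\<lambda>n. e (n + 3)) \<longrightarrow> odd_at M (e 0) (e 1) s i) \<and>
      (\<not> P M i (\<lambda>n. e (n + 3)) \<longrightarrow> even_at M (e 0) (e 1) s i)))))"

lemma delta0_double_at: "delta0 (\<lambda>M e. double_at M (e 0) (\<lambda>n. e (Suc n)))"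
  unfolding double_at_def le_def beta_rel_def by (intro delta0_intros)

lemma delta0_prefix_at:
  assumes "delta0 (\<lambda>M e. P M (e 0) (\<lambda>n. e (Suc n)))"
  shows "delta0 (\<lambda>M e. prefix_at P M (e 0) (\<lambda>n. e (Suc n)))"
  unfolding prefix_at_def le_def beta_rel_def odd_at_def even_at_def by (intro delta0_intros delta0_app[OF assms])

locale exp_model = PA_model +
  assumes induct: "\<phi> \<in> Delta0 \<Longrightarrow> sat M (zr M ## e) \<phi> \<Longrightarrow>
      (\<And>x. sat M (x ## e) \<phi> \<Longrightarrow> sat M (ad M x (un M) ## e) \<phi>) \<Longrightarrow> sat M (x ## e) \<phi>"
    and exp: "sat M e Exp"

lemma sat_Forall_iter: "sat M e ((Forall ^^ k) \<phi>) \<Longrightarrow> closed_fm k \<phi> \<Longrightarrow> sat M e' \<phi>"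
proof -
  have "sat M e ((Forall ^^ k) \<phi>) \<Longrightarrow> sat M (\<lambda>n. if n < k then f n else e (n - k)) \<phi>" for f
  proof (induction k arbitrary: \<phi> f)
    case (Suc k)
    then have "sat M e ((Forall ^^ k) (Forall \<phi>))" by (simp only: funpow_Suc_right o_apply)
    from Suc.IH[OF this, of "\<lambda>n. f (Suc n)"]
    have "sat M (f 0 ## (\<lambda>n. if n < k then f (Suc n) else e (n - k))) \<phi>" by simp
    moreover have "f 0 ## (\<lambda>n. if n < k then f (Suc n) else e (n - k)) =
        (\<lambda>n. if n < Suc k then f n else e (n - Suc k))"
      by (auto simp: fun_eq_iff split: nat.splits)
    ultimately show ?case by simp
  qed simp
  from this[of e'] show "sat M e ((Forall ^^ k) \<phi>) \<Longrightarrow> closed_fm k \<phi> \<Longrightarrow> sat M e' \<phi>"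
    using sat_agree[of k \<phi> "\<lambda>n. if n < k then e' n else e (n - k)" e' M] by simp
qed

lemma exp_model_intro:
  assumes "\<And>\<phi> e. \<phi> \<in> IDelta0 \<union> {Exp} \<Longrightarrow> sat M e \<phi>"
  shows "exp_model M"
proof
  show "sat M e \<phi>" if "\<phi> \<in> PA_minus" for \<phi> e using assms that by (simp add: IDelta0_def)
  show "sat M e Exp" for e using assms by simp
  fix \<phi> e x
  assume 1: "\<phi> \<in> Delta0" "sat M (zr M ## e) \<phi>" "\<And>x. sat M (x ## e) \<phi> \<Longrightarrow> sat M (ad M x (un M) ## e) \<phi>"
  obtain k where k: "closed_fm k (induction_fm \<phi>)" using closed_fm_ex by blast
  then have "(Forall ^^ k) (induction_fm \<phi>) \<in> IDelta0" using 1(1) unfolding IDelta0_def by blast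
  then have "sat M e (induction_fm \<phi>)" using assms sat_Forall_iter[OF _ k] by blast
  moreover have "(\<lambda>n. val M (x ## e) (case n of 0 \<Rightarrow> Add (Var 0) One | Suc m \<Rightarrow> Var (Suc m))) =
      ad M x (un M) ## e" for x
    by (auto simp: fun_eq_iff split: nat.splits)
  ultimately show "sat M (x ## e) \<phi>" using 1(2,3) by (simp add: induction_fm_def)
qed

context exp_model
begin

lemma delta0_induct:
  assumes "delta0 (\<lambda>M e. P M (e 0) (\<lambda>n. e (Suc n)))" "P M \<zero> e" "\<And>x. P M x e \<Longrightarrow> P M (x \<oplus> \<one>) e"
  shows "P M x e"
proof -
  obtain \<phi> where "\<phi> \<in> Delta0" "\<forall>M e. sat M e \<phi> = P M (e 0) (\<lambda>n. e (Suc n))"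
    using assms(1) unfolding delta0_def by blast
  then show ?thesis using induct[of \<phi> e x] assms(2,3) by simp
qed

lemma beta_rel_unique: "beta_rel M a b i r \<Longrightarrow> beta_rel M a b i r' \<Longrightarrow> r = r'"
  unfolding beta_rel_def using division_unique by metis

lemma beta_rel_le: "beta_rel M a b i r \<Longrightarrow> r \<preceq> a"
  unfolding beta_rel_def using le_add(2) by metis

lemma exp_beta_rel: "\<exists>a b. beta_rel M a b \<zero> \<one> \<and> (\<forall>i. i \<prec> N \<longrightarrow> (\<exists>r. beta_rel M a b i r \<and> beta_rel M a b (i \<oplus> \<one>) (r \<oplus> r)))"
  using exp[of "\<lambda>_. N"] unfolding Exp_def pow2_fm_def
  by (auto simp: sat_beta_fm) metis

lemma double_at:
  assumes "\<And>i. i \<prec> e 2 \<Longrightarrow> \<exists>r. beta_rel M (e 0) (e 1) i r \<and> beta_rel M (e 0) (e 1) (i \<oplus> \<one>) (r \<oplus> r)"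
  shows "double_at M n e"
proof (rule delta0_induct[OF delta0_double_at])
  show "double_at M \<zero> e" by (simp add: double_at_def)
next
  let ?B = "beta_rel M (e 0) (e 1)"
  fix n assume IH: "double_at M n e"
  show "double_at M (n \<oplus> \<one>) e" unfolding double_at_def
  proof (intro impI allI)
    fix i r u assume n: "n \<oplus> \<one> \<preceq> e 2" and i: "i \<prec> n \<oplus> \<one>" and r: "?B i r" and u: "?B (n \<oplus> \<one>) u"
    obtain w where w: "?B n w" "?B (n \<oplus> \<one>) (w \<oplus> w)" using assms n suc_le by blast
    then have u2: "u = w \<oplus> w" using u beta_rel_unique by blast
    have "\<exists>k. u = (k \<oplus> k) \<otimes> r"
    proof (cases "i = n")
      case True
      then have "r = w" using w r beta_rel_unique by blast
      then have "u = (\<one> \<oplus> \<one>) \<otimes> r" using u2 by (simp only: R.distrib_right R.mult_1_left)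
      then show ?thesis by blast
    next
      case False
      then have "i \<prec> n" "n \<preceq> e 2" using i n le_iff suc_le by auto
      then obtain k where "w = (k \<oplus> k) \<otimes> r" using IH w(1) r beta_rel_le unfolding double_at_def by blast
      then have "u = ((k \<oplus> k) \<oplus> (k \<oplus> k)) \<otimes> r" using u2 by (simp add: R.distrib_right)
      then show ?thesis by blast
    qed
    then obtain k where k: "u = (k \<oplus> k) \<otimes> r" by blast
    show "\<exists>k. k \<preceq> e 0 \<and> u = (k \<oplus> k) \<otimes> r"
    \<comment> \<open>The bound on k rests on r being at least 1; for r = 0 the number u is 0 as
      well, and 0 replaces k.\<close>
    proof (cases "r = \<zero>")
      case True then show ?thesis using k by (intro exI[of _ \<zero>]) simp
    next
      case False
      then have "\<one> \<preceq> r" using axioms(16,17) le_iff by metis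
      then have "k \<otimes> \<one> \<preceq> (k \<oplus> k) \<otimes> r" by (intro mult_mono) simp_all
      then have "k \<preceq> e 0" using k beta_rel_le[OF u] R.order.trans by simp
      then show ?thesis using k by blast
    qed
  qed
qed

lemma prefix_at:
  assumes P: "delta0 (\<lambda>M e. P M (e 0) (\<lambda>n. e (Suc n)))"
    and 0: "beta_rel M (e 0) (e 1) \<zero> \<one>"
    and Suc: "\<And>i. i \<prec> e 2 \<Longrightarrow> \<exists>r. beta_rel M (e 0) (e 1) i r \<and> beta_rel M (e 0) (e 1) (i \<oplus> \<one>) (r \<oplus> r)"
  shows "prefix_at P M n e"
proof (rule delta0_induct[OF delta0_prefix_at[OF P]])
  show "prefix_at P M \<zero> e" unfolding prefix_at_def
    using 0 beta_rel_le[OF 0] axioms(15) by (intro impI exI[of _ \<one>] exI[of _ \<zero>] conjI) auto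
next
  let ?B = "beta_rel M (e 0) (e 1)" and ?o = "odd_at M (e 0) (e 1)" and ?v = "even_at M (e 0) (e 1)"
  define Q where "Q i \<longleftrightarrow> P M i (\<lambda>n. e (n + 3))" for i
  fix n assume IH: "prefix_at P M n e"
  show "prefix_at P M (n \<oplus> \<one>) e" unfolding prefix_at_def
  proof (intro impI)
    assume n: "n \<oplus> \<one> \<preceq> e 2"
    then have n': "n \<prec> e 2" by (simp add: suc_le)
    then obtain r s where r: "?B n r" and s: "s \<prec> r" and
      rs: "\<And>i. i \<prec> n \<Longrightarrow> (Q i \<longrightarrow> ?o s i) \<and> (\<not> Q i \<longrightarrow> ?v s i)"
      using IH le_iff unfolding prefix_at_def Q_def by blast
    have B: "?B (n \<oplus> \<one>) (r \<oplus> r)" using Suc[OF n'] r beta_rel_unique by blast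
    have rr: "r \<preceq> r \<oplus> r" by simp
    \<comment> \<open>Below entry n digit n of s is 0; adding the entry r turns it into 1.\<close>
    define s' where "s' = (if Q n then s \<oplus> r else s)"
    have "s' \<prec> r \<oplus> r" using s rr R.less_le_trans by (auto simp: s'_def)
    moreover have "(Q i \<longrightarrow> ?o s' i) \<and> (\<not> Q i \<longrightarrow> ?v s' i)" if i: "i \<prec> n \<oplus> \<one>" for i
    proof (cases "i = n")
      case True
      have "?o (s \<oplus> r) n" unfolding odd_at_def
        by (rule exI[of _ r], intro conjI beta_rel_le[OF r] r exI[of _ \<zero>] exI[of _ s] s)
          (simp_all add: R.add.commute)
      moreover have "?v s n" unfolding even_at_def
        by (rule exI[of _ r], intro conjI beta_rel_le[OF r] r exI[of _ \<zero>] exI[of _ s] s) simp_all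
      ultimately show ?thesis using True by (simp add: s'_def)
    next
      case False
      then have i': "i \<prec> n" using i le_iff by simp
      show ?thesis
      proof (cases "Q n")
        case False then show ?thesis using rs[OF i'] by (simp add: s'_def)
      next
        case True
        \<comment> \<open>The entry r is an even multiple of the earlier entry w, so adding it
          changes the quotient of s by w by the even number 2m, and digit i stays as it was.\<close>
        have key: "\<exists>m. r = (m \<oplus> m) \<otimes> w" if "?B i w" for w
          using double_at[OF Suc, of n] n' i' that r beta_rel_le le_iff unfolding double_at_def by blast
        \<comment> \<open>Both digit relations demand that half the quotient be bounded by the
          number itself; as w is at least 1, m is at most r and k + m at most s + r.\<close>
        have bound: "m \<preceq> (m \<oplus> m) \<otimes> w" if "t \<prec> w" for m t w
        proof -
          have "\<one> \<preceq> w" using that axioms(16,17) le_iff not_less_zero by metis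
          then have "m \<otimes> \<one> \<preceq> (m \<oplus> m) \<otimes> w" by (intro mult_mono) simp_all
          then show ?thesis by simp
        qed
        have "?o (s \<oplus> r) i" if o: "?o s i"
        proof -
          obtain w k t where w: "w \<preceq> e 0" "?B i w" "k \<preceq> s" "t \<prec> w" "s = (k \<oplus> k \<oplus> \<one>) \<otimes> w \<oplus> t"
            using o unfolding odd_at_def by blast
          obtain m where m: "r = (m \<oplus> m) \<otimes> w" using key w by blast
          have "s \<oplus> r = ((k \<oplus> m) \<oplus> (k \<oplus> m) \<oplus> \<one>) \<otimes> w \<oplus> t"
            unfolding w(5) m by (simp add: R.distrib_right R.add.assoc R.add.commute R.add.left_commute)
          moreover have "k \<oplus> m \<preceq> s \<oplus> r" using w(3) bound[OF w(4)] m by (intro add_mono) simp_all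
          ultimately show ?thesis unfolding odd_at_def using w by blast
        qed
        moreover have "?v (s \<oplus> r) i" if v: "?v s i"
        proof -
          obtain w k t where w: "w \<preceq> e 0" "?B i w" "k \<preceq> s" "t \<prec> w" "s = (k \<oplus> k) \<otimes> w \<oplus> t"
            using v unfolding even_at_def by blast
          obtain m where m: "r = (m \<oplus> m) \<otimes> w" using key w by blast
          have "s \<oplus> r = ((k \<oplus> m) \<oplus> (k \<oplus> m)) \<otimes> w \<oplus> t"
            unfolding w(5) m by (simp add: R.distrib_right R.add.assoc R.add.commute R.add.left_commute)
          moreover have "k \<oplus> m \<preceq> s \<oplus> r" using w(3) bound[OF w(4)] m by (intro add_mono) simp_all
          ultimately show ?thesis unfolding even_at_def using w by blast
        qed
        ultimately show ?thesis using rs[OF i'] True by (simp add: s'_def)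
      qed
    qed
    ultimately show "\<exists>r. r \<preceq> e 0 \<and> ?B (n \<oplus> \<one>) r \<and> (\<exists>s. s \<prec> r \<and> (\<forall>i. i \<prec> n \<oplus> \<one> \<longrightarrow>
        (P M i (\<lambda>n. e (n + 3)) \<longrightarrow> ?o s i) \<and> (\<not> P M i (\<lambda>n. e (n + 3)) \<longrightarrow> ?v s i)))"
      unfolding Q_def[symmetric] using B beta_rel_le by blast
  qed
qed

text \<open>Uniqueness of division gives both relations the same quotient, and discreteness of the
  order excludes 2k + 1 = 2k'.\<close>

lemma odd_even_exclusive: "odd_at M a b s i \<Longrightarrow> \<not> even_at M a b s i"
proof
  assume "odd_at M a b s i" "even_at M a b s i"
  then obtain r k t r' k' t' where *: "beta_rel M a b i r" "t \<prec> r" "s = (k \<oplus> k \<oplus> \<one>) \<otimes> r \<oplus> t"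
    "beta_rel M a b i r'" "t' \<prec> r'" "s = (k' \<oplus> k') \<otimes> r' \<oplus> t'" unfolding odd_at_def even_at_def by blast
  then have "r = r'" using beta_rel_unique by blast
  then have eq: "k \<oplus> k \<oplus> \<one> = k' \<oplus> k'" using division_unique * by metis
  show False
  proof (cases "k \<prec> k'")
    case True
    then have "k \<oplus> \<one> \<preceq> k'" by (simp add: suc_le)
    then have "(k \<oplus> \<one>) \<oplus> (k \<oplus> \<one>) \<preceq> k \<oplus> k \<oplus> \<one>" unfolding eq by (intro add_mono)
    moreover have "(k \<oplus> \<one>) \<oplus> (k \<oplus> \<one>) = k \<oplus> k \<oplus> \<one> \<oplus> \<one>"
      by (simp only: R.add.assoc R.add.commute R.add.left_commute)
    ultimately show False by (simp add: suc_le)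
  next
    case False
    then have "k' \<oplus> k' \<preceq> k \<oplus> k" by (intro add_mono) (simp_all add: R.not_less)
    then have "k \<oplus> k \<oplus> \<one> \<preceq> k \<oplus> k" using eq by simp
    then show False by (simp add: suc_le)
  qed
qed

text \<open>This is where Exp is used: it supplies a table of powers of 2 up to position N, and
  \<open>prefix_at\<close> at n = N yields the digits.\<close>

lemma comprehension:
  assumes "delta0 (\<lambda>M e. P M (e 0) (\<lambda>n. e (Suc n)))"
  shows "\<exists>u. \<forall>i. mem M u i \<longleftrightarrow> i \<prec> N \<and> P M i e"
proof -
  obtain a b where ab: "beta_rel M a b \<zero> \<one>"
    "\<forall>i. i \<prec> N \<longrightarrow> (\<exists>r. beta_rel M a b i r \<and> beta_rel M a b (i \<oplus> \<one>) (r \<oplus> r))"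
    using exp_beta_rel by blast
  define e' where "e' = a ## b ## N ## e"
  have e': "e' 0 = a" "e' 1 = b" "e' 2 = N" "(\<lambda>n. e' (n + 3)) = e"
    by (simp_all add: e'_def numeral_2_eq_2 numeral_3_eq_3)
  have "prefix_at P M N e'"
    by (rule prefix_at[OF assms]) (use ab in \<open>simp_all only: e' simp_thms\<close>)
  then obtain s where s: "\<forall>i. i \<prec> N \<longrightarrow> (P M i e \<longrightarrow> odd_at M a b s i) \<and> (\<not> P M i e \<longrightarrow> even_at M a b s i)"
    unfolding prefix_at_def e' by auto
  have "mem M (pr M a (pr M b (pr M s N))) i \<longleftrightarrow> i \<prec> N \<and> P M i e" for i
    using s odd_even_exclusive by (auto simp: mem_def)
  then show ?thesis by blast
qed

end

section \<open>Truth definitions\<close>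

text \<open>
  \<open>Delta0\<close> formulas are evaluated after translation into expressions over an environment which is a
  nested pair: \<open>EnvX\<close> is the whole environment, \<open>HdX\<close> its head, and \<open>TlX f\<close> evaluates \<open>f\<close> in its
  tail. Truth values are 0 and 1, so that negations, implications and equations can be expressed by
  \<open>AddX\<close> and \<open>LessX\<close>; \<open>AllX f g\<close> quantifies over the numbers below the value of \<open>f\<close>.
\<close>

datatype expr = EnvX | HdX | TlX expr | OneX | AddX expr expr | MulX expr expr | LessX expr expr | AllX expr expr

text \<open>Built with \<open>pr\<close> rather than \<open>pe\<close> because \<open>pr\<close> is
  a term and so commutes with numerals in every model. The distinct tags separate the
  constructors.\<close>

primrec ecode :: "expr \<Rightarrow> nat" where
  "ecode EnvX = pr std 2 2"
| "ecode HdX = pr std 3 3"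
| "ecode (TlX f) = pr std 4 (ecode f)"
| "ecode OneX = pr std 5 5"
| "ecode (AddX f g) = pr std 6 (pr std (ecode f) (ecode g))"
| "ecode (MulX f g) = pr std 7 (pr std (ecode f) (ecode g))"
| "ecode (LessX f g) = pr std 8 (pr std (ecode f) (ecode g))"
| "ecode (AllX f g) = pr std 9 (pr std (ecode f) (ecode g))"

definition tv :: "'a str \<Rightarrow> bool \<Rightarrow> 'a" where
  "tv M b = (if b then un M else zr M)"

text \<open>A relation and not a function, because \<open>pr\<close> is not surjective and
  \<open>HdX\<close> may have no value on a given environment.\<close>

primrec evals :: "'a str \<Rightarrow> expr \<Rightarrow> 'a \<Rightarrow> 'a \<Rightarrow> bool" where
  "evals M EnvX e v \<longleftrightarrow> v = e"
| "evals M HdX e v \<longleftrightarrow> (\<exists>e'. e = pr M v e')"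
| "evals M (TlX f) e v \<longleftrightarrow> (\<exists>x e'. e = pr M x e' \<and> evals M f e' v)"
| "evals M OneX e v \<longleftrightarrow> v = un M"
| "evals M (AddX f g) e v \<longleftrightarrow> (\<exists>x y. evals M f e x \<and> evals M g e y \<and> v = ad M x y)"
| "evals M (MulX f g) e v \<longleftrightarrow> (\<exists>x y. evals M f e x \<and> evals M g e y \<and> v = mu M x y)"
| "evals M (LessX f g) e v \<longleftrightarrow> (\<exists>x y. evals M f e x \<and> evals M g e y \<and>
    (ls M x y \<and> v = un M \<or> \<not> ls M x y \<and> v = zr M))"
| "evals M (AllX f g) e v \<longleftrightarrow> (\<exists>w. evals M f e w \<and>
    (v = un M \<and> (\<forall>x. ls M x w \<longrightarrow> evals M g (pr M x e) (un M)) \<or>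
     v = zr M \<and> (\<exists>x. ls M x w \<and> (\<exists>y. y \<noteq> un M \<and> evals M g (pr M x e) y))))"

text \<open>The bound W on all environments and values makes evaluation of a fixed expression a
  bounded relation, to which comprehension applies.\<close>

primrec evals_le :: "'a str \<Rightarrow> 'a \<Rightarrow> expr \<Rightarrow> 'a \<Rightarrow> 'a \<Rightarrow> bool" where
  "evals_le M W EnvX e v \<longleftrightarrow> le M e W \<and> le M v W \<and> v = e"
| "evals_le M W HdX e v \<longleftrightarrow> le M e W \<and> le M v W \<and> (\<exists>e'. le M e' W \<and> e = pr M v e')"
| "evals_le M W (TlX f) e v \<longleftrightarrow> le M e W \<and> le M v W \<and>
    (\<exists>x. le M x W \<and> (\<exists>e'. le M e' W \<and> e = pr M x e' \<and> evals_le M W f e' v))"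
| "evals_le M W OneX e v \<longleftrightarrow> le M e W \<and> le M v W \<and> v = un M"
| "evals_le M W (AddX f g) e v \<longleftrightarrow> le M e W \<and> le M v W \<and>
    (\<exists>x. le M x W \<and> (\<exists>y. le M y W \<and> evals_le M W f e x \<and> evals_le M W g e y \<and> v = ad M x y))"
| "evals_le M W (MulX f g) e v \<longleftrightarrow> le M e W \<and> le M v W \<and>
    (\<exists>x. le M x W \<and> (\<exists>y. le M y W \<and> evals_le M W f e x \<and> evals_le M W g e y \<and> v = mu M x y))"
| "evals_le M W (LessX f g) e v \<longleftrightarrow> le M e W \<and> le M v W \<and>
    (\<exists>x. le M x W \<and> (\<exists>y. le M y W \<and> evals_le M W f e x \<and> evals_le M W g e y \<and>
    (ls M x y \<and> v = un M \<or> \<not> ls M x y \<and> v = zr M)))"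
| "evals_le M W (AllX f g) e v \<longleftrightarrow> le M e W \<and> le M v W \<and> (\<exists>w. le M w W \<and> evals_le M W f e w \<and>
    (v = un M \<and> (\<forall>x. ls M x w \<longrightarrow> evals_le M W g (pr M x e) (un M)) \<or>
     v = zr M \<and> (\<exists>x. ls M x w \<and> (\<exists>y. le M y W \<and> y \<noteq> un M \<and> evals_le M W g (pr M x e) y))))"

lemma delta0_evals_le: "delta0 (\<lambda>M e. evals_le M (e 0) f (e 1) (e 2))"
proof (induction f)
  case (TlX f)
  show ?case unfolding evals_le.simps le_def by (intro delta0_intros term_fn_pr delta0_3[where P = "\<lambda>M W. evals_le M W f", OF TlX])
next
  case (AddX f g)
  show ?case unfolding evals_le.simps le_def
    by (intro delta0_intros delta0_3[where P = "\<lambda>M W. evals_le M W f", OF AddX(1)] delta0_3[where P = "\<lambda>M W. evals_le M W g", OF AddX(2)])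
next
  case (MulX f g)
  show ?case unfolding evals_le.simps le_def
    by (intro delta0_intros delta0_3[where P = "\<lambda>M W. evals_le M W f", OF MulX(1)] delta0_3[where P = "\<lambda>M W. evals_le M W g", OF MulX(2)])
next
  case (LessX f g)
  show ?case unfolding evals_le.simps le_def
    by (intro delta0_intros delta0_3[where P = "\<lambda>M W. evals_le M W f", OF LessX(1)] delta0_3[where P = "\<lambda>M W. evals_le M W g", OF LessX(2)])
next
  case (AllX f g)
  show ?case unfolding evals_le.simps le_def
    by (intro delta0_intros term_fn_pr delta0_3[where P = "\<lambda>M W. evals_le M W f", OF AllX(1)]
        delta0_3[where P = "\<lambda>M W. evals_le M W g", OF AllX(2)])
qed (unfold evals_le.simps le_def, (intro delta0_intros term_fn_pr)+)

section \<open>Certificates of evaluation\<close>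

primrec subs :: "expr \<Rightarrow> expr list" where
  "subs EnvX = [EnvX]"
| "subs HdX = [HdX]"
| "subs (TlX f) = TlX f # subs f"
| "subs OneX = [OneX]"
| "subs (AddX f g) = AddX f g # subs f @ subs g"
| "subs (MulX f g) = MulX f g # subs f @ subs g"
| "subs (LessX f g) = LessX f g # subs f @ subs g"
| "subs (AllX f g) = AllX f g # subs f @ subs g"

lemma subs_refl [simp]: "f \<in> set (subs f)"
  by (cases f) auto

lemma subs_trans: "g \<in> set (subs f) \<Longrightarrow> h \<in> set (subs g) \<Longrightarrow> h \<in> set (subs f)"
  by (induction f) auto

lemma le_pr_std: "x \<le> pr std x y" "y \<le> pr std x y"
  using PA_model.pr_le[OF PA_model_std] by simp_all

lemma le_pr_pr_std: "x \<le> pr std t (pr std x y)" "y \<le> pr std t (pr std x y)"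
  using le_pr_std order_trans by metis+

lemma ecode_subs: "g \<in> set (subs f) \<Longrightarrow> ecode g \<le> ecode f"
  by (induction f) (auto intro: order_trans le_pr_std le_pr_pr_std)

text \<open>
  A certificate is a coded set of triples (code of \<open>f\<close>, environment, value) in which each triple
  is justified by other members, so that its standard part can only contain correct evaluations.
\<close>

abbreviation entry :: "'a str \<Rightarrow> 'a \<Rightarrow> 'a \<Rightarrow> 'a \<Rightarrow> 'a \<Rightarrow> bool" where
  "entry M u c e v \<equiv> mem M u (pr M c (pr M e v))"

definition justified :: "'a str \<Rightarrow> 'a \<Rightarrow> 'a \<Rightarrow> 'a \<Rightarrow> 'a \<Rightarrow> bool" where
  "justified M u c e v \<longleftrightarrow>
    (c = pr M (nm M 2) (nm M 2) \<and> v = e) \<or>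
    (c = pr M (nm M 3) (nm M 3) \<and> (\<exists>e'. e = pr M v e')) \<or>
    (\<exists>c' x e'. c = pr M (nm M 4) c' \<and> e = pr M x e' \<and> entry M u c' e' v) \<or>
    (c = pr M (nm M 5) (nm M 5) \<and> v = un M) \<or>
    (\<exists>c1 c2 x y. entry M u c1 e x \<and> entry M u c2 e y \<and>
      (c = pr M (nm M 6) (pr M c1 c2) \<and> v = ad M x y \<or>
       c = pr M (nm M 7) (pr M c1 c2) \<and> v = mu M x y \<or>
       c = pr M (nm M 8) (pr M c1 c2) \<and> (ls M x y \<and> v = un M \<or> \<not> ls M x y \<and> v = zr M))) \<or>
    (\<exists>c1 c2 w. c = pr M (nm M 9) (pr M c1 c2) \<and> entry M u c1 e w \<and>
      (v = un M \<and> (\<forall>x. ls M x w \<longrightarrow> entry M u c2 (pr M x e) (un M)) \<or>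
       v = zr M \<and> (\<exists>x. ls M x w \<and> (\<exists>y. y \<noteq> un M \<and> entry M u c2 (pr M x e) y))))"

definition certified :: "'a str \<Rightarrow> 'a \<Rightarrow> 'a \<Rightarrow> 'a \<Rightarrow> bool" where
  "certified M c e v \<longleftrightarrow> (\<exists>u. (\<forall>c e v. entry M u c e v \<longrightarrow> justified M u c e v) \<and> entry M u c e v)"

lemma arith_mem: "arith (\<lambda>M e. mem M (e 0) (e 1))"
  unfolding mem_def odd_at_def beta_rel_def le_def by (intro arith_intros term_fn_pr)

lemma arith_certified: "arith (\<lambda>M e. certified M (e 0) (e 1) (e 2))"
  unfolding certified_def justified_def by (intro arith_intros arith_2[OF arith_mem] term_fn_pr term_fn_nm)

context exp_model
begin

text \<open>The induction runs over the expression f itself, not over codes in M: the justification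
  of its code refers only to codes of direct subexpressions, so entries with nonstandard codes are
  never consulted.\<close>

lemma entry_sound:
  assumes just: "\<And>c e v. entry M u c e v \<Longrightarrow> justified M u c e v"
  shows "entry M u (nm M (ecode f)) e v \<Longrightarrow> evals M f e v"
proof (induction f arbitrary: e v)
  case (AllX f g)
  from just[OF AllX.prems] have "\<exists>w. entry M u (nm M (ecode f)) e w \<and>
      (v = \<one> \<and> (\<forall>x. x \<prec> w \<longrightarrow> entry M u (nm M (ecode g)) (pr M x e) \<one>) \<or>
       v = \<zero> \<and> (\<exists>x. x \<prec> w \<and> (\<exists>y. y \<noteq> \<one> \<and> entry M u (nm M (ecode g)) (pr M x e) y)))"
    unfolding justified_def by (simp add: nm_pr)
  then show ?case unfolding evals.simps using AllX.IH by blast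
next
  case EnvX
  from just[OF EnvX.prems] show ?case unfolding justified_def by (simp add: nm_pr)
next
  case HdX
  from just[OF HdX.prems] show ?case unfolding justified_def by (simp add: nm_pr)
next
  case (TlX f)
  from just[OF TlX.prems] show ?case unfolding justified_def using TlX.IH by (auto simp add: nm_pr)
next
  case OneX
  from just[OF OneX.prems] show ?case unfolding justified_def by (simp add: nm_pr)
next
  case (AddX f g)
  from just[OF AddX.prems] have "\<exists>x y. entry M u (nm M (ecode f)) e x \<and> entry M u (nm M (ecode g)) e y \<and> v = x \<oplus> y"
    unfolding justified_def by (auto simp: nm_pr)
  then show ?case unfolding evals.simps using AddX.IH by blast
next
  case (MulX f g)
  from just[OF MulX.prems] have "\<exists>x y. entry M u (nm M (ecode f)) e x \<and> entry M u (nm M (ecode g)) e y \<and> v = x \<otimes> y"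
    unfolding justified_def by (auto simp: nm_pr)
  then show ?case unfolding evals.simps using MulX.IH by blast
next
  case (LessX f g)
  from just[OF LessX.prems] have "\<exists>x y. entry M u (nm M (ecode f)) e x \<and> entry M u (nm M (ecode g)) e y \<and>
      (x \<prec> y \<and> v = \<one> \<or> \<not> x \<prec> y \<and> v = \<zero>)"
    unfolding justified_def by (auto simp: nm_pr)
  then show ?case unfolding evals.simps using LessX.IH by blast
qed

lemma evals_le_bounds: "evals_le M W f e v \<Longrightarrow> e \<preceq> W \<and> v \<preceq> W"
  by (cases f) auto

text \<open>Uniformity over all environments up to m is forced by \<open>AllX\<close>, whose body is
  evaluated in varying environments; uniformity over all larger W lets the bounds of subexpressions
  be combined.\<close>

definition bounds :: "'a \<Rightarrow> expr \<Rightarrow> 'a \<Rightarrow> bool" where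
  "bounds m f W0 \<longleftrightarrow> (\<forall>e v. e \<preceq> m \<longrightarrow> evals M f e v \<longrightarrow> v \<preceq> W0 \<and> (\<forall>W. W0 \<preceq> W \<longrightarrow> evals_le M W f e v))"

lemma bounds_binary:
  assumes fg: "bounds m f W1" "bounds m g W2"
    and h: "\<And>e v. evals M h e v \<Longrightarrow> \<exists>x y. evals M f e x \<and> evals M g e y \<and> Q x y v"
    and hW: "\<And>W e v x y. e \<preceq> W \<Longrightarrow> v \<preceq> W \<Longrightarrow> x \<preceq> W \<Longrightarrow> y \<preceq> W \<Longrightarrow> evals_le M W f e x \<Longrightarrow>
      evals_le M W g e y \<Longrightarrow> Q x y v \<Longrightarrow> evals_le M W h e v"
    and Q: "\<And>x y v. Q x y v \<Longrightarrow> v = x \<oplus> y \<or> v = x \<otimes> y \<or> v \<preceq> \<one>"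
  shows "\<exists>W0. bounds m h W0"
proof -
  \<comment> \<open>The summands cover a sum, a product, a truth value and the environment.\<close>
  let ?W = "(W1 \<oplus> W2) \<oplus> (W1 \<otimes> W2 \<oplus> (\<one> \<oplus> m))"
  have "bounds m h ?W" unfolding bounds_def
  proof (intro allI impI conjI)
    fix e v assume e: "e \<preceq> m" and "evals M h e v"
    then obtain x y where xy: "evals M f e x" "evals M g e y" "Q x y v" using h by blast
    then have W: "x \<preceq> W1" "y \<preceq> W2" using fg e unfolding bounds_def by blast+
    then have "v \<preceq> W1 \<oplus> W2 \<or> v \<preceq> W1 \<otimes> W2 \<or> v \<preceq> \<one>" using Q[OF xy(3)] add_mono mult_mono by blast
    then show v: "v \<preceq> ?W" using le_add R.order.trans by metis
    fix W assume "?W \<preceq> W"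
    then have le: "W1 \<preceq> W" "W2 \<preceq> W" "m \<preceq> W" "v \<preceq> W" using v le_add R.order.trans by metis+
    then have "e \<preceq> W" "x \<preceq> W" "y \<preceq> W" using e W R.order.trans by metis+
    moreover have "evals_le M W f e x" "evals_le M W g e y" using fg e xy le unfolding bounds_def by blast+
    ultimately show "evals_le M W h e v" using hW le(4) xy(3) by blast
  qed
  then show ?thesis ..
qed

lemma bounds_exists: "\<exists>W0. bounds m f W0"
proof (induction f arbitrary: m)
  case EnvX
  show ?case unfolding bounds_def by (rule exI[of _ m]) (auto intro: R.order.trans)
next
  case HdX
  show ?case unfolding bounds_def by (rule exI[of _ m]) (auto intro: R.order.trans pr_le)
next
  case OneX
  show ?case unfolding bounds_def by (rule exI[of _ "m \<oplus> \<one>"]) (auto, (metis le_add R.order.trans)+)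
next
  case (TlX f)
  then obtain W1 where W1: "bounds m f W1" by blast
  have "bounds m (TlX f) (W1 \<oplus> m)" unfolding bounds_def
  proof (intro allI impI conjI)
    fix e v assume e: "e \<preceq> m" and ev: "evals M (TlX f) e v"
    then obtain x e' where xe: "e = pr M x e'" "evals M f e' v" by auto
    then have m: "x \<preceq> m" "e' \<preceq> m" using e pr_le R.order.trans by metis+
    then have v: "v \<preceq> W1" using W1 xe unfolding bounds_def by blast
    then show "v \<preceq> W1 \<oplus> m" using le_add R.order.trans by metis
    fix W assume "W1 \<oplus> m \<preceq> W"
    then have W: "W1 \<preceq> W" "m \<preceq> W" using le_add R.order.trans by metis+
    have "evals_le M W f e' v" using W1 m xe W unfolding bounds_def by blast
    moreover have "e \<preceq> W" "v \<preceq> W" "x \<preceq> W" "e' \<preceq> W" using e m v W R.order.trans by metis+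
    ultimately show "evals_le M W (TlX f) e v" using xe by auto
  qed
  then show ?case ..
next
  case (AddX f g)
  from AddX obtain W1 W2 where "bounds m f W1" "bounds m g W2" by metis
  then show ?case by (rule bounds_binary[where Q = "\<lambda>x y v. v = x \<oplus> y"]) auto
next
  case (MulX f g)
  from MulX obtain W1 W2 where "bounds m f W1" "bounds m g W2" by metis
  then show ?case by (rule bounds_binary[where Q = "\<lambda>x y v. v = x \<otimes> y"]) auto
next
  case (LessX f g)
  from LessX obtain W1 W2 where "bounds m f W1" "bounds m g W2" by metis
  then show ?case by (rule bounds_binary[where Q = "\<lambda>x y v. x \<prec> y \<and> v = \<one> \<or> \<not> x \<prec> y \<and> v = \<zero>"]) auto
next
  case (AllX f g)
  from AllX(1) obtain W1 where W1: "\<And>e v W. e \<preceq> m \<Longrightarrow> evals M f e v \<Longrightarrow> v \<preceq> W1 \<and> (W1 \<preceq> W \<longrightarrow> evals_le M W f e v)"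
    unfolding bounds_def by meson
  \<comment> \<open>The body is evaluated at \<open>pr M x e\<close> with x below a value that is at
    most W1 and e at most m, so \<open>pr M W1 m\<close> bounds all its environments.\<close>
  from AllX(2) obtain W2 where W2: "\<And>e v W. e \<preceq> pr M W1 m \<Longrightarrow> evals M g e v \<Longrightarrow> v \<preceq> W2 \<and> (W2 \<preceq> W \<longrightarrow> evals_le M W g e v)"
    unfolding bounds_def by meson
  show ?case unfolding bounds_def
  proof (rule exI[of _ "\<one> \<oplus> (W1 \<oplus> W2 \<oplus> m)"], intro allI impI conjI)
    fix e v assume e: "e \<preceq> m" and ev: "evals M (AllX f g) e v"
    then obtain w where w: "evals M f e w" "v = \<one> \<and> (\<forall>x. x \<prec> w \<longrightarrow> evals M g (pr M x e) \<one>) \<or>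
      v = \<zero> \<and> (\<exists>x. x \<prec> w \<and> (\<exists>y. y \<noteq> \<one> \<and> evals M g (pr M x e) y))" by auto
    then have wW: "w \<preceq> W1" using W1 e by blast
    have "v \<preceq> \<one>" using w by auto
    then show v: "v \<preceq> \<one> \<oplus> (W1 \<oplus> W2 \<oplus> m)" using le_add R.order.trans by metis
    fix W assume W: "\<one> \<oplus> (W1 \<oplus> W2 \<oplus> m) \<preceq> W"
    then have W': "W1 \<preceq> W" "W2 \<preceq> W" "m \<preceq> W" using le_add R.order.trans by metis+
    have f: "evals_le M W f e w" using W1 w e W' by blast
    have b: "e \<preceq> W" "v \<preceq> W" "w \<preceq> W" using e v wW W W' R.order.trans by metis+
    have pe: "pr M x e \<preceq> pr M W1 m" if "x \<prec> w" for x
      using that wW e R.less_imp_le R.order.trans by (intro pr_mono) blast+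
    have "evals_le M W g (pr M x e) y \<and> y \<preceq> W" if "x \<prec> w" "evals M g (pr M x e) y" for x y
      using W2[OF pe[OF that(1)] that(2), of W] W' R.order.trans by blast
    with w(2) have "v = \<one> \<and> (\<forall>x. x \<prec> w \<longrightarrow> evals_le M W g (pr M x e) \<one>) \<or>
      v = \<zero> \<and> (\<exists>x. x \<prec> w \<and> (\<exists>y. y \<preceq> W \<and> y \<noteq> \<one> \<and> evals_le M W g (pr M x e) y))" by blast
    then show "evals_le M W (AllX f g) e v" unfolding evals_le.simps using b f by blast
  qed
qed

text \<open>The certificate is the set of all correct triples for subexpressions of f within a
  sufficiently large W. It is definable by a bounded formula because f has a fixed finite list of
  subexpressions.\<close>

lemma certificate_exists:
  assumes "evals M f e v"
  shows "\<exists>u. (\<forall>c e v. entry M u c e v \<longrightarrow> justified M u c e v) \<and> entry M u (nm M (ecode f)) e v"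
proof -
  obtain W where W: "evals_le M W f e v" using bounds_exists[of e f] assms R.order.refl unfolding bounds_def by blast
  define P where "P M i s \<longleftrightarrow> (\<exists>e. le M e (s 0) \<and> (\<exists>v. le M v (s 0) \<and> (\<exists>g\<in>set (subs f).
    i = pr M (nm M (ecode g)) (pr M e v) \<and> evals_le M (s 0) g e v)))" for M :: "'a str" and i and s :: "nat \<Rightarrow> 'a"
  have evals_le: "delta0 (\<lambda>M s. evals_le M (W M s) g (e M s) (v M s))" if "term_fn W" "term_fn e" "term_fn v"
    for W e v :: "'a str \<Rightarrow> (nat \<Rightarrow> 'a) \<Rightarrow> 'a" and g
    using delta0_3[where P = "\<lambda>M W. evals_le M W g", OF delta0_evals_le that] .
  have "delta0 (\<lambda>M e. P M (e 0) (\<lambda>n. e (Suc n)))"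
    unfolding P_def le_def by (intro delta0_intros delta0_list_ex evals_le term_fn_pr term_fn_nm)
  \<comment> \<open>By monotonicity of \<open>pr\<close> and \<open>ecode_subs\<close> this pair
    bounds every triple in question; the added 1 turns the strict bound of
    \<open>comprehension\<close> into \<open>le\<close>. The parameter environment is constantly
    W.\<close>
  from comprehension[OF this, of "pr M (nm M (ecode f)) (pr M W W) \<oplus> \<one>" "\<lambda>_. W"]
  obtain u where u: "\<And>i. mem M u i \<longleftrightarrow> i \<preceq> pr M (nm M (ecode f)) (pr M W W) \<and> P M i (\<lambda>_. W)" by auto
  have entry: "entry M u c e v \<longleftrightarrow> (\<exists>g\<in>set (subs f). c = nm M (ecode g) \<and> evals_le M W g e v)" for c e v
  proof
    assume "entry M u c e v"
    then show "\<exists>g\<in>set (subs f). c = nm M (ecode g) \<and> evals_le M W g e v" by (auto simp: u P_def)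
  next
    assume "\<exists>g\<in>set (subs f). c = nm M (ecode g) \<and> evals_le M W g e v"
    then obtain g where g: "g \<in> set (subs f)" "c = nm M (ecode g)" "evals_le M W g e v" by blast
    moreover have b: "e \<preceq> W" "v \<preceq> W" using evals_le_bounds g(3) by blast+
    moreover have "pr M c (pr M e v) \<preceq> pr M (nm M (ecode f)) (pr M W W)"
      using b ecode_subs[OF g(1)] g(2) by (intro pr_mono) simp_all
    ultimately show "entry M u c e v" unfolding u P_def by blast
  qed
  have "justified M u c e v" if en: "entry M u c e v" for c e v
  proof -
    obtain g where g: "g \<in> set (subs f)" "c = nm M (ecode g)" "evals_le M W g e v" using en unfolding entry by blast
    have sub: "entry M u (nm M (ecode h)) e' v'" if "h \<in> set (subs g)" "evals_le M W h e' v'" for h e' v'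
      unfolding entry using that subs_trans[OF g(1)] by blast
    show ?thesis
    proof (cases g)
      case EnvX
      then show ?thesis using g unfolding justified_def by (simp add: nm_pr)
    next
      case HdX
      then show ?thesis using g unfolding justified_def by (auto simp add: nm_pr)
    next
      case OneX
      then show ?thesis using g unfolding justified_def by (simp add: nm_pr)
    next
      case (TlX h)
      then obtain x e' where "e = pr M x e'" "evals_le M W h e' v" using g by auto
      moreover from this have "entry M u (nm M (ecode h)) e' v" using TlX by (intro sub) auto
      ultimately show ?thesis using g TlX unfolding justified_def by (auto simp add: nm_pr)
    next
      case (AddX h k)
      then obtain x y where "evals_le M W h e x" "evals_le M W k e y" "v = x \<oplus> y" using g by auto
      moreover from this have "entry M u (nm M (ecode h)) e x" "entry M u (nm M (ecode k)) e y"
        using AddX by (auto intro!: sub)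
      ultimately show ?thesis using g AddX unfolding justified_def by (auto simp add: nm_pr)
    next
      case (MulX h k)
      then obtain x y where "evals_le M W h e x" "evals_le M W k e y" "v = x \<otimes> y" using g by auto
      moreover from this have "entry M u (nm M (ecode h)) e x" "entry M u (nm M (ecode k)) e y"
        using MulX by (auto intro!: sub)
      ultimately show ?thesis using g MulX unfolding justified_def by (auto simp add: nm_pr)
    next
      case (LessX h k)
      then obtain x y where xy: "evals_le M W h e x" "evals_le M W k e y" "x \<prec> y \<and> v = \<one> \<or> \<not> x \<prec> y \<and> v = \<zero>"
        using g by auto
      then have e: "entry M u (nm M (ecode h)) e x" "entry M u (nm M (ecode k)) e y"
        using LessX by (auto intro!: sub)
      have "\<exists>c1 c2 x y. entry M u c1 e x \<and> entry M u c2 e y \<and> c = pr M (nm M 8) (pr M c1 c2) \<and>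
          (x \<prec> y \<and> v = \<one> \<or> \<not> x \<prec> y \<and> v = \<zero>)"
        using e xy(3) g(2) LessX by (simp add: nm_pr) blast
      then show ?thesis unfolding justified_def by blast
    next
      case (AllX h k)
      then obtain w where w: "evals_le M W h e w" "v = \<one> \<and> (\<forall>x. x \<prec> w \<longrightarrow> evals_le M W k (pr M x e) \<one>) \<or>
        v = \<zero> \<and> (\<exists>x. x \<prec> w \<and> (\<exists>y. y \<noteq> \<one> \<and> evals_le M W k (pr M x e) y))" using g by auto
      have k: "entry M u (nm M (ecode k)) e' v'" if "evals_le M W k e' v'" for e' v'
        using AllX that by (auto intro!: sub)
      have "entry M u (nm M (ecode h)) e w" using AllX w by (auto intro!: sub)
      moreover have "v = \<one> \<and> (\<forall>x. x \<prec> w \<longrightarrow> entry M u (nm M (ecode k)) (pr M x e) \<one>) \<or>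
        v = \<zero> \<and> (\<exists>x. x \<prec> w \<and> (\<exists>y. y \<noteq> \<one> \<and> entry M u (nm M (ecode k)) (pr M x e) y))"
        using w(2) k by blast
      moreover have "c = pr M (nm M 9) (pr M (nm M (ecode h)) (nm M (ecode k)))" using g AllX by (simp add: nm_pr)
      ultimately show ?thesis unfolding justified_def by blast
    qed
  qed
  moreover have "entry M u (nm M (ecode f)) e v" unfolding entry using W subs_refl by blast
  ultimately show ?thesis by blast
qed

lemma certified_iff: "certified M (nm M (ecode f)) e v \<longleftrightarrow> evals M f e v"
  unfolding certified_def using entry_sound certificate_exists by blast

end

section \<open>Translation of formulas into expressions\<close>

primrec envc :: "'a str \<Rightarrow> nat \<Rightarrow> (nat \<Rightarrow> 'a) \<Rightarrow> 'a" where
  "envc M 0 e = zr M"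
| "envc M (Suc k) e = pr M (e 0) (envc M k (\<lambda>n. e (Suc n)))"

lemma (in PA_model) evals_Var: "n < k \<Longrightarrow> evals M ((TlX ^^ n) HdX) (envc M k e) v \<longleftrightarrow> v = e n"
proof (induction n arbitrary: k e)
  case 0 then show ?case by (cases k) auto
next
  case (Suc n) then show ?case by (cases k) auto
qed

text \<open>One expression must serve in all models. The threshold k0 asks for an environment long
  enough that every variable looked up is a genuine entry; all longer ones are allowed because
  quantifiers lengthen it.\<close>

definition codes :: "'a itself \<Rightarrow> expr \<Rightarrow> nat \<Rightarrow> ('a str \<Rightarrow> (nat \<Rightarrow> 'a) \<Rightarrow> 'a) \<Rightarrow> bool" where
  "codes _ f k0 h \<longleftrightarrow> (\<forall>M k e v. PA_model M \<longrightarrow> k0 \<le> k \<longrightarrow> (evals M f (envc M k e) v \<longleftrightarrow> v = h M e))"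

lemma codesI:
  "(\<And>(M :: 'a str) k e v. PA_model M \<Longrightarrow> k0 \<le> k \<Longrightarrow> evals M f (envc M k e) v \<longleftrightarrow> v = h M e) \<Longrightarrow> codes TYPE('a) f k0 h"
  by (simp add: codes_def)

lemma codesD:
  "codes TYPE('a) f k0 h \<Longrightarrow> PA_model (M :: 'a str) \<Longrightarrow> k0 \<le> k \<Longrightarrow> evals M f (envc M k e) v \<longleftrightarrow> v = h M e"
  by (simp add: codes_def)

lemma term_code: "\<exists>f k0. codes TYPE('a) f k0 (\<lambda>M e. val M e t)"
proof (induction t)
  case (Var n)
  have "codes TYPE('a) ((TlX ^^ n) HdX) (Suc n) (\<lambda>M e. val M e (Var n))"
    by (rule codesI) (simp add: PA_model.evals_Var)
  then show ?case by blast
next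
  case Zero
  \<comment> \<open>The constant 0 is obtained as the truth value of the false statement 1 <
    1.\<close>
  have "codes TYPE('a) (LessX OneX OneX) 0 (\<lambda>M e. val M e Zero)"
    by (rule codesI) (simp add: PA_model.axioms(10))
  then show ?case by blast
next
  case One
  have "codes TYPE('a) OneX 0 (\<lambda>M e. val M e One)" by (rule codesI) simp
  then show ?case by blast
next
  case (Add s t)
  then obtain f k1 g k2 where "codes TYPE('a) f k1 (\<lambda>M e. val M e s)" "codes TYPE('a) g k2 (\<lambda>M e. val M e t)"
    by blast
  then have "codes TYPE('a) (AddX f g) (max k1 k2) (\<lambda>M e. val M e (Add s t))"
    by (intro codesI) (simp add: codesD)
  then show ?case by blast
next
  case (Mul s t)
  then obtain f k1 g k2 where "codes TYPE('a) f k1 (\<lambda>M e. val M e s)" "codes TYPE('a) g k2 (\<lambda>M e. val M e t)"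
    by blast
  then have "codes TYPE('a) (MulX f g) (max k1 k2) (\<lambda>M e. val M e (Mul s t))"
    by (intro codesI) (simp add: codesD)
  then show ?case by blast
qed

lemma Delta0_code: "\<phi> \<in> Delta0 \<Longrightarrow> \<exists>f k0. codes TYPE('a) f k0 (\<lambda>M e. tv M (sat M e \<phi>))"
proof (induction rule: Delta0.induct)
  case (1 s t)
  obtain f k1 where f: "codes TYPE('a) f k1 (\<lambda>M e. val M e s)" using term_code by blast
  obtain g k2 where g: "codes TYPE('a) g k2 (\<lambda>M e. val M e t)" using term_code by blast
  \<comment> \<open>In a linear order s = t means that neither s < t nor t < s, that is, the two
    truth values add up to less than 1.\<close>
  have "codes TYPE('a) (LessX (AddX (LessX f g) (LessX g f)) OneX) (max k1 k2) (\<lambda>M e. tv M (sat M e (Equal s t)))"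
  proof (rule codesI)
    fix M :: "'a str" and k e v assume M: "PA_model M" and k: "max k1 k2 \<le> k"
    interpret PA_model M by fact
    note * = codesD[OF f M, of k] codesD[OF g M, of k]
    have less: "ls M x y \<Longrightarrow> \<not> ls M y x \<and> x \<noteq> y \<and> y \<noteq> x" for x y by auto
    show "evals M (LessX (AddX (LessX f g) (LessX g f)) OneX) (envc M k e) v \<longleftrightarrow> v = tv M (sat M e (Equal s t))"
      using k by (cases rule: R.linorder_cases[of "val M e s" "val M e t"]) (auto simp: * tv_def axioms(15) dest: less)
  qed
  then show ?case by blast
next
  case (2 s t)
  obtain f k1 where f: "codes TYPE('a) f k1 (\<lambda>M e. val M e s)" using term_code by blast
  obtain g k2 where g: "codes TYPE('a) g k2 (\<lambda>M e. val M e t)" using term_code by blast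
  have "codes TYPE('a) (LessX f g) (max k1 k2) (\<lambda>M e. tv M (sat M e (Less s t)))"
    by (rule codesI) (auto simp: codesD[OF f] codesD[OF g] tv_def)
  then show ?case by blast
next
  case 3
  have "codes TYPE('a) (LessX OneX OneX) 0 (\<lambda>M e. tv M (sat M e Falsum))"
    by (rule codesI) (simp add: PA_model.axioms(10) tv_def)
  then show ?case by blast
next
  case (4 \<phi> \<psi>)
  then obtain f k1 g k2 where f: "codes TYPE('a) f k1 (\<lambda>M e. tv M (sat M e \<phi>))"
    and g: "codes TYPE('a) g k2 (\<lambda>M e. tv M (sat M e \<psi>))" by blast
  \<comment> \<open>On truth values an implication is the inequality f < g + 1.\<close>
  have "codes TYPE('a) (LessX f (AddX g OneX)) (max k1 k2) (\<lambda>M e. tv M (sat M e (Imp \<phi> \<psi>)))"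
  proof (rule codesI)
    fix M :: "'a str" and k e v assume M: "PA_model M" and k: "max k1 k2 \<le> k"
    interpret PA_model M by fact
    show "evals M (LessX f (AddX g OneX)) (envc M k e) v \<longleftrightarrow> v = tv M (sat M e (Imp \<phi> \<psi>))"
      using k axioms(15) by (auto simp: codesD[OF f M] codesD[OF g M] tv_def le_iff)
  qed
  then show ?case by blast
next
  case (5 \<phi> t)
  obtain f k1 where f: "codes TYPE('a) f k1 (\<lambda>M e. val M e t)" using term_code by blast
  obtain g k2 where g: "codes TYPE('a) g k2 (\<lambda>M e. tv M (sat M e \<phi>))" using 5 by blast
  have "codes TYPE('a) (AllX f g) (max k1 k2) (\<lambda>M e. tv M (sat M e (BForall t \<phi>)))"
  proof (rule codesI)
    fix M :: "'a str" and k e v assume M: "PA_model M" and k: "max k1 k2 \<le> k"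
    interpret PA_model M by fact
    have "evals M g (pr M x (envc M k e)) v \<longleftrightarrow> v = tv M (sat M (x ## e) \<phi>)" for x v
      using codesD[OF g M, of "Suc k" "x ## e" v] k by simp
    then show "evals M (AllX f g) (envc M k e) v \<longleftrightarrow> v = tv M (sat M e (BForall t \<phi>))"
      using k axioms(10,15) by (auto simp: codesD[OF f M] tv_def)
  qed
  then show ?case by blast
next
  case (6 \<phi> t)
  obtain f k1 where f: "codes TYPE('a) f k1 (\<lambda>M e. val M e t)" using term_code by blast
  obtain g k2 where g: "codes TYPE('a) g k2 (\<lambda>M e. tv M (sat M e \<phi>))" using 6 by blast
  \<comment> \<open>Comparison with 1 negates a truth value, so this is the negation of a universal
    negation.\<close>
  let ?h = "LessX (AllX f (LessX g OneX)) OneX"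
  have "codes TYPE('a) ?h (max k1 k2) (\<lambda>M e. tv M (sat M e (BExists t \<phi>)))"
  proof (rule codesI)
    fix M :: "'a str" and k e v assume M: "PA_model M" and k: "max k1 k2 \<le> k"
    interpret PA_model M by fact
    have "evals M g (pr M x (envc M k e)) v \<longleftrightarrow> v = tv M (sat M (x ## e) \<phi>)" for x v
      using codesD[OF g M, of "Suc k" "x ## e" v] k by simp
    then show "evals M ?h (envc M k e) v \<longleftrightarrow> v = tv M (sat M e (BExists t \<phi>))"
      using k axioms(10,15) by (auto simp: codesD[OF f M] tv_def)
  qed
  then show ?case by blast
qed

text \<open>
  \<open>true_Sigma n\<close> and \<open>true_Pi n\<close> define truth of \<open>\<Sigma>\<^sub>n\<close> and \<open>\<Pi>\<^sub>n\<close> formulas. The code of a formula with an outer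
  block of length \<open>j\<close> contains the code of \<open>TlX ^^ j\<close>, whose evaluation strips \<open>j\<close> entries off the
  environment.
\<close>

fun true_Sigma true_Pi :: "nat \<Rightarrow> 'a str \<Rightarrow> 'a \<Rightarrow> 'a \<Rightarrow> bool" where
  "true_Sigma 0 M c e \<longleftrightarrow> certified M c e (un M)"
| "true_Pi 0 M c e \<longleftrightarrow> certified M c e (un M)"
| "true_Sigma (Suc n) M c e \<longleftrightarrow> (\<exists>t d e'. c = pr M t d \<and> certified M t e' e \<and> true_Pi n M d e')"
| "true_Pi (Suc n) M c e \<longleftrightarrow> (\<forall>t d e'. c = pr M t d \<and> certified M t e' e \<longrightarrow> true_Sigma n M d e')"

lemma arith_true_Sigma_true_Pi: "arith (\<lambda>(M :: 'a str) e. true_Sigma n M (e 0) (e 1))" "arith (\<lambda>(M :: 'a str) e. true_Pi n M (e 0) (e 1))"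
proof (induction n)
  case 0
  case 1 show ?case unfolding true_Sigma.simps by (intro arith_3[OF arith_certified] term_fn_intros)
  case 2 show ?case unfolding true_Pi.simps by (intro arith_3[OF arith_certified] term_fn_intros)
next
  case (Suc n)
  case 1 show ?case unfolding true_Sigma.simps by (intro arith_intros arith_3[OF arith_certified] arith_2[OF Suc.IH(2)] term_fn_pr)
  case 2 show ?case unfolding true_Pi.simps by (intro arith_intros arith_3[OF arith_certified] arith_2[OF Suc.IH(1)] term_fn_pr)
qed

lemma (in PA_model) evals_TlX_iter: "evals M ((TlX ^^ Suc j) EnvX) e v \<longleftrightarrow> (\<exists>x. evals M ((TlX ^^ j) EnvX) e (pr M x v))"
  by (induction j arbitrary: e) auto

text \<open>The environments e' from which j tails lead back to the given one are those with j
  entries prepended, so one quantifier over e' stands for the whole block. The length k varies in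
  the induction as each quantifier adds an entry.\<close>

lemma (in PA_model) Exists_iter:
  assumes "\<And>e k. k0 \<le> k \<Longrightarrow> Q (envc M k e) \<longleftrightarrow> sat M e \<phi>" and "k0 \<le> k"
  shows "sat M e ((Exists ^^ j) \<phi>) \<longleftrightarrow> (\<exists>e'. evals M ((TlX ^^ j) EnvX) e' (envc M k e) \<and> Q e')"
  using assms(2)
proof (induction j arbitrary: e k)
  case 0 then show ?case using assms(1) by auto
next
  case (Suc j)
  have "sat M e ((Exists ^^ Suc j) \<phi>) \<longleftrightarrow> (\<exists>x. sat M (x ## e) ((Exists ^^ j) \<phi>))" by simp
  also have "\<dots> \<longleftrightarrow> (\<exists>x e'. evals M ((TlX ^^ j) EnvX) e' (pr M x (envc M k e)) \<and> Q e')"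
    using Suc.IH[of "Suc k"] Suc.prems by simp
  finally show ?case unfolding evals_TlX_iter by blast
qed

lemma (in PA_model) Forall_iter:
  assumes "\<And>e k. k0 \<le> k \<Longrightarrow> Q (envc M k e) \<longleftrightarrow> sat M e \<phi>" and "k0 \<le> k"
  shows "sat M e ((Forall ^^ j) \<phi>) \<longleftrightarrow> (\<forall>e'. evals M ((TlX ^^ j) EnvX) e' (envc M k e) \<longrightarrow> Q e')"
  using assms(2)
proof (induction j arbitrary: e k)
  case 0 then show ?case using assms(1) by auto
next
  case (Suc j)
  have "sat M e ((Forall ^^ Suc j) \<phi>) \<longleftrightarrow> (\<forall>x. sat M (x ## e) ((Forall ^^ j) \<phi>))" by simp
  also have "\<dots> \<longleftrightarrow> (\<forall>x e'. evals M ((TlX ^^ j) EnvX) e' (pr M x (envc M k e)) \<longrightarrow> Q e')"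
    using Suc.IH[of "Suc k"] Suc.prems by simp
  finally show ?case unfolding evals_TlX_iter by blast
qed

text \<open>The code does not depend on the model: it is used both in the fixed model of T + A and
  in arbitrary models of T.\<close>

lemma Sigma_Pi_code:
  "\<phi> \<in> Sigma_fm n \<Longrightarrow> \<exists>c k0. \<forall>(M :: 'a str) k e. exp_model M \<longrightarrow> k0 \<le> k \<longrightarrow> (true_Sigma n M (nm M c) (envc M k e) \<longleftrightarrow> sat M e \<phi>)"
  "\<phi> \<in> Pi_fm n \<Longrightarrow> \<exists>c k0. \<forall>(M :: 'a str) k e. exp_model M \<longrightarrow> k0 \<le> k \<longrightarrow> (true_Pi n M (nm M c) (envc M k e) \<longleftrightarrow> sat M e \<phi>)"
proof (induction n arbitrary: \<phi>)
  case 0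
  have *: "\<exists>c k0. \<forall>(M :: 'a str) k e. exp_model M \<longrightarrow> k0 \<le> k \<longrightarrow> (certified M (nm M c) (envc M k e) (un M) \<longleftrightarrow> sat M e \<phi>)"
    if \<phi>: "\<phi> \<in> Delta0" for \<phi>
  proof -
    obtain f k0 where f: "codes TYPE('a) f k0 (\<lambda>M e. tv M (sat M e \<phi>))" using Delta0_code[OF \<phi>] by blast
    have "certified M (nm M (ecode f)) (envc M k e) (un M) \<longleftrightarrow> sat M e \<phi>" if "exp_model M" "k0 \<le> k" for M :: "'a str" and k e
    proof -
      interpret exp_model M by fact
      have "PA_model M" by unfold_locales
      then have "evals M f (envc M k e) (un M) \<longleftrightarrow> un M = tv M (sat M e \<phi>)" using codesD[OF f _ that(2)] by blast
      then show ?thesis using axioms(10,15) by (auto simp: certified_iff tv_def)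
    qed
    then show ?thesis by blast
  qed
  {
    case 1 then show ?case using * by simp
  next
    case 2 then show ?case using * by simp
  }
next
  case (Suc n)
  {
    case 1
    then obtain j \<psi> where \<psi>: "\<phi> = (Exists ^^ j) \<psi>" "\<psi> \<in> Pi_fm n" by auto
    then obtain d k0 where d: "\<forall>(M :: 'a str) k e. exp_model M \<longrightarrow> k0 \<le> k \<longrightarrow> (true_Pi n M (nm M d) (envc M k e) \<longleftrightarrow> sat M e \<psi>)"
      using Suc.IH(2) by blast
    have "true_Sigma (Suc n) M (nm M (pr std (ecode ((TlX ^^ j) EnvX)) d)) (envc M k e) \<longleftrightarrow> sat M e \<phi>"
      if "exp_model M" "k0 \<le> k" for M :: "'a str" and k e
    proof -
      interpret exp_model M by fact
      show ?thesis unfolding \<psi> using Exists_iter[of k0 "true_Pi n M (nm M d)" \<psi> k e j] d that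
        by (simp add: nm_pr certified_iff)
    qed
    then show ?case by blast
  next
    case 2
    then obtain j \<psi> where \<psi>: "\<phi> = (Forall ^^ j) \<psi>" "\<psi> \<in> Sigma_fm n" by auto
    then obtain d k0 where d: "\<forall>(M :: 'a str) k e. exp_model M \<longrightarrow> k0 \<le> k \<longrightarrow> (true_Sigma n M (nm M d) (envc M k e) \<longleftrightarrow> sat M e \<psi>)"
      using Suc.IH(1) by blast
    have "true_Pi (Suc n) M (nm M (pr std (ecode ((TlX ^^ j) EnvX)) d)) (envc M k e) \<longleftrightarrow> sat M e \<phi>"
      if "exp_model M" "k0 \<le> k" for M :: "'a str" and k e
    proof -
      interpret exp_model M by fact
      show ?thesis unfolding \<psi> using Forall_iter[of k0 "true_Sigma n M (nm M d)" \<psi> k e j] d that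
        by (simp add: nm_pr certified_iff)
    qed
    then show ?case by blast
  }
qed

definition true_code :: "nat \<Rightarrow> 'a str \<Rightarrow> 'a \<Rightarrow> bool" where
  "true_code n M x \<longleftrightarrow> (\<exists>c e. x = pr M c e \<and> true_Sigma n M c e)"

lemma arith_true_code: "arith (\<lambda>M e. true_code n M (e 0))"
  unfolding true_code_def by (intro arith_intros arith_2[OF arith_true_Sigma_true_Pi(1)] term_fn_pr)

lemma true_code_exists:
  assumes "\<phi> \<in> Sigma_fm n" "sentence \<phi>"
  shows "\<exists>c. \<forall>(M :: 'a str) e. exp_model M \<longrightarrow> (true_code n M (nm M c) \<longleftrightarrow> sat M e \<phi>)"
proof -
  obtain c k0 where c: "\<forall>(M :: 'a str) k e. exp_model M \<longrightarrow> k0 \<le> k \<longrightarrow> (true_Sigma n M (nm M c) (envc M k e) \<longleftrightarrow> sat M e \<phi>)"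
    using Sigma_Pi_code(1)[OF assms(1)] by blast
  \<comment> \<open>The code comprises an environment of k0 zeros: a sentence has the same truth
    value in every environment, but the environment must be long enough for the translated
    expressions.\<close>
  have "true_code n M (nm M (pr std c (envc std k0 (\<lambda>_. 0)))) \<longleftrightarrow> sat M e \<phi>" if "exp_model M" for M :: "'a str" and e
  proof -
    interpret exp_model M by fact
    have "nm M (envc std k (\<lambda>_. 0)) = envc M k (\<lambda>_. zr M)" for k by (induction k) (simp_all add: nm_pr)
    then have "true_code n M (nm M (pr std c (envc std k0 (\<lambda>_. 0)))) \<longleftrightarrow> sat M (\<lambda>_. zr M) \<phi>"
      using c that by (simp add: true_code_def nm_pr)
    then show ?thesis using sat_sentence[OF assms(2)] by blast
  qed
  then show ?thesis by blast
qed

section \<open>Incompleteness\<close>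

text \<open>In contrast to \<open>mem\<close>, only finite sets of standard numbers have to be
  coded, so the beta function suffices for the characteristic sequence. Its parameters are bounded
  by l, which makes the relation bounded and therefore absolute.\<close>

definition in_code :: "'a str \<Rightarrow> 'a \<Rightarrow> 'a \<Rightarrow> bool" where
  "in_code M c l \<longleftrightarrow> (\<exists>a. le M a l \<and> (\<exists>b. le M b l \<and> (\<exists>q. le M q l \<and>
    l = pr M a (pr M b q) \<and> ls M c q \<and> beta_rel M a b c (un M))))"

definition all_true :: "nat \<Rightarrow> 'a str \<Rightarrow> 'a \<Rightarrow> bool" where
  "all_true n M l \<longleftrightarrow> (\<forall>c. in_code M c l \<longrightarrow> true_code n M c)"

lemma delta0_in_code: "delta0 (\<lambda>M e. in_code M (e 0) (e 1))"
  unfolding in_code_def beta_rel_def le_def by (intro delta0_intros term_fn_pr)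

lemma arith_all_true: "arith (\<lambda>M e. all_true n M (e 0))"
proof -
  have true_code: "arith (\<lambda>M e. true_code n M (f M e))" if "term_fn f" for f :: "'a str \<Rightarrow> (nat \<Rightarrow> 'a) \<Rightarrow> 'a"
    using arith_subst[OF arith_true_code, of "\<lambda>M e _. f M e"] that by simp
  show ?thesis unfolding all_true_def
    by (intro arith_intros true_code arith_2[OF delta0_arith[OF delta0_in_code]])
qed

lemma beta_rel_std: "beta_rel std a b i r \<longleftrightarrow> r = beta a b i"
proof -
  let ?m = "Suc (Suc i * b)"
  have "beta_rel std a b i r \<longleftrightarrow> r < ?m \<and> (\<exists>k<Suc a. a = k * ?m + r)" by (simp add: beta_rel_def)
  moreover have "(\<exists>k<Suc a. a = k * ?m + r) \<longleftrightarrow> (\<exists>k. a = k * ?m + r)"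
  proof
    assume "\<exists>k. a = k * ?m + r"
    then obtain k where k: "a = k * ?m + r" ..
    have "k * 1 \<le> k * ?m" by (rule mult_le_mono2) simp
    then have "k < Suc a" using k by linarith
    then show "\<exists>k<Suc a. a = k * ?m + r" using k by blast
  qed blast
  ultimately show ?thesis by (simp only: beta_graph)
qed

lemma in_code_std_exists:
  assumes "finite C" shows "\<exists>l. \<forall>c. in_code std c l \<longleftrightarrow> c \<in> C"
proof -
  obtain q where q: "\<forall>c\<in>C. c < q" using assms by (metis finite_nat_set_iff_bounded)
  obtain a b where ab: "\<forall>i<q. beta a b i = (if i \<in> C then 1 else 0)"
    using beta_exists[of q "\<lambda>i. if i \<in> C then 1 else 0"] by blast
  have "in_code std c (pr std a (pr std b q)) \<longleftrightarrow> c \<in> C" for c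
  proof -
    have "in_code std c (pr std a (pr std b q)) \<longleftrightarrow> c < q \<and> beta_rel std a b c 1"
      using PA_model.pr_eq_iff[OF PA_model_std] le_pr_std le_pr_pr_std by (auto simp: in_code_def)
    then show ?thesis using q ab by (auto simp: beta_rel_std split: if_splits)
  qed
  then show ?thesis by blast
qed

text \<open>A member is below q and q is at most l, so a standard code acquires no nonstandard
  members in M.\<close>

lemma in_code_nm:
  fixes M :: "nat str"
  assumes "PA_model M"
  shows "in_code M x (nm M l) \<longleftrightarrow> (\<exists>c. x = nm M c \<and> in_code std c l)"
proof -
  interpret PA_model M by fact
  have abs: "in_code M (nm M c) (nm M l) \<longleftrightarrow> in_code std c l" for c
    using delta0_absolute[OF delta0_in_code assms, of "c ## (\<lambda>_. l)"] by simp
  have "\<exists>c. x = nm M c" if "in_code M x (nm M l)"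
    using that le_nmD less_nmD unfolding in_code_def by metis
  then show ?thesis using abs by blast
qed

lemma all_true_nm:
  fixes M :: "nat str"
  assumes "PA_model M"
  shows "all_true n M (nm M l) \<longleftrightarrow> (\<forall>c. in_code std c l \<longrightarrow> true_code n M (nm M c))"
  unfolding all_true_def in_code_nm[OF assms] by blast

text \<open>A quantified equation replaces the substitution of the numeral, so that the code of the
  result is obtained by pairing alone.\<close>

definition at_num :: "fm \<Rightarrow> nat \<Rightarrow> fm" where
  "at_num \<phi> k = Forall (Imp (Equal (Var 0) (num k)) \<phi>)"

lemma sat_num_inst [simp]: "sat M e (at_num \<phi> k) \<longleftrightarrow> sat M (nm M k ## e) \<phi>"
  by (simp add: at_num_def)

lemma sentence_num_inst: "closed_fm 1 \<phi> \<Longrightarrow> sentence (at_num \<phi> k)"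
proof -
  have "closed_tm m (num k)" for m by (induction k) auto
  then show "closed_fm 1 \<phi> \<Longrightarrow> sentence (at_num \<phi> k)" by (simp add: at_num_def sentence_def)
qed

definition at_code :: "nat \<Rightarrow> nat \<Rightarrow> nat" where
  "at_code c k = pe 4 (pe 3 (pe (pe 0 (pe (pe 0 0) (tm_code (num k)))) c))"

lemma fm_code_num_inst: "fm_code (at_num \<phi> k) = at_code (fm_code \<phi>) k"
  by (simp add: at_num_def at_code_def)

text \<open>Any further free variables of the defining formula are replaced by \<open>Zero\<close>,
  which is harmless since P depends on variable 0 only.\<close>

lemma arith_unary:
  assumes "arith (\<lambda>M e. P M (e 0))"
  shows "\<exists>\<phi>. closed_fm 1 \<phi> \<and> (\<forall>M e. sat M e \<phi> \<longleftrightarrow> P M (e 0))"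
proof -
  obtain \<phi> where \<phi>: "\<forall>M e. sat M e \<phi> \<longleftrightarrow> P M (e 0)" using assms unfolding arith_def by blast
  obtain k where "closed_fm k \<phi>" using closed_fm_ex by blast
  then have "closed_fm 1 (subst_fm (Var 0 ## (\<lambda>_. Zero)) \<phi>)"
    by (rule closed_fm_subst) (auto split: nat.splits)
  moreover have "sat M e (subst_fm (Var 0 ## (\<lambda>_. Zero)) \<phi>) \<longleftrightarrow> P M (e 0)" for M e
    using \<phi> by simp
  ultimately show ?thesis by blast
qed

lemma exp_model_model:
  fixes M :: "nat str"
  assumes T: "\<forall>\<phi>\<in>T. sentence \<phi>" and ext: "extends T (IDelta0 \<union> {Exp})" and M: "\<forall>\<phi>\<in>T. sat M e \<phi>"
  shows "exp_model M"
proof (rule exp_model_intro)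
  fix \<phi> e' assume "\<phi> \<in> IDelta0 \<union> {Exp}"
  then have "T \<turnstile> \<phi>" using ext unfolding extends_def by blast
  moreover have "\<forall>\<phi>\<in>T. sat M e' \<phi>" using T M sat_sentence by blast
  ultimately show "sat M e' \<phi>" by (rule soundness)
qed

text \<open>
  \<open>witnessed Q n M x f\<close>: below \<open>x\<close> there are a witness for \<open>Q\<close> and a set of \<open>\<Sigma>\<^sub>n\<close> sentences, all true
  in \<open>M\<close>, to which it applies.
\<close>

definition witnessed :: "('a str \<Rightarrow> (nat \<Rightarrow> 'a) \<Rightarrow> bool) \<Rightarrow> nat \<Rightarrow> 'a str \<Rightarrow> 'a \<Rightarrow> 'a \<Rightarrow> bool" where
  "witnessed Q n M x f \<longleftrightarrow> (\<exists>z. ls M z x \<and> (\<exists>l. ls M l x \<and> Q M (z ## l ## f ## (\<lambda>_. zr M)) \<and> all_true n M l))"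

lemma arith_witnessed:
  fixes Q :: "'a str \<Rightarrow> (nat \<Rightarrow> 'a) \<Rightarrow> bool"
  assumes "delta0 Q" shows "arith (\<lambda>M e. witnessed Q n M (e 0) (e 1))"
proof -
  have all_true: "arith (\<lambda>M e. all_true n M (f M e))" if "term_fn f" for f :: "'a str \<Rightarrow> (nat \<Rightarrow> 'a) \<Rightarrow> 'a"
    using arith_subst[OF arith_all_true, of "\<lambda>M e _. f M e"] that by simp
  show ?thesis unfolding witnessed_def
    by (intro arith_intros all_true delta0_arith[OF delta0_subst[OF assms]])
qed

text \<open>Below a standard bound z and l are both standard, so \<open>Q\<close> may be evaluated
  in the standard model, and l codes a genuine finite set.\<close>

lemma witnessed_nm:
  fixes M :: "nat str"
  assumes "delta0 Q" "PA_model M"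
  shows "witnessed Q n M (nm M x) (nm M f) \<longleftrightarrow>
    (\<exists>z<x. \<exists>l<x. Q std (z ## l ## f ## (\<lambda>_. 0)) \<and> all_true n M (nm M l))"
proof -
  interpret PA_model M by fact
  have "Q M (nm M z ## nm M l ## nm M f ## (\<lambda>_. zr M)) \<longleftrightarrow> Q std (z ## l ## f ## (\<lambda>_. 0))" for z l
  proof -
    have "nm M z ## nm M l ## nm M f ## (\<lambda>_. zr M) = (\<lambda>n. nm M ((z ## l ## f ## (\<lambda>_. 0)) n))"
      by (auto simp: fun_eq_iff split: nat.splits)
    then show ?thesis using delta0_absolute[OF assms] by simp
  qed
  then show ?thesis unfolding witnessed_def ex_less_nm by simp
qed

lemma (in PA_model) witnessed_mono: "witnessed Q n M x f \<Longrightarrow> x \<preceq> y \<Longrightarrow> witnessed Q n M y f"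
  unfolding witnessed_def using R.less_le_trans by blast

text \<open>\<open>Suc (pe c 0)\<close> is the code of a context with one formula. The parameter f
  supplies both the formula, through h, and the numeral at which it is taken; h will be the identity
  and the code of negation.\<close>

lemma sigma1_provable:
  assumes "sigma1 (\<lambda>e. e 0 \<in> W)" "sigma1 (\<lambda>e. e 0 = h (e 1))"
  shows "\<exists>Q. delta0 Q \<and> (\<forall>l f. prov_code W (Suc (pe (at_code s l) 0)) (at_code (h f) f) \<longleftrightarrow>
    (\<exists>z. Q std (z ## l ## f ## (\<lambda>_. 0))))"
proof -
  have sig_fun: "sig_fun (\<lambda>e. at_code (f e) (g e))" if "sig_fun f" "sig_fun g" for f g
    unfolding at_code_def by (intro sigma1_intros sig_fun_num that)
  have "sigma1 (\<lambda>e. prov_code W (Suc (pe (at_code s (e 0)) 0)) (at_code (h (e 1)) (e 1)))"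
    by (intro sigma1_2[OF sigma1_prov_code[OF assms(1)]] sig_fun sigma1_intros sig_fun_1[OF assms(2)])
  then obtain Q where "delta0 Q" and Q: "\<forall>e. prov_code W (Suc (pe (at_code s (e 0)) 0)) (at_code (h (e 1)) (e 1)) \<longleftrightarrow>
    (\<exists>z. Q std (z ## e))" unfolding sigma1_def by blast
  have "prov_code W (Suc (pe (at_code s l) 0)) (at_code (h f) f) \<longleftrightarrow> (\<exists>z. Q std (z ## l ## f ## (\<lambda>_. 0)))" for l f
    using Q[rule_format, of "l ## f ## (\<lambda>_. 0)"] by simp
  then show ?thesis using \<open>delta0 Q\<close> by blast
qed

theorem mainTheorem4:
  fixes T A :: "fm set" and n :: nat
  assumes T_sentences: "\<forall>\<phi>\<in>T. sentence \<phi>"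
    and T_ce: "computably_enumerable T"
    and T_extends: "extends T (IDelta0 \<union> {Exp})"
    and A_sentences: "\<forall>\<phi>\<in>A. sentence \<phi>"
    and A_Sigma: "A \<subseteq> Sigma_fm n"
    and consistent: "consistent (T \<union> A)"
  shows "incomplete (T \<union> A)"
proof (rule ccontr)
  assume "\<not> incomplete (T \<union> A)"
  then have complete: "T \<union> A \<turnstile> \<psi> \<or> T \<union> A \<turnstile> Neg \<psi>" if "sentence \<psi>" for \<psi>
    using that unfolding incomplete_def by blast
  have ext: "extends (T \<union> B) PA_minus" for B
    using T_extends weakening[of T _ "T \<union> B"] unfolding extends_def IDelta0_def by blast
  obtain M :: "nat str" and e where "\<forall>\<phi>\<in>T \<union> A. sat M e \<phi>"
    using model_existence[OF _ consistent ext] T_sentences A_sentences by blast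
  then have M: "\<forall>\<phi>\<in>T \<union> A. sat M e \<phi>" for e
    using T_sentences A_sentences sat_sentence by blast
  interpret exp_model M by (rule exp_model_model[OF T_sentences T_extends]) (use M in blast)
  have pamM: "PA_model M" by unfold_locales

  obtain S where S: "closed_fm 1 S" "\<And>(N :: nat str) e. sat N e S \<longleftrightarrow> all_true n N (e 0)"
    using arith_unary[OF arith_all_true] by blast
  have sent: "\<forall>\<phi>\<in>T \<union> {at_num S l}. sentence \<phi>" for l using T_sentences sentence_num_inst[OF S(1)] by blast

  \<comment> \<open>Passing to a semantic consequence \<open>\<psi>'\<close> is needed below,
    because \<open>Neg (at_num D d)\<close> and \<open>at_num (Neg D) d\<close> are equivalent but
    different formulas.\<close>
  have finite_part: "\<exists>l. all_true n M (nm M l) \<and> T \<union> {at_num S l} \<turnstile> \<psi>'"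
    if \<psi>: "T \<union> A \<turnstile> \<psi>" "sentence \<psi>'" "\<And>(N :: nat str) e. sat N e \<psi> \<Longrightarrow> sat N e \<psi>'" for \<psi> \<psi>'
  proof -
    obtain F where F: "finite F" "F \<subseteq> T \<union> A" "F \<turnstile> \<psi>" using compactness[OF \<psi>(1)] by blast
    have "\<forall>\<sigma>\<in>A. \<exists>c. \<forall>(N :: nat str) e. exp_model N \<longrightarrow> (true_code n N (nm N c) \<longleftrightarrow> sat N e \<sigma>)"
      using true_code_exists A_Sigma A_sentences by blast
    from bchoice[OF this] obtain c where
      "\<forall>\<sigma>\<in>A. \<forall>(N :: nat str) e. exp_model N \<longrightarrow> (true_code n N (nm N (c \<sigma>)) \<longleftrightarrow> sat N e \<sigma>)" by blast
    then have c: "true_code n N (nm N (c \<sigma>)) \<longleftrightarrow> sat N e \<sigma>" if "\<sigma> \<in> A" "exp_model N" for \<sigma> and N :: "nat str" and e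
      using that by blast
    have "finite (c ` (F \<inter> A))" using F(1) by simp
    from in_code_std_exists[OF this] obtain l where l: "\<forall>k. in_code std k l \<longleftrightarrow> k \<in> c ` (F \<inter> A)" ..
    have "all_true n M (nm M l)"
      unfolding all_true_nm[OF pamM]
    proof (intro allI impI)
      fix k assume "in_code std k l"
      then obtain \<sigma> where "\<sigma> \<in> A" "k = c \<sigma>" using l by blast
      then show "true_code n M (nm M k)" using c[OF _ exp_model_axioms, of \<sigma> "\<lambda>_. 0"] M by blast
    qed
    \<comment> \<open>In an arbitrary model of T and this instance of S, the codes in l force the
      sentences of F taken from A to hold; completeness then yields a derivation that assumes none
      of them.\<close>
    moreover have "T \<union> {at_num S l} \<turnstile> \<psi>'"
    proof (rule completeness[OF sent ext \<psi>(2)])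
      fix N :: "nat str" and e assume N: "\<forall>\<phi>\<in>T \<union> {at_num S l}. sat N e \<phi>"
      have exp_model: "exp_model N" by (rule exp_model_model[OF T_sentences T_extends]) (use N in blast)
      then have "PA_model N" by (simp add: exp_model_def)
      moreover have "all_true n N (nm N l)" using N S(2) by simp
      ultimately have "\<forall>\<sigma>\<in>F \<inter> A. true_code n N (nm N (c \<sigma>))" using l by (simp add: all_true_nm)
      then have "\<forall>\<sigma>\<in>F \<inter> A. sat N e \<sigma>" using c[OF _ exp_model] by blast
      then have "\<forall>\<sigma>\<in>F. sat N e \<sigma>" using F(2) N by blast
      then show "sat N e \<psi>'" using soundness[OF F(3)] \<psi>(3) by blast
    qed
    ultimately show ?thesis by blast
  qed

  let ?W = "fm_code ` T"
  have W: "sigma1 (\<lambda>e. e 0 \<in> ?W)" using T_ce sigma1_ce unfolding computably_enumerable_def by blast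
  have prov_code: "prov_code ?W (Suc (pe (at_code (fm_code S) l) 0)) (at_code (fm_code \<phi>) k) \<longleftrightarrow> T \<union> {at_num S l} \<turnstile> at_num \<phi> k" for \<phi> l k
    using prov_code_iff[OF T_sentences, of "[at_num S l]" "at_num \<phi> k"] by (simp add: fm_code_num_inst)
  \<comment> \<open>\<open>at_code f f\<close> takes the formula with code f at its own code, so a
    self-referential sentence arises simply by choosing f as the code of the formula defined from P
    and Q.\<close>
  obtain P where P: "delta0 P" "\<And>l f. prov_code ?W (Suc (pe (at_code (fm_code S) l) 0)) (at_code f f) \<longleftrightarrow>
      (\<exists>z. P std (z ## l ## f ## (\<lambda>_. 0)))"
    using sigma1_provable[OF W, of "\<lambda>f. f"] sigma1_eq[OF sig_fun_var sig_fun_var] by blast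
  have "sigma1 (\<lambda>e. e 0 = pe 3 (pe (e 1) (pe 2 0)))" by (intro sigma1_intros)
  then obtain Q where Q: "delta0 Q" "\<And>l f. prov_code ?W (Suc (pe (at_code (fm_code S) l) 0)) (at_code (pe 3 (pe f (pe 2 0))) f) \<longleftrightarrow>
      (\<exists>z. Q std (z ## l ## f ## (\<lambda>_. 0)))"
    using sigma1_provable[OF W, of "\<lambda>f. pe 3 (pe f (pe 2 0))"] by blast

  \<comment> \<open>Rosser's form: at every bound where the diagonal sentence has a witnessed
    derivation, its negation has one as well.\<close>
  have "arith (\<lambda>N e. \<not> (\<exists>x. witnessed P n N x (e 0) \<and> \<not> witnessed Q n N x (e 0)))"
    by (intro arith_intros arith_2[OF arith_witnessed[OF P(1)]] arith_2[OF arith_witnessed[OF Q(1)]])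
  from arith_unary[OF this] obtain D where D: "closed_fm 1 D"
    "\<And>(N :: nat str) e. sat N e D \<longleftrightarrow> \<not> (\<exists>x. witnessed P n N x (e 0) \<and> \<not> witnessed Q n N x (e 0))" by blast
  define d where "d = fm_code D"
  have Pd: "T \<union> {at_num S l} \<turnstile> at_num D d \<longleftrightarrow> (\<exists>z. P std (z ## l ## d ## (\<lambda>_. 0)))" for l
    unfolding P(2)[symmetric] d_def prov_code ..
  \<comment> \<open>\<open>Neg D\<close> is an implication to \<open>Falsum\<close>, so its code is
    the pairing with tags 3 and 2 in the definition of Q.\<close>
  have Qd: "T \<union> {at_num S l} \<turnstile> at_num (Neg D) d \<longleftrightarrow> (\<exists>z. Q std (z ## l ## d ## (\<lambda>_. 0)))" for l
    using Q(2)[of l d] prov_code[of l "Neg D" d] by (simp add: d_def)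
  have true: "sat M e \<phi>" if "T \<union> {at_num S l} \<turnstile> \<phi>" "all_true n M (nm M l)" for \<phi> l e
    by (rule soundness[OF that(1)]) (use M S(2) that(2) in auto)
  have witI: "\<exists>x. witnessed R n M (nm M x) (nm M d)"
    if "delta0 R" "R std (z ## l ## d ## (\<lambda>_. 0))" "all_true n M (nm M l)" for R z l
  proof -
    have "z < Suc (z + l)" "l < Suc (z + l)" by simp_all
    then show ?thesis unfolding witnessed_nm[OF that(1) pamM] using that(2,3) by blast
  qed
  have D_iff: "sat M e (at_num D d) \<longleftrightarrow> \<not> (\<exists>x. witnessed P n M x (nm M d) \<and> \<not> witnessed Q n M x (nm M d))" for e
    using D(2) by simp
  have sD: "sentence (at_num D d)" "sentence (at_num (Neg D) d)" using sentence_num_inst D(1) by simp_all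

  show False
  proof (cases "sat M (\<lambda>_. 0) (at_num D d)")
    case True
    have "\<not> T \<union> A \<turnstile> Neg (at_num D d)" using soundness[of "T \<union> A" "Neg (at_num D d)" M "\<lambda>_. 0"] M True by auto
    then have "T \<union> A \<turnstile> at_num D d" using complete[OF sD(1)] by blast
    then obtain l where l: "all_true n M (nm M l)" "T \<union> {at_num S l} \<turnstile> at_num D d"
      using finite_part[OF _ sD(1)] by blast
    then obtain x where "witnessed P n M (nm M x) (nm M d)" using witI[OF P(1)] Pd by blast
    \<comment> \<open>The bound x is standard, so the negation has a standard witness: it is
      derivable from T and a true instance of S, hence true in M.\<close>
    then have "witnessed Q n M (nm M x) (nm M d)" using True D_iff by blast
    then obtain z l' where "Q std (z ## l' ## d ## (\<lambda>_. 0))" "all_true n M (nm M l')"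
      unfolding witnessed_nm[OF Q(1) pamM] by blast
    then have "sat M (\<lambda>_. 0) (at_num (Neg D) d)" using Qd true by blast
    then show False using True by simp
  next
    case False
    have "\<not> T \<union> A \<turnstile> at_num D d" using soundness[of "T \<union> A" "at_num D d" M "\<lambda>_. 0"] M False by auto
    then have "T \<union> A \<turnstile> Neg (at_num D d)" using complete[OF sD(1)] by blast
    then obtain l where l: "all_true n M (nm M l)" "T \<union> {at_num S l} \<turnstile> at_num (Neg D) d"
      using finite_part[of "Neg (at_num D d)" "at_num (Neg D) d", OF _ sD(2)] by auto
    then obtain x where x: "witnessed Q n M (nm M x) (nm M d)" using witI[OF Q(1)] Qd by blast
    obtain y where y: "witnessed P n M y (nm M d)" "\<not> witnessed Q n M y (nm M d)" using False D_iff by blast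
    \<comment> \<open>Witnessing is monotone in the bound, so a y without a witness for Q lies below
      the standard x. Thus y is standard and its witness for P yields a genuine derivation.\<close>
    have "ls M y (nm M x)" using x y(2) witnessed_mono R.not_less by blast
    then obtain k where "y = nm M k" using less_nmD by blast
    then have "witnessed P n M (nm M k) (nm M d)" using y(1) by simp
    then obtain z l' where "P std (z ## l' ## d ## (\<lambda>_. 0))" "all_true n M (nm M l')"
      unfolding witnessed_nm[OF P(1) pamM] by blast
    then have "sat M (\<lambda>_. 0) (at_num D d)" using Pd true by blast
    then show False using False by simp
  qed
qed

end
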